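(* Let $k$ be a field of characteristic zero and let $(A,x)$ be a pair consisting either of a discrete valuation ring $A$ with uniformizing parameter $x$ and residue field $k$, or of the polynomial ring $A=k[x]$ and its variable $x$; let $X=\mathrm{Spec}(A)$. Two $(A,x)$-labelled trees $\gamma$ and $\gamma'$ define $X$-isomorphic Danielewski-Fieseler surfaces $S(\gamma)$ and $S(\gamma')$ if and only if they are equivalent.
   Context: Trees. A (rooted) tree $\Gamma$ is a nonempty finite poset with a unique minimal element $e_0$ (the root) such that $(\downarrow e)_\Gamma=\{e'\in\Gamma: e'\le e\}$ is a chain for every $e\in\Gamma$. An element $e$ is at level $m$ if $\mathrm{Card}((\downarrow e)_\Gamma)=m+1$. Leaves are the maximal elements; $L(\Gamma)$ denotes the set of leaves. The children of a non-leaf $e$ are the minimal elements of $\{e'\in\Gamma:e'>e\}$. The first common ancestor of $e,e'\in\Gamma\setminus\{e_0\}$ is the maximal element of the chain $((\downarrow e)_\Gamma\setminus\{e\})\cap((\downarrow e')_\Gamma\setminus\{e'\})$. An isomorphism of trees is an isomorphism of posets. Labelled trees. An $(A,x)$-labelled tree is a pair $\gamma=(\Gamma,\sigma)$ of a tree $\Gamma$ with leaves $e_1,\ldots,e_n$ at levels $m_1,\ldots,m_n$ and a cochain $\sigma=(\sigma_i)\in A^n$ which is $\Gamma$-compatible: for all $i\ne j$, $\sigma_j-\sigma_i\in x^{d_{ij}}A\setminus x^{d_{ij}+1}A$, where $d_{ij}<\min(m_i,m_j)$ is the level of the first common ancestor of $e_i$ and $e_j$. The surface $S(\gamma)$. $S(\gamma)$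 is the $X$-scheme obtained by gluing $n$ copies $\mathrm{Spec}(A[T_i])$ of $\mathbb{A}^1_X$ over $X_*=\mathrm{Spec}(A_x)$ by means of the $A_x$-algebra isomorphisms $A_x[T_i]\to A_x[T_j]$, $T_i\mapsto x^{-m_i}(\sigma_j-\sigma_i)+x^{m_j-m_i}T_j$, $i\neq j$. Essential subtrees and equivalence. A labelled tree is essential if its root does not have exactly one child. The essential subtree $\mathrm{Es}(\Gamma)$ of $\Gamma$ is the subtree $\{e\in\Gamma: e\ge\tilde e_0\}$, where $\tilde e_0$ is the unique leaf of $\Gamma$ if $\Gamma$ is a chain, and the first common ancestor of all the leaves of $\Gamma$ otherwise. Let $m$ be the level of $\tilde e_0$ in $\Gamma$. An essential cochain for $\gamma=(\Gamma,\sigma)$ is an $\mathrm{Es}(\Gamma)$-compatible cochain $\mathrm{Es}(\sigma)=(\tilde\sigma_i)_{i=1,\ldots,n}\in A^n$ for which there is $c\in A$ with $\sigma_i=c+x^m\tilde\sigma_i$ for every $i$. Two labelled trees $\gamma=(\Gamma,\sigma)$ and $\gamma'=(\Gamma',\sigma')$ are equivalent if there exist essential cochains $\mathrm{Es}(\sigma)$ and $\mathrm{Es}(\sigma')$ for them, an isomorphism of trees $\tau:\mathrm{Es}(\Gamma')\to\mathrm{Es}(\Gamma)$ and a pair $(a,b)\in A^*\times A$ such that $a\,\mathrm{Es}(\sigma')_i-\mathrm{Es}(\sigma)_{j(i)}+b\in x^{m_{j(i)}}A$ whenever the leaf $e_{j(i)}$ of $\mathrm{Es}(\Gamma)$, at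 level $m_{j(i)}$ in $\mathrm{Es}(\Gamma)$, is the image by $\tau$ of the leaf $e'_i$ of $\mathrm{Es}(\Gamma')$. *)

theory Defs
  imports
    "HOL-Algebra.Algebraic_Closure_Type"
    "HOL-Analysis.Abstract_Topology"
    "HOL-Computational_Algebra.Polynomial_Factorial"
begin

section \<open>Ringed spaces\<close>

record ('p, 's) ringed_space =
  space_top :: "'p topology"
  sections :: "'p set \<Rightarrow> 's ring"
  restr :: "'p set \<Rightarrow> 'p set \<Rightarrow> 's \<Rightarrow> 's"

text \<open>
  A map of ringed spaces consists of a map on points and of a family of maps on sections
  that is contravariant: an open set \<open>V\<close> of the target is sent to a map from the sections
  over \<open>V\<close> to the sections over the preimage of \<open>V\<close>.
\<close>

record ('p, 's, 'q, 't) space_map =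
  on_points :: "'p \<Rightarrow> 'q"
  on_sections :: "'q set \<Rightarrow> 't \<Rightarrow> 's"

abbreviation points :: "('p, 's) ringed_space \<Rightarrow> 'p set"
  where "points S \<equiv> topspace (space_top S)"

definition preim :: "('p, 's) ringed_space \<Rightarrow> ('p, 's, 'q, 't) space_map \<Rightarrow> 'q set \<Rightarrow> 'p set"
  where "preim S f V = {p \<in> points S. on_points f p \<in> V}"

definition germ_invertible :: "('p, 's) ringed_space \<Rightarrow> 'p set \<Rightarrow> 's \<Rightarrow> 'p \<Rightarrow> bool"
  where "germ_invertible S U s p \<longleftrightarrow>
    (\<exists>W. openin (space_top S) W \<and> p \<in> W \<and> W \<subseteq> U \<and> restr S U W s \<in> Units (sections S W))"

text \<open>
  Morphisms of locally ringed spaces. The last condition says that the ring homomorphisms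
  induced on stalks are local, i.e. that they reflect invertibility.
\<close>

definition lrs_morphism ::
    "('p, 's) ringed_space \<Rightarrow> ('q, 't) ringed_space \<Rightarrow> ('p, 's, 'q, 't) space_map \<Rightarrow> bool"
  where "lrs_morphism S Y f \<longleftrightarrow>
    continuous_map (space_top S) (space_top Y) (on_points f) \<and>
    (\<forall>V. openin (space_top Y) V \<longrightarrow>
      on_sections f V \<in> ring_hom (sections Y V) (sections S (preim S f V))) \<and>
    (\<forall>V W. openin (space_top Y) V \<and> openin (space_top Y) W \<and> W \<subseteq> V \<longrightarrow>
      (\<forall>t \<in> carrier (sections Y V).
        on_sections f W (restr Y V W t) =
          restr S (preim S f V) (preim S f W) (on_sections f V t))) \<and>
    (\<forall>V. openin (space_top Y) V \<longrightarrow>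
      (\<forall>t \<in> carrier (sections Y V). \<forall>p \<in> preim S f V.
        germ_invertible S (preim S f V) (on_sections f V t) p \<longrightarrow>
          germ_invertible Y V t (on_points f p)))"

definition id_map :: "('p, 's, 'p, 's) space_map"
  where "id_map = \<lparr>on_points = (\<lambda>p. p), on_sections = (\<lambda>V s. s)\<rparr>"

text \<open>The composite of \<open>f\<close> from \<open>S\<close> to \<open>Y\<close> with \<open>g\<close> from \<open>Y\<close> to some \<open>Z\<close>.\<close>

definition comp_map :: "('q, 't) ringed_space \<Rightarrow> ('q, 't, 'r, 'u) space_map \<Rightarrow>
    ('p, 's, 'q, 't) space_map \<Rightarrow> ('p, 's, 'r, 'u) space_map"
  where "comp_map Y g f =
    \<lparr>on_points = (\<lambda>p. on_points g (on_points f p)),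
     on_sections = (\<lambda>V t. on_sections f (preim Y g V) (on_sections g V t))\<rparr>"

text \<open>Equality of maps, ignoring their values outside of the points, open sets and sections.\<close>

definition same_map :: "('p, 's) ringed_space \<Rightarrow> ('q, 't) ringed_space \<Rightarrow>
    ('p, 's, 'q, 't) space_map \<Rightarrow> ('p, 's, 'q, 't) space_map \<Rightarrow> bool"
  where "same_map S Y f g \<longleftrightarrow>
    (\<forall>p \<in> points S. on_points f p = on_points g p) \<and>
    (\<forall>V. openin (space_top Y) V \<longrightarrow>
      (\<forall>t \<in> carrier (sections Y V). on_sections f V t = on_sections g V t))"

definition isomorphic_over :: "('x, 'r) ringed_space \<Rightarrow>
    ('p, 's) ringed_space \<Rightarrow> ('p, 's, 'x, 'r) space_map \<Rightarrow>
    ('q, 't) ringed_space \<Rightarrow> ('q, 't, 'x, 'r) space_map \<Rightarrow> bool"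
  where "isomorphic_over B S \<pi> S' \<pi>' \<longleftrightarrow>
    (\<exists>f g. lrs_morphism S S' f \<and> lrs_morphism S' S g \<and>
      same_map S B (comp_map S' \<pi>' f) \<pi> \<and>
      same_map S' B (comp_map S \<pi> g) \<pi>' \<and>
      same_map S S (comp_map S' g f) id_map \<and>
      same_map S' S' (comp_map S f g) id_map)"

section \<open>Spectra of integral domains\<close>

text \<open>
  The domains considered are subrings \<open>R\<close> of (the carrier type of) an integral domain. Their
  localizations are realized inside the fraction field of the latter.
\<close>

definition subring_of_type :: "'r::idom set \<Rightarrow> 'r ring"
  where "subring_of_type R = ring_of_type_algebra\<lparr>carrier := R\<rparr>"

definition primes :: "'r::idom set \<Rightarrow> 'r set set"
  where "primes R = {P. primeideal P (subring_of_type R)}"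

definition zariski_open :: "'r::idom set \<Rightarrow> 'r set set \<Rightarrow> bool"
  where "zariski_open R U \<longleftrightarrow> (\<exists>E \<subseteq> R. U = {P \<in> primes R. \<not> E \<subseteq> P})"

lemma istopology_zariski: "istopology (zariski_open R)"
  unfolding istopology_def
proof (intro conjI allI impI)
  fix S T assume "zariski_open R S" "zariski_open R T"
  then obtain E F where E: "E \<subseteq> R" "S = {P \<in> primes R. \<not> E \<subseteq> P}"
    and F: "F \<subseteq> R" "T = {P \<in> primes R. \<not> F \<subseteq> P}"
    by (auto simp: zariski_open_def)
  let ?G = "{a * b |a b. a \<in> E \<and> b \<in> F} \<inter> R"
  have "\<not> ?G \<subseteq> P \<longleftrightarrow> \<not> E \<subseteq> P \<and> \<not> F \<subseteq> P" if "P \<in> primes R" for P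
  proof -
    from that interpret primeideal P "subring_of_type R"
      by (simp add: primes_def)
    have mem: "a * b \<in> R" if "a \<in> R" "b \<in> R" for a b
      using m_closed[of a b] that by (simp add: subring_of_type_def ring_of_type_algebra_def)
    have pr: "a \<in> P \<or> b \<in> P" if "a \<in> R" "b \<in> R" "a * b \<in> P" for a b
      using I_prime[of a b] that by (simp add: subring_of_type_def ring_of_type_algebra_def)
    have l: "a * b \<in> P" if "a \<in> P" "b \<in> R" for a b
      using I_r_closed[of a b] that by (simp add: subring_of_type_def ring_of_type_algebra_def)
    have r: "a * b \<in> P" if "a \<in> R" "b \<in> P" for a b
      using I_l_closed[of b a] that by (simp add: subring_of_type_def ring_of_type_algebra_def)
    show ?thesis
    proof
      assume "\<not> ?G \<subseteq> P"
      then show "\<not> E \<subseteq> P \<and> \<not> F \<subseteq> P"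
        using l r E(1) F(1) by blast
    next
      assume "\<not> E \<subseteq> P \<and> \<not> F \<subseteq> P"
      then obtain a b where ab: "a \<in> E" "a \<notin> P" "b \<in> F" "b \<notin> P" by blast
      then have "a * b \<notin> P" "a * b \<in> R" using pr mem E(1) F(1) by blast+
      with ab show "\<not> ?G \<subseteq> P" by blast
    qed
  qed
  then have "S \<inter> T = {P \<in> primes R. \<not> ?G \<subseteq> P}"
    unfolding E(2) F(2) by blast
  then show "zariski_open R (S \<inter> T)"
    unfolding zariski_open_def by (intro exI[of _ ?G]) auto
next
  fix K assume "\<forall>S \<in> K. zariski_open R S"
  then obtain E where E: "\<And>S. S \<in> K \<Longrightarrow> E S \<subseteq> R \<and> S = {P \<in> primes R. \<not> E S \<subseteq> P}"
    unfolding zariski_open_def by metis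
  have "\<Union> K = {P \<in> primes R. \<not> (\<Union>S\<in>K. E S) \<subseteq> P}"
  proof (intro equalityI subsetI)
    fix P assume "P \<in> \<Union> K"
    then obtain S where "S \<in> K" "P \<in> S" by blast
    with E[of S] show "P \<in> {P \<in> primes R. \<not> (\<Union>S\<in>K. E S) \<subseteq> P}" by blast
  next
    fix P assume "P \<in> {P \<in> primes R. \<not> (\<Union>S\<in>K. E S) \<subseteq> P}"
    then obtain S where "S \<in> K" "P \<in> primes R" "\<not> E S \<subseteq> P" by blast
    with E[of S] show "P \<in> \<Union> K" by blast
  qed
  then show "zariski_open R (\<Union> K)"
    unfolding zariski_open_def using E by (intro exI[of _ "\<Union>S\<in>K. E S"]) auto
qed

definition zariski :: "'r::idom set \<Rightarrow> 'r set topology"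
  where "zariski R = topology (zariski_open R)"

lemma openin_zariski: "openin (zariski R) U \<longleftrightarrow> zariski_open R U"
  by (simp add: zariski_def istopology_zariski topology_inverse')

text \<open>
  Sections of the structure sheaf: functions into the localizations that are locally given
  by a single fraction.
\<close>

definition regular_functions :: "'r::idom set \<Rightarrow> 'r set set \<Rightarrow> ('r set \<Rightarrow> 'r fract) set"
  where "regular_functions R U = {s \<in> extensional U.
    \<forall>P \<in> U. \<exists>W. openin (zariski R) W \<and> P \<in> W \<and> W \<subseteq> U \<and>
      (\<exists>a \<in> R. \<exists>b \<in> R. \<forall>Q \<in> W. b \<notin> Q \<and> s Q = Fract a b)}"

definition Spec :: "'r::idom set \<Rightarrow> ('r set, 'r set \<Rightarrow> 'r fract) ringed_space"
  where "Spec R =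
    \<lparr>space_top = zariski R,
     sections = (\<lambda>U.
       \<lparr>carrier = regular_functions R U,
        monoid.mult = (\<lambda>s t. \<lambda>P \<in> U. s P * t P),
        monoid.one = (\<lambda>P \<in> U. 1),
        ring.zero = (\<lambda>P \<in> U. 0),
        ring.add = (\<lambda>s t. \<lambda>P \<in> U. s P + t P)\<rparr>),
     restr = (\<lambda>U V s. restrict s V)\<rparr>"

text \<open>
  The homomorphism of localizations induced by a ring homomorphism \<open>\<phi>\<close> on \<open>R\<close>, from the
  localization at the preimage of \<open>P'\<close> to the localization at \<open>P'\<close>.
\<close>

definition localized_hom ::
    "'r::idom set \<Rightarrow> ('r \<Rightarrow> 's::idom) \<Rightarrow> 's set \<Rightarrow> 'r fract \<Rightarrow> 's fract"
  where "localized_hom R \<phi> P' z =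
    (THE w. \<exists>a \<in> R. \<exists>b \<in> R. \<phi> b \<notin> P' \<and> z = Fract a b \<and> w = Fract (\<phi> a) (\<phi> b))"

text \<open>The morphism \<open>Spec R' \<rightarrow> Spec R\<close> induced by a ring homomorphism \<open>\<phi>\<close> from \<open>R\<close> to \<open>R'\<close>.\<close>

definition Spec_map :: "'r::idom set \<Rightarrow> 's::idom set \<Rightarrow> ('r \<Rightarrow> 's) \<Rightarrow>
    ('s set, 's set \<Rightarrow> 's fract, 'r set, 'r set \<Rightarrow> 'r fract) space_map"
  where "Spec_map R R' \<phi> =
    \<lparr>on_points = (\<lambda>P'. {a \<in> R. \<phi> a \<in> P'}),
     on_sections = (\<lambda>V s. \<lambda>P' \<in> {P' \<in> primes R'. {a \<in> R. \<phi> a \<in> P'} \<in> V}.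
       localized_hom R \<phi> P' (s {a \<in> R. \<phi> a \<in> P'}))\<rparr>"

section \<open>Gluing\<close>

text \<open>
  The spaces \<open>C i\<close>, for \<open>i\<close> in \<open>I\<close>, are glued along overlaps \<open>W i j\<close>, for distinct
  \<open>i\<close> and \<open>j\<close>, given with open immersions \<open>l i j\<close> into \<open>C i\<close> and \<open>r i j\<close> into \<open>C j\<close>.
\<close>

definition glue_rel :: "'i set \<Rightarrow> ('i \<Rightarrow> ('p, 's) ringed_space) \<Rightarrow>
    ('i \<Rightarrow> 'i \<Rightarrow> ('w, 'u) ringed_space) \<Rightarrow>
    ('i \<Rightarrow> 'i \<Rightarrow> ('w, 'u, 'p, 's) space_map) \<Rightarrow>
    ('i \<Rightarrow> 'i \<Rightarrow> ('w, 'u, 'p, 's) space_map) \<Rightarrow> (('i \<times> 'p) \<times> ('i \<times> 'p)) set"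
  where "glue_rel I C W l r =
    Id_on (SIGMA i:I. points (C i)) \<union>
    {((i, on_points (l i j) w), (j, on_points (r i j) w)) |i j w.
      i \<in> I \<and> j \<in> I \<and> i \<noteq> j \<and> w \<in> points (W i j)}"

definition glue_chart :: "('i \<Rightarrow> ('p, 's) ringed_space) \<Rightarrow> (('i \<times> 'p) \<times> ('i \<times> 'p)) set \<Rightarrow>
    'i \<Rightarrow> ('i \<times> 'p) set set \<Rightarrow> 'p set"
  where "glue_chart C rel i U = {p \<in> points (C i). rel `` {(i, p)} \<in> U}"

definition glue_open :: "'i set \<Rightarrow> ('i \<Rightarrow> ('p, 's) ringed_space) \<Rightarrow>
    (('i \<times> 'p) \<times> ('i \<times> 'p)) set \<Rightarrow> ('i \<times> 'p) set set \<Rightarrow> bool"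
  where "glue_open I C rel U \<longleftrightarrow>
    U \<subseteq> (SIGMA i:I. points (C i)) // rel \<and>
    (\<forall>i \<in> I. openin (space_top (C i)) (glue_chart C rel i U))"

lemma istopology_glue: "istopology (glue_open I C rel)"
  unfolding istopology_def
proof (intro conjI allI impI)
  fix S T assume "glue_open I C rel S" "glue_open I C rel T"
  moreover have "glue_chart C rel i (S \<inter> T) = glue_chart C rel i S \<inter> glue_chart C rel i T" for i
    by (auto simp: glue_chart_def)
  ultimately show "glue_open I C rel (S \<inter> T)"
    by (auto simp: glue_open_def)
next
  fix K assume "\<forall>S \<in> K. glue_open I C rel S"
  moreover have "glue_chart C rel i (\<Union> K) = (\<Union>S\<in>K. glue_chart C rel i S)" for i
    by (auto simp: glue_chart_def)
  ultimately show "glue_open I C rel (\<Union> K)"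
    by (auto simp: glue_open_def)
qed

definition glue_top :: "'i set \<Rightarrow> ('i \<Rightarrow> ('p, 's) ringed_space) \<Rightarrow>
    (('i \<times> 'p) \<times> ('i \<times> 'p)) set \<Rightarrow> ('i \<times> 'p) set topology"
  where "glue_top I C rel = topology (glue_open I C rel)"

lemma openin_glue_top: "openin (glue_top I C rel) U \<longleftrightarrow> glue_open I C rel U"
  by (simp add: glue_top_def istopology_glue topology_inverse')

text \<open>
  A section of the glued space is a family of sections on the charts whose pullbacks to
  the overlaps agree.
\<close>

definition glue :: "'i set \<Rightarrow> ('i \<Rightarrow> ('p, 's) ringed_space) \<Rightarrow>
    ('i \<Rightarrow> 'i \<Rightarrow> ('w, 'u) ringed_space) \<Rightarrow>
    ('i \<Rightarrow> 'i \<Rightarrow> ('w, 'u, 'p, 's) space_map) \<Rightarrow>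
    ('i \<Rightarrow> 'i \<Rightarrow> ('w, 'u, 'p, 's) space_map) \<Rightarrow> (('i \<times> 'p) set, 'i \<Rightarrow> 's) ringed_space"
  where "glue I C W l r =
    (let rel = glue_rel I C W l r; ch = glue_chart C rel;
         O_ch = (\<lambda>i U. sections (C i) (ch i U)) in
     \<lparr>space_top = glue_top I C rel,
      sections = (\<lambda>U.
        \<lparr>carrier = {s \<in> (\<Pi>\<^sub>E i \<in> I. carrier (O_ch i U)). \<forall>i \<in> I. \<forall>j \<in> I. i \<noteq> j \<longrightarrow>
           on_sections (l i j) (ch i U) (s i) = on_sections (r i j) (ch j U) (s j)},
         monoid.mult = (\<lambda>s t. \<lambda>i \<in> I. s i \<otimes>\<^bsub>O_ch i U\<^esub> t i),
         monoid.one = (\<lambda>i \<in> I. \<one>\<^bsub>O_ch i U\<^esub>),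
         ring.zero = (\<lambda>i \<in> I. \<zero>\<^bsub>O_ch i U\<^esub>),
         ring.add = (\<lambda>s t. \<lambda>i \<in> I. s i \<oplus>\<^bsub>O_ch i U\<^esub> t i)\<rparr>),
      restr = (\<lambda>U V s. \<lambda>i \<in> I. restr (C i) (ch i U) (ch i V) (s i))\<rparr>)"

text \<open>The morphism on the glued space determined by morphisms \<open>f i\<close> on the charts.\<close>

definition glue_map :: "'i set \<Rightarrow> ('i \<Rightarrow> ('p, 's) ringed_space) \<Rightarrow>
    ('i \<Rightarrow> ('p, 's, 'q, 't) space_map) \<Rightarrow> (('i \<times> 'p) set, 'i \<Rightarrow> 's, 'q, 't) space_map"
  where "glue_map I C f =
    \<lparr>on_points = (\<lambda>c. THE y. \<exists>(i, p) \<in> c. y = on_points (f i) p),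
     on_sections = (\<lambda>V t. \<lambda>i \<in> I. on_sections (f i) V t)\<rparr>"

section \<open>Trees\<close>

text \<open>A poset is given by its order relation; its underlying set is the field of the relation.\<close>

definition minimal_element :: "'v rel \<Rightarrow> 'v \<Rightarrow> bool"
  where "minimal_element \<Gamma> e \<longleftrightarrow> e \<in> Field \<Gamma> \<and> (\<forall>e'. (e', e) \<in> \<Gamma> \<longrightarrow> e' = e)"

definition tree :: "'v rel \<Rightarrow> bool"
  where "tree \<Gamma> \<longleftrightarrow> Partial_order \<Gamma> \<and> finite (Field \<Gamma>) \<and> Field \<Gamma> \<noteq> {} \<and>
    (\<exists>!e. minimal_element \<Gamma> e) \<and> (\<forall>e \<in> Field \<Gamma>. under \<Gamma> e \<in> Chains \<Gamma>)"

definition level :: "'v rel \<Rightarrow> 'v \<Rightarrow> nat"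
  where "level \<Gamma> e = card (under \<Gamma> e) - 1"

definition leaves :: "'v rel \<Rightarrow> 'v set"
  where "leaves \<Gamma> = {e \<in> Field \<Gamma>. \<forall>e'. (e, e') \<in> \<Gamma> \<longrightarrow> e' = e}"

definition first_common_ancestor :: "'v rel \<Rightarrow> 'v set \<Rightarrow> 'v"
  where "first_common_ancestor \<Gamma> E =
    (THE z. z \<in> (\<Inter>e \<in> E. underS \<Gamma> e) \<and>
      (\<forall>y \<in> (\<Inter>e \<in> E. underS \<Gamma> e). (z, y) \<in> \<Gamma> \<longrightarrow> y = z))"

definition tree_iso :: "'v rel \<Rightarrow> 'w rel \<Rightarrow> ('v \<Rightarrow> 'w) \<Rightarrow> bool"
  where "tree_iso \<Gamma> \<Delta> \<tau> \<longleftrightarrow> bij_betw \<tau> (Field \<Gamma>) (Field \<Delta>) \<and>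
    (\<forall>e \<in> Field \<Gamma>. \<forall>e' \<in> Field \<Gamma>. (e, e') \<in> \<Gamma> \<longleftrightarrow> (\<tau> e, \<tau> e') \<in> \<Delta>)"

text \<open>
  Cochains are indexed by the leaves themselves instead of by an enumeration of the leaves;
  their values elsewhere play no role.
\<close>

definition compatible :: "'a::idom \<Rightarrow> 'v rel \<Rightarrow> ('v \<Rightarrow> 'a) \<Rightarrow> bool"
  where "compatible x \<Gamma> \<sigma> \<longleftrightarrow>
    (\<forall>i \<in> leaves \<Gamma>. \<forall>j \<in> leaves \<Gamma>. i \<noteq> j \<longrightarrow>
      (let d = level \<Gamma> (first_common_ancestor \<Gamma> {i, j}) in
        x ^ d dvd \<sigma> j - \<sigma> i \<and> \<not> x ^ (d + 1) dvd \<sigma> j - \<sigma> i))"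

definition labelled_tree :: "'a::idom \<Rightarrow> 'v rel \<times> ('v \<Rightarrow> 'a) \<Rightarrow> bool"
  where "labelled_tree x \<gamma> \<longleftrightarrow> tree (fst \<gamma>) \<and> compatible x (fst \<gamma>) (snd \<gamma>)"

definition essential_root :: "'v rel \<Rightarrow> 'v"
  where "essential_root \<Gamma> =
    (if Field \<Gamma> \<in> Chains \<Gamma> then the_elem (leaves \<Gamma>)
     else first_common_ancestor \<Gamma> (leaves \<Gamma>))"

definition Es :: "'v rel \<Rightarrow> 'v rel"
  where "Es \<Gamma> = Restr \<Gamma> {e \<in> Field \<Gamma>. (essential_root \<Gamma>, e) \<in> \<Gamma>}"

definition essential_cochain :: "'a::idom \<Rightarrow> 'v rel \<times> ('v \<Rightarrow> 'a) \<Rightarrow> ('v \<Rightarrow> 'a) \<Rightarrow> bool"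
  where "essential_cochain x \<gamma> \<sigma>' \<longleftrightarrow>
    compatible x (Es (fst \<gamma>)) \<sigma>' \<and>
    (\<exists>c. \<forall>i \<in> leaves (fst \<gamma>).
      snd \<gamma> i = c + x ^ level (fst \<gamma>) (essential_root (fst \<gamma>)) * \<sigma>' i)"

definition equivalent_trees ::
    "'a::idom \<Rightarrow> 'v rel \<times> ('v \<Rightarrow> 'a) \<Rightarrow> 'w rel \<times> ('w \<Rightarrow> 'a) \<Rightarrow> bool"
  where "equivalent_trees x \<gamma> \<gamma>' \<longleftrightarrow>
    (\<exists>\<rho> \<rho>' \<tau> a b. essential_cochain x \<gamma> \<rho> \<and> essential_cochain x \<gamma>' \<rho>' \<and>
      tree_iso (Es (fst \<gamma>')) (Es (fst \<gamma>)) \<tau> \<and> a dvd 1 \<and>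
      (\<forall>i \<in> leaves (Es (fst \<gamma>')).
        x ^ level (Es (fst \<gamma>)) (\<tau> i) dvd a * \<rho>' i - \<rho> (\<tau> i) + b))"

section \<open>The surface defined by a labelled tree\<close>

text \<open>The ring \<open>A\<^sub>x[T]\<close>, where the localization \<open>A\<^sub>x\<close> is a subring of the fraction field of \<open>A\<close>.\<close>

definition localization_at :: "'a::idom \<Rightarrow> 'a fract set"
  where "localization_at x = {Fract a (x ^ n) |a n. True}"

definition polys_over_localization :: "'a::idom \<Rightarrow> 'a fract poly set"
  where "polys_over_localization x = {p. \<forall>n. coeff p n \<in> localization_at x}"

definition affine_line :: "('a::idom poly set, 'a poly set \<Rightarrow> 'a poly fract) ringed_space"
  where "affine_line = Spec UNIV"

definition affine_line_over_X_star ::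
    "'a::idom \<Rightarrow> ('a fract poly set, 'a fract poly set \<Rightarrow> 'a fract poly fract) ringed_space"
  where "affine_line_over_X_star x = Spec (polys_over_localization x)"

text \<open>
  The transition isomorphism from \<open>A\<^sub>x[T\<^sub>i]\<close> to \<open>A\<^sub>x[T\<^sub>j]\<close>, given by substitution of the
  image of \<open>T\<^sub>i\<close>.
\<close>

definition transition :: "'a::idom \<Rightarrow> 'v rel \<times> ('v \<Rightarrow> 'a) \<Rightarrow> 'v \<Rightarrow> 'v \<Rightarrow>
    'a fract poly \<Rightarrow> 'a fract poly"
  where "transition x \<gamma> i j p =
    (let m = (\<lambda>e. int (level (fst \<gamma>) e)); y = to_fract x in
      pcompose p [: y powi (- m i) * to_fract (snd \<gamma> j - snd \<gamma> i), y powi (m j - m i) :])"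

definition overlap_left :: "'a::idom \<Rightarrow> 'v rel \<times> ('v \<Rightarrow> 'a) \<Rightarrow> 'v \<Rightarrow> 'v \<Rightarrow>
    ('a fract poly set, 'a fract poly set \<Rightarrow> 'a fract poly fract,
     'a poly set, 'a poly set \<Rightarrow> 'a poly fract) space_map"
  where "overlap_left x \<gamma> i j =
    Spec_map UNIV (polys_over_localization x) (\<lambda>p. transition x \<gamma> i j (map_poly to_fract p))"

definition overlap_right :: "'a::idom \<Rightarrow>
    ('a fract poly set, 'a fract poly set \<Rightarrow> 'a fract poly fract,
     'a poly set, 'a poly set \<Rightarrow> 'a poly fract) space_map"
  where "overlap_right x = Spec_map UNIV (polys_over_localization x) (map_poly to_fract)"

text \<open>
  The overlap of the \<open>i\<close>-th and the \<open>j\<close>-th chart is taken to be the spectrum of \<open>A\<^sub>x[T\<^sub>j]\<close>,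
  mapped to the \<open>i\<close>-th chart by means of the transition isomorphism.
\<close>

definition surface :: "'a::idom \<Rightarrow> 'v rel \<times> ('v \<Rightarrow> 'a) \<Rightarrow>
    (('v \<times> 'a poly set) set, 'v \<Rightarrow> 'a poly set \<Rightarrow> 'a poly fract) ringed_space"
  where "surface x \<gamma> =
    glue (leaves (fst \<gamma>)) (\<lambda>i. affine_line) (\<lambda>i j. affine_line_over_X_star x)
      (overlap_left x \<gamma>) (\<lambda>i j. overlap_right x)"

definition surface_projection :: "'v rel \<times> ('v \<Rightarrow> 'a::idom) \<Rightarrow>
    (('v \<times> 'a poly set) set, 'v \<Rightarrow> 'a poly set \<Rightarrow> 'a poly fract,
     'a set, 'a set \<Rightarrow> 'a fract) space_map"
  where "surface_projection \<gamma> =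
    glue_map (leaves (fst \<gamma>)) (\<lambda>i. affine_line)
      (\<lambda>i. Spec_map UNIV UNIV (\<lambda>a. [:a:]))"

definition X_isomorphic_surfaces ::
    "'a::idom \<Rightarrow> 'v rel \<times> ('v \<Rightarrow> 'a) \<Rightarrow> 'w rel \<times> ('w \<Rightarrow> 'a) \<Rightarrow> bool"
  where "X_isomorphic_surfaces x \<gamma> \<gamma>' \<longleftrightarrow>
    isomorphic_over (Spec (UNIV :: 'a set))
      (surface x \<gamma>) (surface_projection \<gamma>) (surface x \<gamma>') (surface_projection \<gamma>')"

section \<open>The base ring\<close>

text \<open>
  A discrete valuation ring is a principal ideal domain with exactly one nonzero prime
  ideal; the uniformizing parameters are the generators of this ideal.
\<close>

definition dvr_pair :: "'k::field itself \<Rightarrow> 'a::idom \<Rightarrow> bool"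
  where "dvr_pair K x \<longleftrightarrow>
    (let A = (ring_of_type_algebra :: 'a ring) in
      principal_domain A \<and>
      {P. primeideal P A \<and> P \<noteq> {0}} = {cgenideal A x} \<and>
      A Quot (cgenideal A x) \<simeq> (ring_of_type_algebra :: 'k ring))"

definition polynomial_ring_pair :: "'k::field itself \<Rightarrow> 'a::idom \<Rightarrow> bool"
  where "polynomial_ring_pair K x \<longleftrightarrow>
    (\<exists>h \<in> ring_iso (ring_of_type_algebra :: 'k poly ring) (ring_of_type_algebra :: 'a ring).
      h [:0, 1:] = x)"

end

theory Submission
  imports Defs
begin

text \<open>
  The function \<open>u = \<sigma>\<^sub>i + x\<^sup>m T\<^sub>i\<close>, where \<open>m = m\<^sub>i\<close>, is the same on all charts, so it is a global
  coordinate on \<open>S(\<gamma>)\<close>. Comparing the pullbacks of the global functions \<open>u'\<close> and \<open>u\<close> under an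
  isomorphism and its inverse, a count of degrees shows \<open>u' = \<alpha> u + \<beta>\<close> over the fraction field.
  An isomorphism over \<open>X\<close> permutes the components of the fibre over \<open>x = 0\<close>, say \<open>i \<mapsto> J(i)\<close>, and
  divisibility by powers of \<open>x\<close> at the generic points of these components turns \<open>\<alpha> u + \<beta>\<close> into
  affine automorphisms \<open>T' = e T\<^sub>i + c\<^sub>i\<close> between the charts \<open>i\<close> and \<open>J(i)\<close>, with the same unit \<open>e\<close>
  for all \<open>i\<close>. The differences of the cochains then have the same valuations up to a common
  shift, and a tree is determined by the levels of its leaves and of their first common
  ancestors; this is equivalence of the labelled trees. Conversely, an equivalence provides such
  affine automorphisms of the charts, which glue.
\<close>

section \<open>Fraction fields and localizations\<close>

text \<open>The surface need not be affine, and a morphism of ringed spaces carries data on every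
  open set. What brings this down to algebra is that all charts share one generic point and one
  function field: a section over an open subset of a chart is a single constant fraction, and once
  fractions are rewritten in terms of \<open>u\<close>, gluing means equality of fractions. In the
  forward direction an isomorphism enters only through the pullbacks of \<open>u'\<close> and
  \<open>u\<close> and through the images of the generic points of the fibre components.

  Why units appear: on the chart \<open>j\<close> the function \<open>u' - \<sigma>'\<close> is
  \<open>x^m'\<close> times the coordinate, so its pullback is \<open>x^m'\<close> times a function
  regular at the generic point of the component \<open>i\<close>, where denominators are prime to
  \<open>x\<close>. Hence the slope \<open>a\<close> of the pullback of \<open>u'\<close> is
  divisible by \<open>x^m'\<close>, and the slope \<open>a'\<close> of the pullback of
  \<open>u\<close> by \<open>x^m\<close>. The two pullbacks being inverse,
  \<open>a * a' = x^(m + m')\<close>, and the cofactors are units. One unit serves all leaves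
  because \<alpha> is common to them and a power of \<open>x\<close> times a unit determines both
  factors.\<close>

lemma to_fract_power: "to_fract (a ^ n) = to_fract a ^ n"
  by (induction n) auto

text \<open>Makes no reference to a prime: for injective \<phi> each \<open>localized_hom\<close> is
  a restriction of this one map of fraction fields, so values at different points can be
  compared.\<close>

definition fract_map :: "('r::idom \<Rightarrow> 's::idom) \<Rightarrow> 'r fract \<Rightarrow> 's fract"
  where "fract_map \<phi> z = (SOME w. \<exists>a b. b \<noteq> 0 \<and> z = Fract a b \<and> w = Fract (\<phi> a) (\<phi> b))"

locale domain_embedding =
  fixes \<phi> :: "'r::idom \<Rightarrow> 's::idom"
  assumes hom_add: "\<phi> (a + b) = \<phi> a + \<phi> b"
    and hom_mult: "\<phi> (a * b) = \<phi> a * \<phi> b"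
    and hom_one: "\<phi> 1 = 1"
    and hom_eq_0: "\<phi> a = 0 \<Longrightarrow> a = 0"
begin

lemma hom_zero: "\<phi> 0 = 0"
  using hom_add[of 0 0] by (metis add.right_neutral add_left_cancel)

lemma hom_uminus: "\<phi> (- a) = - \<phi> a"
  using hom_add[of a "- a"] hom_zero by (simp add: eq_neg_iff_add_eq_0 add.commute)

lemma hom_diff: "\<phi> (a - b) = \<phi> a - \<phi> b"
  using hom_add[of a "- b"] by (simp add: hom_uminus)

lemma hom_eq_iff: "\<phi> a = \<phi> b \<longleftrightarrow> a = b"
  using hom_eq_0[of "a - b"] by (auto simp: hom_diff)

lemma hom_eq_0_iff: "\<phi> a = 0 \<longleftrightarrow> a = 0"
  using hom_eq_0 hom_zero by auto

lemma fract_map_Fract: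
  assumes "b \<noteq> 0"
  shows "fract_map \<phi> (Fract a b) = Fract (\<phi> a) (\<phi> b)"
  unfolding fract_map_def
proof (rule some_equality)
  show "\<exists>a' b'. b' \<noteq> 0 \<and> Fract a b = Fract a' b' \<and> Fract (\<phi> a) (\<phi> b) = Fract (\<phi> a') (\<phi> b')"
    using assms by blast
next
  fix w assume "\<exists>a' b'. b' \<noteq> 0 \<and> Fract a b = Fract a' b' \<and> w = Fract (\<phi> a') (\<phi> b')"
  then obtain a' b' where *: "b' \<noteq> 0" "Fract a b = Fract a' b'" "w = Fract (\<phi> a') (\<phi> b')"
    by blast
  then have "a * b' = a' * b" using assms by (simp add: eq_fract)
  then have "\<phi> a * \<phi> b' = \<phi> a' * \<phi> b" by (metis hom_mult)
  then show "w = Fract (\<phi> a) (\<phi> b)"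
    using * assms hom_eq_0 by (metis eq_fract(1))
qed

lemma fract_map_add: "fract_map \<phi> (z + w) = fract_map \<phi> z + fract_map \<phi> w"
  by (cases z; cases w) (simp add: fract_map_Fract hom_add hom_mult hom_eq_0_iff)

lemma fract_map_mult: "fract_map \<phi> (z * w) = fract_map \<phi> z * fract_map \<phi> w"
  by (cases z; cases w) (simp add: fract_map_Fract hom_mult)

lemma fract_map_to_fract: "fract_map \<phi> (to_fract a) = to_fract (\<phi> a)"
  by (simp add: to_fract_def fract_map_Fract hom_one)

lemma fract_map_one: "fract_map \<phi> 1 = 1"
  by (simp add: One_fract_def fract_map_Fract hom_one)

lemma domain_embedding_fract_map: "domain_embedding (fract_map \<phi>)"
proof
  fix z :: "'r fract" assume "fract_map \<phi> z = 0"
  then show "z = 0"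
    by (cases z) (auto simp: fract_map_Fract Zero_fract_def eq_fract hom_eq_0_iff)
qed (auto simp: fract_map_add fract_map_mult fract_map_one)

text \<open>Since \<open>0\<close> lies in \<open>P\<close>, a denominator whose image avoids
  \<open>P\<close> is nonzero; so the definite description in \<open>localized_hom\<close> can only
  pick the value of \<open>fract_map\<close>.\<close>

lemma localized_hom_eq_fract_map:
  assumes "z = Fract a b" "\<phi> b \<notin> P" "0 \<in> P"
  shows "localized_hom UNIV \<phi> P z = fract_map \<phi> z"
  unfolding localized_hom_def
proof (rule the_equality)
  have nz: "b \<noteq> 0" if "\<phi> b \<notin> P" for b
    using that assms(3) hom_zero by auto
  show "\<exists>a\<in>UNIV. \<exists>b\<in>UNIV. \<phi> b \<notin> P \<and> z = Fract a b \<and> fract_map \<phi> z = Fract (\<phi> a) (\<phi> b)"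
    using assms nz[of b] by (auto simp: fract_map_Fract)
  fix w assume "\<exists>a\<in>UNIV. \<exists>b\<in>UNIV. \<phi> b \<notin> P \<and> z = Fract a b \<and> w = Fract (\<phi> a) (\<phi> b)"
  then show "w = fract_map \<phi> z" using nz by (auto simp: fract_map_Fract)
qed

end

lemma domain_embedding_compose:
  assumes "domain_embedding \<phi>" "domain_embedding \<psi>"
  shows "domain_embedding (\<lambda>a. \<psi> (\<phi> a))"
proof -
  interpret p: domain_embedding \<phi> by fact
  interpret q: domain_embedding \<psi> by fact
  show ?thesis
    by unfold_locales
      (auto simp: p.hom_add p.hom_mult p.hom_one q.hom_add q.hom_mult q.hom_one
        dest!: q.hom_eq_0 p.hom_eq_0)
qed

lemma fract_map_compose:
  assumes "domain_embedding \<phi>" "domain_embedding \<psi>"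
  shows "fract_map \<psi> (fract_map \<phi> z) = fract_map (\<lambda>a. \<psi> (\<phi> a)) z"
proof -
  interpret p: domain_embedding \<phi> by fact
  interpret q: domain_embedding \<psi> by fact
  interpret c: domain_embedding "\<lambda>a. \<psi> (\<phi> a)" by (rule domain_embedding_compose[OF assms])
  show ?thesis
    by (cases z) (simp add: p.fract_map_Fract q.fract_map_Fract c.fract_map_Fract p.hom_eq_0_iff)
qed

lemma fract_map_ident: "fract_map (\<lambda>a. a) z = z"
proof -
  interpret domain_embedding "\<lambda>a::'a. a" by unfold_locales auto
  show ?thesis by (cases z) (simp add: fract_map_Fract)
qed

section \<open>Prime ideals of subrings\<close>

definition subring_set :: "'r::idom set \<Rightarrow> bool"
  where "subring_set R \<longleftrightarrow> 1 \<in> R \<and> (\<forall>a \<in> R. - a \<in> R) \<and>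
    (\<forall>a \<in> R. \<forall>b \<in> R. a + b \<in> R) \<and> (\<forall>a \<in> R. \<forall>b \<in> R. a * b \<in> R)"

lemma subring_set_zero: "subring_set R \<Longrightarrow> 0 \<in> R"
  unfolding subring_set_def by (metis add.right_inverse)

lemma subring_set_UNIV: "subring_set UNIV"
  by (simp add: subring_set_def)

lemma cring_subring_of_type:
  assumes "subring_set R"
  shows "cring (subring_of_type R)"
proof (rule cringI)
  have inv: "\<exists>y\<in>R. y + x = 0" if "x \<in> R" for x
    using assms that unfolding subring_set_def by (metis add.left_inverse)
  show "abelian_group (subring_of_type R)"
    by (rule abelian_groupI)
      (use assms inv subring_set_zero[OF assms] in
        \<open>auto simp: subring_of_type_def ring_of_type_algebra_def subring_set_def algebra_simps\<close>)
  show "Group.comm_monoid (subring_of_type R)"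
    by (rule comm_monoidI)
      (use assms in \<open>auto simp: subring_of_type_def ring_of_type_algebra_def subring_set_def\<close>)
qed (auto simp: subring_of_type_def ring_of_type_algebra_def algebra_simps)

text \<open>Translates \<open>primeideal\<close> into plain membership conditions, so that later
  arguments need no record structures.\<close>

lemma primes_iff:
  assumes R: "subring_set R"
  shows "P \<in> primes R \<longleftrightarrow> P \<subseteq> R \<and> 0 \<in> P \<and> 1 \<notin> P \<and> (\<forall>a \<in> P. \<forall>b \<in> P. a + b \<in> P) \<and>
    (\<forall>a \<in> R. \<forall>b \<in> P. a * b \<in> P) \<and> (\<forall>a \<in> R. \<forall>b \<in> R. a * b \<in> P \<longrightarrow> a \<in> P \<or> b \<in> P)"
    (is "_ \<longleftrightarrow> ?r")
proof
  let ?S = "subring_of_type R"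
  have S [simp]: "carrier ?S = R" "\<And>a b. a \<otimes>\<^bsub>?S\<^esub> b = a * b" "\<And>a b. a \<oplus>\<^bsub>?S\<^esub> b = a + b"
    "\<zero>\<^bsub>?S\<^esub> = 0" "\<one>\<^bsub>?S\<^esub> = 1"
    by (auto simp: subring_of_type_def ring_of_type_algebra_def)
  interpret S: cring ?S by (rule cring_subring_of_type[OF R])
  {
    assume "P \<in> primes R"
    then interpret primeideal P ?S by (simp add: primes_def)
    have "1 \<notin> P"
      using one_imp_carrier I_notcarr by auto
    moreover have "P \<subseteq> R" "0 \<in> P" "\<forall>a \<in> P. \<forall>b \<in> P. a + b \<in> P" "\<forall>a \<in> R. \<forall>b \<in> P. a * b \<in> P"
      using a_subset additive_subgroup.zero_closed[OF is_additive_subgroup]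
        additive_subgroup.a_closed[OF is_additive_subgroup] I_l_closed by auto
    moreover have "\<forall>a \<in> R. \<forall>b \<in> R. a * b \<in> P \<longrightarrow> a \<in> P \<or> b \<in> P"
      using I_prime by auto
    ultimately show ?r by blast
  next
    assume r: ?r
    have "primeideal P ?S"
    proof (rule primeidealI2)
      show "additive_subgroup P ?S"
      proof (rule additive_subgroupI, rule group.subgroupI)
        show "group (add_monoid ?S)" by (rule S.a_group)
        fix a assume a: "a \<in> P"
        have "inv\<^bsub>add_monoid ?S\<^esub> a = - a"
          using S.minus_equality[of "- a" a] a r R
          by (auto simp: a_inv_def subring_set_def)
        moreover have "- 1 \<in> R" using R unfolding subring_set_def by blast
        then have "- 1 * a \<in> P" using a r by blast
        ultimately show "inv\<^bsub>add_monoid ?S\<^esub> a \<in> P" by simp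
      qed (use r in auto)
      show "a \<otimes>\<^bsub>?S\<^esub> c \<in> P" if "a \<in> P" "c \<in> carrier ?S" for a c
        using r that unfolding S by (metis mult.commute)
      show "carrier ?S \<noteq> P" using r R by (auto simp: subring_set_def)
    qed (use r S.is_cring in auto)
    then show "P \<in> primes R" by (simp add: primes_def)
  }
qed

lemma primes_UNIV_iff:
  "P \<in> primes UNIV \<longleftrightarrow> 0 \<in> P \<and> 1 \<notin> P \<and> (\<forall>a \<in> P. \<forall>b \<in> P. a + b \<in> P) \<and>
    (\<forall>a. \<forall>b \<in> P. a * b \<in> P) \<and> (\<forall>a b. a * b \<in> P \<longrightarrow> a \<in> P \<or> b \<in> P)"
  by (simp add: primes_iff subring_set_UNIV)

lemma zero_in_prime: "P \<in> primes UNIV \<Longrightarrow> 0 \<in> P"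
  by (simp add: primes_UNIV_iff)

lemma one_notin_prime: "P \<in> primes UNIV \<Longrightarrow> 1 \<notin> P"
  by (simp add: primes_UNIV_iff)

lemma prime_mult_iff: "P \<in> primes UNIV \<Longrightarrow> a * b \<in> P \<longleftrightarrow> a \<in> P \<or> b \<in> P"
  unfolding primes_UNIV_iff by (metis mult.commute)

lemma prime_power_iff:
  assumes P: "P \<in> primes UNIV"
  shows "a ^ n \<in> P \<longleftrightarrow> a \<in> P \<and> n > 0"
  by (induction n) (auto simp: prime_mult_iff[OF P] one_notin_prime[OF P])

lemma zero_ideal_prime: "{0} \<in> primes (UNIV :: 'r::idom set)"
  by (auto simp: primes_UNIV_iff)

lemma principal_ideal_prime:
  assumes "prime_elem (p::'r::idom)"
  shows "{a. p dvd a} \<in> primes UNIV"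
  using assms prime_elem_dvd_mult_iff[OF assms]
  by (auto simp: primes_UNIV_iff prime_elem_def)

lemma primes_preimage:
  assumes "subring_set R" "subring_set R'" "P \<in> primes R'"
    and "\<And>a. a \<in> R \<Longrightarrow> \<phi> a \<in> R'" "\<phi> 0 = 0" "\<phi> 1 = 1"
    and "\<And>a b. \<phi> (a + b) = \<phi> a + \<phi> b" "\<And>a b. \<phi> (a * b) = \<phi> a * \<phi> b"
  shows "{a \<in> R. \<phi> a \<in> P} \<in> primes R"
  using assms subring_set_zero[OF assms(1)] unfolding primes_iff[OF assms(1)] primes_iff[OF assms(2)]
  by (auto simp: subring_set_def)

lemma (in domain_embedding) primes_vimage: "P \<in> primes UNIV \<Longrightarrow> {a. \<phi> a \<in> P} \<in> primes UNIV"
  using primes_preimage[OF subring_set_UNIV subring_set_UNIV, of P \<phi>]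
  by (simp add: hom_zero hom_one hom_add hom_mult)

text \<open>Krull's theorem: an ideal that Zorn's lemma makes maximal among the proper ones above
  \<open>I\<close> is prime.\<close>

lemma ex_prime_above:
  fixes I :: "'r::idom set"
  assumes I: "0 \<in> I" "1 \<notin> I" "\<And>a b. a \<in> I \<Longrightarrow> b \<in> I \<Longrightarrow> a + b \<in> I" "\<And>a b. b \<in> I \<Longrightarrow> a * b \<in> I"
  obtains P where "P \<in> primes UNIV" "I \<subseteq> P"
proof -
  define idl where "idl J \<longleftrightarrow> I \<subseteq> J \<and> 1 \<notin> J \<and> (\<forall>a\<in>J. \<forall>b\<in>J. a + b \<in> J) \<and> (\<forall>a. \<forall>b\<in>J. a * b \<in> J)"
    for J :: "'r set"
  have "\<exists>U\<in>Collect idl. (\<forall>J\<in>F. J \<subseteq> U)" if C: "subset.chain (Collect idl) F" for F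
  proof (cases "F = {}")
    case True
    \<comment> \<open>The empty chain has empty union, which is not an ideal; here \<open>I\<close>
      itself is the bound.\<close>
    have "idl I" using I by (auto simp: idl_def)
    then show ?thesis using True by auto
  next
    case False
    have mem: "idl J" if "J \<in> F" for J using C that by (auto simp: subset_chain_def)
    have "a + b \<in> \<Union> F" if ab: "a \<in> \<Union> F" "b \<in> \<Union> F" for a b
    proof -
      from ab obtain J K where JK: "J \<in> F" "K \<in> F" "a \<in> J" "b \<in> K" by auto
      with C have "J \<subseteq> K \<or> K \<subseteq> J" by (auto simp: subset_chain_def)
      with JK mem[of J] mem[of K] show ?thesis unfolding idl_def by blast
    qed
    then have "idl (\<Union> F)" using False mem unfolding idl_def by blast
    then show ?thesis by blast
  qed
  then obtain M where M: "idl M" "\<And>J. idl J \<Longrightarrow> M \<subseteq> J \<Longrightarrow> J = M"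
    using subset_Zorn[of "Collect idl"] by auto
  have "b \<in> M" if ab: "a * b \<in> M" "a \<notin> M" for a b
  proof -
    \<comment> \<open>The ideal generated by \<open>M\<close> and \<open>a\<close>. By maximality it
      contains 1, and multiplying \<open>1 = m + c * a\<close> by \<open>b\<close> puts
      \<open>b\<close> into \<open>M\<close>.\<close>
    let ?J = "{m + c * a |m c. m \<in> M}"
    have M_sum: "m + n \<in> M" if "m \<in> M" "n \<in> M" for m n
      using M(1) that by (auto simp: idl_def)
    have M_mult: "c * m \<in> M" if "m \<in> M" for m c
      using M(1) that by (auto simp: idl_def)
    have "M \<subseteq> ?J" by force
    moreover have "a \<in> ?J"
    proof -
      have "a = 0 + 1 * a" "0 \<in> M" using M(1) I(1) unfolding idl_def by auto
      then show ?thesis by blast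
    qed
    ultimately have "\<not> idl ?J" using M(2)[of ?J] ab(2) by blast
    moreover have "I \<subseteq> ?J" using \<open>M \<subseteq> ?J\<close> M(1) unfolding idl_def by blast
    moreover have "u + v \<in> ?J" if uv: "u \<in> ?J" "v \<in> ?J" for u v
    proof -
      from uv obtain m c n d where "u = m + c * a" "v = n + d * a" "m \<in> M" "n \<in> M" by blast
      then have "u + v = (m + n) + (c + d) * a" "m + n \<in> M"
        using M_sum by (auto simp: algebra_simps)
      then show ?thesis by blast
    qed
    moreover have "d * u \<in> ?J" if u: "u \<in> ?J" for u d
    proof -
      from u obtain m c where "u = m + c * a" "m \<in> M" by blast
      then have "d * u = d * m + (d * c) * a" "d * m \<in> M"
        using M_mult by (simp add: distrib_left mult.assoc, blast)
      then show ?thesis by blast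
    qed
    ultimately have "1 \<in> ?J" unfolding idl_def by blast
    then obtain m c where mc: "1 = m + c * a" "m \<in> M" by blast
    have "b = b * 1" by simp
    also have "\<dots> = b * m + c * (a * b)" unfolding mc(1) by (simp add: algebra_simps)
    finally show ?thesis using M_sum M_mult mc(2) ab(1) by metis
  qed
  then have "M \<in> primes UNIV"
    using M(1) I(1) unfolding primes_UNIV_iff idl_def by blast
  then show thesis using that M(1) unfolding idl_def by blast
qed

text \<open>A domain is the intersection of its localizations. The denominators of \<open>z\<close>
  form an ideal \<open>I\<close>; a prime above \<open>I\<close> would contain the very denominator
  that the hypothesis provides outside of it.\<close>

lemma to_fract_of_all_localizations:
  fixes z :: "'r::idom fract"
  assumes "\<And>P. P \<in> primes UNIV \<Longrightarrow> \<exists>a b. b \<notin> P \<and> z = Fract a b"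
  shows "\<exists>a. z = to_fract a"
proof -
  define I where "I = {b. \<exists>a. to_fract b * z = to_fract a}"
  have "1 \<in> I"
  proof (rule ccontr)
    assume "1 \<notin> I"
    moreover have "0 \<in> I" by (auto simp: I_def intro: exI[of _ 0])
    moreover have "a + b \<in> I" if "a \<in> I" "b \<in> I" for a b
      using that unfolding I_def by (auto simp: distrib_right) (metis to_fract_add)
    moreover have "a * b \<in> I" if "b \<in> I" for a b
      using that unfolding I_def by (auto simp: mult.assoc) (metis to_fract_mult)
    ultimately obtain P where P: "P \<in> primes UNIV" "I \<subseteq> P"
      using ex_prime_above[of I] by metis
    then obtain a b where ab: "b \<notin> P" "z = Fract a b" using assms by blast
    then have "b \<noteq> 0" using P zero_in_prime by blast
    then have "to_fract b * z = to_fract a"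
      using ab by (simp add: to_fract_def eq_fract)
    then show False using ab P by (auto simp: I_def)
  qed
  then show ?thesis by (auto simp: I_def)
qed

section \<open>Regular functions\<close>

lemma zariski_open_subset: "zariski_open R U \<Longrightarrow> U \<subseteq> primes R"
  by (auto simp: zariski_open_def)

lemma zariski_open_Int: "zariski_open R U \<Longrightarrow> zariski_open R V \<Longrightarrow> zariski_open R (U \<inter> V)"
  using openin_Int[of "zariski R"] by (simp add: openin_zariski)

lemma zariski_open_basic: "b \<in> R \<Longrightarrow> zariski_open R {P \<in> primes R. b \<notin> P}"
  unfolding zariski_open_def by (rule exI[of _ "{b}"]) auto

lemma topspace_zariski:
  assumes R: "subring_set R"
  shows "topspace (zariski R) = primes R"
proof
  show "topspace (zariski R) \<subseteq> primes R"
    unfolding topspace_def openin_zariski using zariski_open_subset by blast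
  have "{P \<in> primes R. 1 \<notin> P} = primes R" using primes_iff[OF R] by blast
  then have "zariski_open R (primes R)"
    using zariski_open_basic[of 1 R] R by (simp add: subring_set_def)
  then show "primes R \<subseteq> topspace (zariski R)"
    by (intro openin_subset) (simp add: openin_zariski)
qed

lemma zariski_open_primes: "zariski_open UNIV (primes UNIV)"
  using openin_topspace[of "zariski UNIV"]
  by (simp add: openin_zariski topspace_zariski subring_set_UNIV)

lemma zariski_open_generization:
  assumes "zariski_open R U" "Q \<in> U" "P \<in> primes R" "P \<subseteq> Q"
  shows "P \<in> U"
  using assms unfolding zariski_open_def by blast

lemma (in domain_embedding) zariski_open_preimage:
  assumes "zariski_open UNIV U"
  shows "zariski_open UNIV {P \<in> primes UNIV. {a. \<phi> a \<in> P} \<in> U}"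
proof -
  from assms obtain E where E: "U = {P \<in> primes UNIV. \<not> E \<subseteq> P}"
    by (auto simp: zariski_open_def)
  have "{P \<in> primes UNIV. {a. \<phi> a \<in> P} \<in> U} = {P \<in> primes UNIV. \<not> \<phi> ` E \<subseteq> P}"
    unfolding E using primes_vimage by auto
  then show ?thesis unfolding zariski_open_def by blast
qed

lemma regular_function_stalk:
  assumes "s \<in> regular_functions R U" "P \<in> U"
  obtains a b where "a \<in> R" "b \<in> R" "b \<notin> P" "s P = Fract a b"
  using assms unfolding regular_functions_def by blast

lemma regular_functionI:
  assumes "s \<in> extensional U" "U \<subseteq> primes R"
    and "\<And>P. P \<in> U \<Longrightarrow> \<exists>W. zariski_open R W \<and> P \<in> W \<and> W \<subseteq> U \<and>
      (\<exists>a \<in> R. \<exists>b \<in> R. \<forall>Q \<in> W. b \<notin> Q \<and> s Q = Fract a b)"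
  shows "s \<in> regular_functions R U"
  using assms by (simp add: regular_functions_def openin_zariski)

text \<open>By constancy every regular function has this shape, so this is how sections are
  constructed: one fraction, with an admissible denominator at each point.\<close>

lemma regular_function_const:
  assumes U: "zariski_open UNIV U" and z: "\<And>P. P \<in> U \<Longrightarrow> \<exists>a b. b \<notin> P \<and> z = Fract a b"
  shows "(\<lambda>P\<in>U. z) \<in> regular_functions UNIV U"
proof (rule regular_functionI)
  fix P assume P: "P \<in> U"
  then obtain a b where ab: "b \<notin> P" "z = Fract a b" using z by blast
  let ?W = "U \<inter> {P \<in> primes UNIV. b \<notin> P}"
  have "zariski_open UNIV ?W" by (rule zariski_open_Int[OF U zariski_open_basic]) simp
  moreover have "P \<in> ?W" using P ab zariski_open_subset[OF U] by auto
  moreover have "\<forall>Q\<in>?W. b \<notin> Q \<and> (\<lambda>P\<in>U. z) Q = Fract a b" using ab by auto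
  ultimately show "\<exists>W. zariski_open UNIV W \<and> P \<in> W \<and> W \<subseteq> U \<and>
      (\<exists>a\<in>UNIV. \<exists>b\<in>UNIV. \<forall>Q\<in>W. b \<notin> Q \<and> (\<lambda>P\<in>U. z) Q = Fract a b)" by blast
qed (use zariski_open_subset[OF U] in auto)

text \<open>Since the zero ideal lies in every nonempty open set, a locally constant fraction is constant.\<close>

lemma regular_function_eq_generic:
  fixes U :: "'r::idom set set"
  assumes "s \<in> regular_functions UNIV U" "P \<in> U"
  shows "{0} \<in> U" "s P = s {0}"
proof -
  from assms obtain W a b where W: "zariski_open UNIV W" "P \<in> W" "W \<subseteq> U"
    and ab: "\<And>Q. Q \<in> W \<Longrightarrow> b \<notin> Q \<and> s Q = Fract a b"
    unfolding regular_functions_def openin_zariski by blast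
  have "P \<in> primes UNIV" using W zariski_open_subset by blast
  then have "{0} \<in> W"
    using zariski_open_generization[OF W(1,2) zero_ideal_prime] zero_in_prime by blast
  then show "{0} \<in> U" "s P = s {0}" using W ab by auto
qed

lemma regular_function_restrict:
  assumes "s \<in> regular_functions UNIV U" "zariski_open UNIV V" "V \<subseteq> U"
  shows "restrict s V \<in> regular_functions UNIV V"
proof -
  have "restrict s V = (\<lambda>P\<in>V. s {0})"
    using regular_function_eq_generic(2)[OF assms(1)] assms(3) by (intro restrict_ext) blast
  moreover have "\<exists>a b. b \<notin> P \<and> s {0} = Fract a b" if "P \<in> V" for P
    using regular_function_stalk[OF assms(1), of P] regular_function_eq_generic(2)[OF assms(1)]
      assms(3) that by (metis subsetD)
  ultimately show ?thesis using regular_function_const[OF assms(2)] by metis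
qed

lemma (in domain_embedding) regular_function_pullback:
  assumes s: "s \<in> regular_functions UNIV U" and U: "zariski_open UNIV U"
  shows "(\<lambda>P \<in> {P \<in> primes UNIV. {a. \<phi> a \<in> P} \<in> U}. fract_map \<phi> (s {a. \<phi> a \<in> P}))
    \<in> regular_functions UNIV {P \<in> primes UNIV. {a. \<phi> a \<in> P} \<in> U}" (is "?s \<in> regular_functions _ ?V")
proof -
  have "\<exists>a b. b \<notin> P \<and> fract_map \<phi> (s {0}) = Fract a b" if P: "P \<in> ?V" for P
  proof -
    obtain a b where ab: "\<phi> b \<notin> P" "s {a. \<phi> a \<in> P} = Fract a b"
      using regular_function_stalk[OF s, of "{a. \<phi> a \<in> P}"] P by blast
    then have "b \<noteq> 0" using P zero_in_prime hom_zero by fastforce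
    moreover have "s {a. \<phi> a \<in> P} = s {0}"
      using regular_function_eq_generic(2)[OF s] P by blast
    ultimately show ?thesis using ab fract_map_Fract[of b a] by metis
  qed
  then have "(\<lambda>P\<in>?V. fract_map \<phi> (s {0})) \<in> regular_functions UNIV ?V"
    by (intro regular_function_const zariski_open_preimage U) auto
  moreover have "?s = (\<lambda>P\<in>?V. fract_map \<phi> (s {0}))"
  proof (rule restrict_ext)
    fix P assume "P \<in> ?V"
    then show "fract_map \<phi> (s {a. \<phi> a \<in> P}) = fract_map \<phi> (s {0})"
      using regular_function_eq_generic(2)[OF s, of "{a. \<phi> a \<in> P}"] by simp
  qed
  ultimately show ?thesis by simp
qed

section \<open>Polynomials over the localization\<close>

lemma domain_embedding_fract_poly:
  "domain_embedding (map_poly to_fract :: 'a::idom poly \<Rightarrow> 'a fract poly)"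
  by unfold_locales auto

text \<open>Nonconstancy of \<open>r\<close> is what makes the substitution injective.\<close>

lemma domain_embedding_pcompose:
  fixes r :: "'r::idom poly"
  assumes "degree r > 0"
  shows "domain_embedding (\<lambda>p. pcompose p r)"
  by unfold_locales
    (use assms pcompose_eq_0 in \<open>auto simp: pcompose_add pcompose_mult pcompose_1\<close>)

lemma domain_embedding_const_poly: "domain_embedding (\<lambda>a::'a::idom. [:a:])"
  by unfold_locales (auto simp: one_pCons)

lemma map_poly_pcompose:
  "map_poly to_fract (pcompose p r) = pcompose (map_poly to_fract p) (map_poly to_fract r)"
  by (induction p) (auto simp: pcompose_pCons map_poly_pCons)

locale nonzero_element =
  fixes x :: "'a::idom"
  assumes x_nonzero: "x \<noteq> 0"
begin

definition y :: "'a fract" where "y = to_fract x"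

lemma y_nonzero [simp]: "y \<noteq> 0"
  using x_nonzero by (simp add: y_def)

abbreviation polys :: "'a fract poly set" ("\<B>")
  where "\<B> \<equiv> polys_over_localization x"

lemma localization_iff: "c \<in> localization_at x \<longleftrightarrow> (\<exists>n a. y ^ n * c = to_fract a)"
proof
  assume "c \<in> localization_at x"
  then obtain a n where "c = Fract a (x ^ n)" by (auto simp: localization_at_def)
  then have "y ^ n * c = to_fract a"
    using x_nonzero
    by (simp add: y_def Fract_conv_to_fract to_fract_power)
  then show "\<exists>n a. y ^ n * c = to_fract a" by blast
next
  assume "\<exists>n a. y ^ n * c = to_fract a"
  then obtain n a where "y ^ n * c = to_fract a" by blast
  moreover have "c = y ^ n * c / y ^ n" by simp
  ultimately have "c = Fract a (x ^ n)"
    by (simp add: y_def Fract_conv_to_fract to_fract_power)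
  then show "c \<in> localization_at x" by (auto simp: localization_at_def)
qed

text \<open>A single power of \<open>x\<close> clears the denominators of all coefficients. This
  reduces questions about \<open>A_x[T]\<close> to polynomials over \<open>A\<close>.\<close>

lemma polys_iff: "q \<in> \<B> \<longleftrightarrow> (\<exists>n p. smult (y ^ n) q = map_poly to_fract p)"
proof
  show "\<exists>n p. smult (y ^ n) q = map_poly to_fract p" if "q \<in> \<B>"
    using that
  proof (induction q)
    case 0
    show ?case by (rule exI[of _ 0], rule exI[of _ 0]) simp
  next
    case (pCons c q)
    then have "coeff (pCons c q) k \<in> localization_at x" for k
      by (simp add: polys_over_localization_def)
    from this[of 0] this[of "Suc k" for k]
    have "c \<in> localization_at x" "q \<in> \<B>" by (simp_all add: polys_over_localization_def)
    with pCons.IH obtain n a m p where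
      "y ^ n * c = to_fract a" "smult (y ^ m) q = map_poly to_fract p"
      using localization_iff by metis
    moreover have "smult (y ^ (n + m)) (pCons c q) = pCons (y ^ m * (y ^ n * c)) (smult (y ^ n) (smult (y ^ m) q))"
      by (simp add: power_add mult_ac)
    ultimately have "smult (y ^ (n + m)) (pCons c q) = pCons (to_fract (x ^ m * a)) (smult (y ^ n) (map_poly to_fract p))"
      by (simp add: y_def to_fract_power)
    also have "\<dots> = map_poly to_fract (pCons (x ^ m * a) (smult (x ^ n) p))"
      by (simp add: map_poly_pCons y_def to_fract_power)
    finally show ?case by blast
  qed
next
  assume "\<exists>n p. smult (y ^ n) q = map_poly to_fract p"
  then obtain n p where np: "smult (y ^ n) q = map_poly to_fract p" by blast
  have "y ^ n * coeff q k = to_fract (coeff p k)" for k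
    using arg_cong[OF np, of "\<lambda>r. coeff r k"] by (simp add: coeff_map_poly)
  then show "q \<in> \<B>"
    unfolding polys_over_localization_def localization_iff by blast
qed

lemma fract_poly_smult_power: "map_poly to_fract (smult (x ^ n) p) = smult (y ^ n) (map_poly to_fract p)"
  by (simp add: y_def to_fract_power)

lemma fract_poly_in_polys: "map_poly to_fract p \<in> \<B>"
  unfolding polys_iff by (rule exI[of _ 0], rule exI[of _ p]) simp

lemma subring_set_polys: "subring_set \<B>"
  unfolding subring_set_def
proof (intro conjI ballI)
  show "1 \<in> \<B>" using fract_poly_in_polys[of 1] by simp
  fix q assume q: "q \<in> \<B>"
  then obtain n p where np: "smult (y ^ n) q = map_poly to_fract p" unfolding polys_iff by blast
  then have "smult (y ^ n) (- q) = map_poly to_fract (- p)"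
    using fract_poly_diff[of 0 p] by simp
  then show "- q \<in> \<B>" unfolding polys_iff by blast
  fix q' assume "q' \<in> \<B>"
  then obtain m p' where mp: "smult (y ^ m) q' = map_poly to_fract p'" unfolding polys_iff by blast
  have "smult (y ^ (n + m)) (q + q') = smult (y ^ m) (smult (y ^ n) q) + smult (y ^ n) (smult (y ^ m) q')"
    by (simp add: power_add smult_add_right mult.commute)
  also have "\<dots> = map_poly to_fract (smult (x ^ m) p + smult (x ^ n) p')"
    by (simp add: np mp fract_poly_smult_power del: smult_smult fract_poly_smult)
  finally show "q + q' \<in> \<B>" unfolding polys_iff by blast
  have "smult (y ^ (n + m)) (q * q') = smult (y ^ n) q * smult (y ^ m) q'"
    by (simp add: power_add mult.commute)
  also have "\<dots> = map_poly to_fract (p * p')" by (simp add: np mp)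
  finally show "q * q' \<in> \<B>" unfolding polys_iff by blast
qed

lemma polys_closed:
  "q \<in> \<B> \<Longrightarrow> q' \<in> \<B> \<Longrightarrow> q + q' \<in> \<B>" "q \<in> \<B> \<Longrightarrow> q' \<in> \<B> \<Longrightarrow> q * q' \<in> \<B>"
  using subring_set_polys by (auto simp: subring_set_def)

lemma pCons_in_polys_iff: "pCons c q \<in> \<B> \<longleftrightarrow> c \<in> localization_at x \<and> q \<in> \<B>"
  unfolding polys_over_localization_def by (simp add: coeff_pCons split: nat.split)
    (metis not0_implies_Suc)

lemma pcompose_in_polys: "q \<in> \<B> \<Longrightarrow> r \<in> \<B> \<Longrightarrow> pcompose q r \<in> \<B>"
proof (induction q)
  case (pCons c q)
  moreover have "0 \<in> \<B>" by (rule subring_set_zero[OF subring_set_polys])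
  ultimately show ?case by (auto simp: pcompose_pCons pCons_in_polys_iff intro!: polys_closed)
qed auto

text \<open>The extension of \<open>P\<close> to \<open>A_x[T]\<close>. For \<open>P\<close>
  avoiding \<open>x\<close>, extension and contraction are the usual bijection between the primes of
  a localization and the primes avoiding the inverted element.\<close>

definition loc :: "'a poly set \<Rightarrow> 'a fract poly set"
  where "loc P = {q. \<exists>n. \<exists>p \<in> P. smult (y ^ n) q = map_poly to_fract p}"

lemma loc_subset: "loc P \<subseteq> \<B>"
  unfolding loc_def using polys_iff by blast

lemma smult_in_prime_iff:
  assumes "P \<in> primes UNIV" "[:x:] \<notin> P"
  shows "smult (x ^ n) p \<in> P \<longleftrightarrow> p \<in> P"
proof -
  have "smult (x ^ n) p = [:x:] ^ n * p"
    by (simp add: poly_const_pow)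
  then show ?thesis using assms prime_mult_iff prime_power_iff by metis
qed

text \<open>The representation chosen for \<open>q\<close> does not matter: two of them agree after
  multiplication by powers of \<open>x\<close>, which lie outside the prime
  \<open>P\<close>.\<close>

lemma in_loc_iff:
  assumes P: "P \<in> primes UNIV" "[:x:] \<notin> P" and q: "smult (y ^ n) q = map_poly to_fract p"
  shows "q \<in> loc P \<longleftrightarrow> p \<in> P"
proof
  assume "q \<in> loc P"
  then obtain m p' where p': "p' \<in> P" "smult (y ^ m) q = map_poly to_fract p'"
    by (auto simp: loc_def)
  have "map_poly to_fract (smult (x ^ m) p) = smult (y ^ m) (smult (y ^ n) q)"
    unfolding fract_poly_smult_power q ..
  also have "\<dots> = smult (y ^ n) (smult (y ^ m) q)" by (simp add: mult.commute)
  also have "\<dots> = map_poly to_fract (smult (x ^ n) p')"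
    unfolding fract_poly_smult_power p' ..
  finally have "smult (x ^ m) p = smult (x ^ n) p'" by (simp only: fract_poly_eq_iff)
  then show "p \<in> P" using smult_in_prime_iff[OF P] p'(1) by metis
qed (use q in \<open>auto simp: loc_def\<close>)

lemma fract_poly_in_loc_iff:
  assumes "P \<in> primes UNIV" "[:x:] \<notin> P"
  shows "map_poly to_fract p \<in> loc P \<longleftrightarrow> p \<in> P"
  using in_loc_iff[OF assms, of 0 "map_poly to_fract p" p] by simp

lemma loc_in_primes:
  assumes P: "P \<in> primes UNIV" "[:x:] \<notin> P"
  shows "loc P \<in> primes \<B>"
  unfolding primes_iff[OF subring_set_polys]
proof (intro conjI ballI impI loc_subset)
  show "0 \<in> loc P" "1 \<notin> loc P"
    using fract_poly_in_loc_iff[OF P, of 0] fract_poly_in_loc_iff[OF P, of 1]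
      zero_in_prime[OF P(1)] one_notin_prime[OF P(1)] by auto
  have rep: "\<exists>n p. smult (y ^ n) q = map_poly to_fract p" if "q \<in> \<B>" for q
    using that polys_iff by blast
  {
    fix q q' assume "q \<in> loc P" "q' \<in> loc P"
    then obtain n p m p' where np: "p \<in> P" "smult (y ^ n) q = map_poly to_fract p"
      and mp: "p' \<in> P" "smult (y ^ m) q' = map_poly to_fract p'" by (auto simp: loc_def)
    have "smult (y ^ (n + m)) (q + q') = smult (y ^ m) (smult (y ^ n) q) + smult (y ^ n) (smult (y ^ m) q')"
      by (simp add: power_add smult_add_right mult.commute)
    also have "\<dots> = map_poly to_fract (smult (x ^ m) p + smult (x ^ n) p')"
      by (simp add: np mp fract_poly_smult_power del: smult_smult fract_poly_smult)
    finally show "q + q' \<in> loc P"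
      using in_loc_iff[OF P] np(1) mp(1) P(1) by (metis primes_UNIV_iff smult_in_prime_iff[OF P])
  }
  {
    fix q q' assume "q \<in> \<B>" "q' \<in> \<B>"
    then obtain n p m p' where np: "smult (y ^ n) q = map_poly to_fract p"
      and mp: "smult (y ^ m) q' = map_poly to_fract p'" using rep by metis
    have "smult (y ^ (n + m)) (q * q') = smult (y ^ n) q * smult (y ^ m) q'"
      by (simp add: power_add mult.commute)
    also have "\<dots> = map_poly to_fract (p * p')" by (simp add: np mp)
    finally have "q * q' \<in> loc P \<longleftrightarrow> p * p' \<in> P" by (rule in_loc_iff[OF P])
    then have "q * q' \<in> loc P \<longleftrightarrow> q \<in> loc P \<or> q' \<in> loc P"
      using in_loc_iff[OF P np] in_loc_iff[OF P mp] prime_mult_iff[OF P(1)] by simp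
  } note mult = this
  show "q * q' \<in> loc P" if "q \<in> \<B>" "q' \<in> loc P" for q q'
    using that mult loc_subset by blast
  show "q \<in> loc P \<or> q' \<in> loc P" if "q \<in> \<B>" "q' \<in> \<B>" "q * q' \<in> loc P" for q q'
    using that mult by blast
qed

lemma contraction_in_primes:
  assumes w: "w \<in> primes \<B>"
  shows "{p. map_poly to_fract p \<in> w} \<in> primes UNIV"
  using primes_preimage[OF subring_set_UNIV subring_set_polys w, of "map_poly to_fract"]
    fract_poly_in_polys by simp

text \<open>\<open>x\<close> is a unit of \<open>A_x[T]\<close>.\<close>

lemma contraction_avoids:
  assumes w: "w \<in> primes \<B>"
  shows "[:x:] \<notin> {p. map_poly to_fract p \<in> w}"
proof
  assume "[:x:] \<in> {p. map_poly to_fract p \<in> w}"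
  then have "[:y:] \<in> w" by (simp add: map_poly_pCons y_def)
  moreover have "[:1 / y:] \<in> \<B>"
    unfolding polys_iff
    by (rule exI[of _ 1], rule exI[of _ 1]) (simp flip: one_pCons)
  moreover have "[:1 / y:] * [:y:] = 1" by (simp add: one_pCons)
  ultimately show False using w unfolding primes_iff[OF subring_set_polys] by metis
qed

text \<open>Multiplication by \<open>y^n\<close> and by its inverse both stay inside
  \<open>A_x[T]\<close>, so clearing denominators does not affect membership in
  \<open>w\<close>.\<close>

lemma loc_contraction:
  assumes w: "w \<in> primes \<B>"
  shows "loc {p. map_poly to_fract p \<in> w} = w"
proof -
  let ?P = "{p. map_poly to_fract p \<in> w}"
  note P = contraction_in_primes[OF w] contraction_avoids[OF w]
  have "q \<in> loc ?P \<longleftrightarrow> q \<in> w" if q: "q \<in> \<B>" for q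
  proof -
    from q obtain n p where np: "smult (y ^ n) q = map_poly to_fract p" using polys_iff by blast
    have "q \<in> loc ?P \<longleftrightarrow> map_poly to_fract p \<in> w" using in_loc_iff[OF P np] by simp
    also have "\<dots> \<longleftrightarrow> q \<in> w"
    proof
      assume "q \<in> w"
      moreover have "[:y ^ n:] \<in> \<B>"
        using fract_poly_in_polys[of "[:x ^ n:]"] by (simp add: map_poly_pCons y_def to_fract_power)
      moreover have "[:y ^ n:] * q = map_poly to_fract p" using np by simp
      ultimately show "map_poly to_fract p \<in> w" using w unfolding primes_iff[OF subring_set_polys] by metis
    next
      assume "map_poly to_fract p \<in> w"
      moreover have "[:1 / y ^ n:] \<in> \<B>"
        unfolding polys_iff
        by (rule exI[of _ n], rule exI[of _ 1]) (simp flip: one_pCons)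
      moreover have "[:1 / y ^ n:] * map_poly to_fract p = q" using np[symmetric] by simp
      ultimately show "q \<in> w" using w unfolding primes_iff[OF subring_set_polys] by metis
    qed
    finally show ?thesis .
  qed
  moreover have "w \<subseteq> \<B>" using w unfolding primes_iff[OF subring_set_polys] by blast
  ultimately show ?thesis using loc_subset by blast
qed

end

section \<open>Points and sections of the surface\<close>

locale surface_charts = nonzero_element x for x :: "'a::idom" +
  fixes \<gamma> :: "'v rel \<times> ('v \<Rightarrow> 'a)"
begin

abbreviation I :: "'v set" where "I \<equiv> leaves (fst \<gamma>)"
abbreviation m :: "'v \<Rightarrow> nat" where "m i \<equiv> level (fst \<gamma>) i"
abbreviation \<sigma> :: "'v \<Rightarrow> 'a" where "\<sigma> \<equiv> snd \<gamma>"
abbreviation S where "S \<equiv> surface x \<gamma>"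

text \<open>The coordinate \<open>u = \<sigma>\<^sub>i + x\<^sup>m T\<^sub>i\<close> is common to all charts; \<open>L i\<close> expresses it in
  terms of \<open>T\<^sub>i\<close> and \<open>K i\<close> expresses \<open>T\<^sub>i\<close> in terms of it.\<close>

definition L :: "'v \<Rightarrow> 'a fract poly"
  where "L i = [:to_fract (\<sigma> i), y ^ m i:]"

definition K :: "'v \<Rightarrow> 'a fract poly"
  where "K i = [:- to_fract (\<sigma> i) / y ^ m i, 1 / y ^ m i:]"

lemma L_K: "pcompose (L i) (K i) = [:0, 1:]"
  by (simp add: L_def K_def pcompose_pCons)

lemma K_L: "pcompose (K i) (L i) = [:0, 1:]"
  by (simp add: L_def K_def pcompose_pCons diff_divide_distrib)

lemma pcompose_cancel:
  "pcompose (pcompose p (L i)) (K i) = p" "pcompose (pcompose p (K i)) (L i) = p"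
  by (simp_all add: L_K K_L flip: pcompose_assoc)

lemma degree_L: "degree (L i) > 0" and degree_K: "degree (K i) > 0"
  by (simp_all add: L_def K_def)

lemma L_in_polys: "L i \<in> \<B>"
  using fract_poly_in_polys[of "[:\<sigma> i, x ^ m i:]"]
  by (simp add: L_def map_poly_pCons y_def to_fract_power)

lemma K_in_polys: "K i \<in> \<B>"
  unfolding polys_iff
  by (rule exI[of _ "m i"], rule exI[of _ "[:- \<sigma> i, 1:]"]) (simp add: K_def map_poly_pCons)

text \<open>The transition polynomial, factored through the common coordinate \<open>u\<close>. This
  factorization is why the gluing is consistent on triple overlaps and \<open>R\<close> is
  transitive.\<close>

definition tr :: "'v \<Rightarrow> 'v \<Rightarrow> 'a fract poly"
  where "tr i j = pcompose (K i) (L j)"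

lemma L_tr: "pcompose (L i) (tr i j) = L j"
  unfolding tr_def pcompose_assoc L_K by (simp add: pcompose_pCons)

lemma tr_in_polys: "tr i j \<in> \<B>"
  unfolding tr_def by (intro pcompose_in_polys K_in_polys L_in_polys)

lemma degree_tr: "degree (tr i j) > 0"
  unfolding tr_def degree_pcompose using degree_L degree_K by simp

lemma transition_eq: "transition x \<gamma> i j p = pcompose p (tr i j)"
proof -
  have "[: y powi (- int (m i)) * to_fract (\<sigma> j - \<sigma> i), y powi (int (m j) - int (m i)) :] = tr i j"
    by (simp add: tr_def K_def L_def pcompose_pCons power_int_minus power_int_diff field_simps)
  then show ?thesis by (simp add: transition_def y_def Let_def)
qed

abbreviation iota :: "'a poly \<Rightarrow> 'a fract poly" ("\<iota>")
  where "\<iota> \<equiv> map_poly to_fract"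

text \<open>The prime ideal of \<open>A\<^sub>x[u]\<close> corresponding to the point \<open>P\<close> of the chart \<open>i\<close>; two points of
  different charts not lying over \<open>x = 0\<close> are glued when these prime ideals agree.\<close>

definition common :: "'v \<Rightarrow> 'a poly set \<Rightarrow> 'a fract poly set"
  where "common i P = {q \<in> \<B>. pcompose q (L i) \<in> loc P}"

definition R :: "(('v \<times> 'a poly set) \<times> ('v \<times> 'a poly set)) set"
  where "R = glue_rel I (\<lambda>i. affine_line) (\<lambda>i j. affine_line_over_X_star x)
    (overlap_left x \<gamma>) (\<lambda>i j. overlap_right x)"

lemma points_affine_line: "points (affine_line :: ('a poly set, 'a poly set \<Rightarrow> 'a poly fract) ringed_space) = primes UNIV"
  by (simp add: affine_line_def Spec_def topspace_zariski subring_set_UNIV)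

lemma points_overlap: "points (affine_line_over_X_star x) = primes \<B>"
  by (simp add: affine_line_over_X_star_def Spec_def topspace_zariski subring_set_polys)

lemma on_points_overlap:
  "on_points (overlap_left x \<gamma> i j) w = {p. pcompose (\<iota> p) (tr i j) \<in> w}"
  "on_points (overlap_right x) w = {p. \<iota> p \<in> w}"
  by (simp_all add: overlap_left_def overlap_right_def Spec_map_def transition_eq)

lemma R_iff_overlap:
  "((i, P), (j, Q)) \<in> R \<longleftrightarrow> i \<in> I \<and> j \<in> I \<and> (i = j \<and> P = Q \<and> P \<in> primes UNIV \<or>
    i \<noteq> j \<and> (\<exists>w \<in> primes \<B>. P = {p. pcompose (\<iota> p) (tr i j) \<in> w} \<and> Q = {p. \<iota> p \<in> w}))"
  unfolding R_def glue_rel_def points_affine_line points_overlap on_points_overlap by auto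

text \<open>The invariant \<open>common\<close> loses no information: \<open>P\<close> can be read
  off from it.\<close>

lemma common_iff:
  assumes "P \<in> primes UNIV" "[:x:] \<notin> P"
  shows "p \<in> P \<longleftrightarrow> pcompose (\<iota> p) (K i) \<in> common i P"
  using fract_poly_in_loc_iff[OF assms] pcompose_in_polys[OF fract_poly_in_polys K_in_polys]
  by (simp add: common_def pcompose_cancel)

text \<open>Replaces the existence of a point \<open>w\<close> of the overlap by the equality of an
  invariant attached to each of the two points, from which symmetry and transitivity can be read
  off.\<close>

lemma R_iff:
  "((i, P), (j, Q)) \<in> R \<longleftrightarrow> i \<in> I \<and> j \<in> I \<and> P \<in> primes UNIV \<and> Q \<in> primes UNIV \<and>
    ((i, P) = (j, Q) \<or> [:x:] \<notin> P \<and> [:x:] \<notin> Q \<and> common i P = common j Q)"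
proof (cases "i = j")
  case True
  have "P = Q" if "P \<in> primes UNIV" "Q \<in> primes UNIV" "[:x:] \<notin> P" "[:x:] \<notin> Q"
    "common i P = common i Q"
    using that common_iff[of _ _ i] by blast
  then show ?thesis using True unfolding R_iff_overlap by auto
next
  case False
  have "\<exists>w \<in> primes \<B>. P = {p. pcompose (\<iota> p) (tr i j) \<in> w} \<and> Q = {p. \<iota> p \<in> w}"
    if P: "P \<in> primes UNIV" "[:x:] \<notin> P" and Q: "Q \<in> primes UNIV" "[:x:] \<notin> Q"
      and eq: "common i P = common j Q"
  proof
    \<comment> \<open>The immersion into the chart \<open>j\<close> is induced by the inclusion of
      coefficients, so the point of the overlap has to be the extension of \<open>Q\<close>.\<close>
    show "loc Q \<in> primes \<B>" by (rule loc_in_primes[OF Q])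
    have "p \<in> P \<longleftrightarrow> pcompose (\<iota> p) (tr i j) \<in> loc Q" for p
      unfolding common_iff[OF P, of p i] eq
      using pcompose_in_polys[OF fract_poly_in_polys K_in_polys]
      by (simp add: common_def tr_def pcompose_assoc)
    then show "P = {p. pcompose (\<iota> p) (tr i j) \<in> loc Q} \<and> Q = {p. \<iota> p \<in> loc Q}"
      using fract_poly_in_loc_iff[OF Q] by auto
  qed
  moreover have "P \<in> primes UNIV \<and> Q \<in> primes UNIV \<and> [:x:] \<notin> P \<and> [:x:] \<notin> Q \<and> common i P = common j Q"
    if w: "w \<in> primes \<B>" and P: "P = {p. pcompose (\<iota> p) (tr i j) \<in> w}" and Q: "Q = {p. \<iota> p \<in> w}" for w
  proof -
    \<comment> \<open>\<open>w\<close> transported to \<open>A_x[T_i]\<close> along the transition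
      isomorphism; it turns out to be the extension of \<open>P\<close>.\<close>
    define v where "v = {q \<in> \<B>. pcompose q (tr i j) \<in> w}"
    have v: "v \<in> primes \<B>"
      unfolding v_def
      by (rule primes_preimage[OF subring_set_polys subring_set_polys w])
        (auto simp: pcompose_in_polys tr_in_polys pcompose_add pcompose_mult pcompose_1)
    have "P = {p. \<iota> p \<in> v}" unfolding P v_def using fract_poly_in_polys by auto
    with v have "loc P = v" "P \<in> primes UNIV" "[:x:] \<notin> P"
      using loc_contraction contraction_in_primes contraction_avoids by auto
    moreover have "loc Q = w" "Q \<in> primes UNIV" "[:x:] \<notin> Q"
      using w Q loc_contraction contraction_in_primes contraction_avoids by auto
    moreover have "pcompose q (L i) \<in> v \<longleftrightarrow> pcompose q (L j) \<in> w" if "q \<in> \<B>" for q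
      unfolding v_def using that pcompose_in_polys[OF that L_in_polys]
      by (simp add: L_tr flip: pcompose_assoc)
    ultimately show ?thesis by (auto simp: common_def)
  qed
  ultimately show ?thesis using False unfolding R_iff_overlap by blast
qed

lemma equiv_R: "equiv (SIGMA i:I. primes UNIV) R"
proof (rule equivI)
  show "R \<subseteq> (SIGMA i:I. primes UNIV) \<times> (SIGMA i:I. primes UNIV)" by (auto simp: R_iff)
  show "refl_on (SIGMA i:I. primes UNIV) R" by (auto simp: refl_on_def R_iff)
  show "sym R" by (auto simp: sym_def R_iff)
  show "trans R" unfolding trans_def by (auto simp: R_iff)
qed

definition cls :: "'v \<Rightarrow> 'a poly set \<Rightarrow> ('v \<times> 'a poly set) set"
  where "cls i P = R `` {(i, P)}"

definition ch :: "'v \<Rightarrow> ('v \<times> 'a poly set) set set \<Rightarrow> 'a poly set set"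
  where "ch i U = {P \<in> primes UNIV. cls i P \<in> U}"

lemma cls_eq_iff:
  assumes "i \<in> I" "P \<in> primes UNIV" "j \<in> I" "Q \<in> primes UNIV"
  shows "cls i P = cls j Q \<longleftrightarrow> ((i, P), (j, Q)) \<in> R"
  unfolding cls_def using eq_equiv_class_iff[OF equiv_R, of "(i, P)" "(j, Q)"] assms by simp

lemma in_cls_self: "i \<in> I \<Longrightarrow> P \<in> primes UNIV \<Longrightarrow> (i, P) \<in> cls i P"
  by (simp add: cls_def R_iff)

lemma glue_chart_eq: "glue_chart (\<lambda>i. affine_line) R i U = ch i U"
  unfolding glue_chart_def ch_def points_affine_line cls_def by simp

lemma openin_S: "openin (space_top S) U \<longleftrightarrow>
    U \<subseteq> {cls i P |i P. i \<in> I \<and> P \<in> primes UNIV} \<and> (\<forall>i \<in> I. zariski_open UNIV (ch i U))"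
proof -
  have "(SIGMA i:I. primes UNIV) // R = {cls i P |i P. i \<in> I \<and> P \<in> primes UNIV}"
    by (auto simp: quotient_def cls_def)
  then show ?thesis
    by (simp add: surface_def glue_def Let_def openin_glue_top glue_open_def points_affine_line
        affine_line_def Spec_def openin_zariski glue_chart_eq[unfolded affine_line_def Spec_def]
        topspace_zariski subring_set_UNIV
        flip: R_def[unfolded affine_line_def Spec_def])
qed

lemma points_S: "points S = {cls i P |i P. i \<in> I \<and> P \<in> primes UNIV}"
proof
  show "points S \<subseteq> {cls i P |i P. i \<in> I \<and> P \<in> primes UNIV}"
    using openin_topspace[of "space_top S"] unfolding openin_S by blast
  have "ch i {cls i P |i P. i \<in> I \<and> P \<in> primes UNIV} = primes UNIV" if "i \<in> I" for i
    using that by (auto simp: ch_def)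
  then show "{cls i P |i P. i \<in> I \<and> P \<in> primes UNIV} \<subseteq> points S"
    by (intro openin_subset) (simp add: openin_S zariski_open_primes)
qed

lemma ch_points: "i \<in> I \<Longrightarrow> ch i (points S) = primes UNIV"
  unfolding points_S by (auto simp: ch_def)

lemma ch_open: "openin (space_top S) U \<Longrightarrow> i \<in> I \<Longrightarrow> zariski_open UNIV (ch i U)"
  by (simp add: openin_S)

text \<open>Rational functions on the chart \<open>i\<close> are compared after rewriting them in terms of \<open>u\<close>.\<close>

definition H :: "'v \<Rightarrow> 'a poly fract \<Rightarrow> 'a fract poly fract"
  where "H i = fract_map (\<lambda>p. pcompose (\<iota> p) (K i))"

lemma domain_embedding_K: "domain_embedding (\<lambda>p. pcompose (\<iota> p) (K i))"
  by (rule domain_embedding_compose[OF domain_embedding_fract_poly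
      domain_embedding_pcompose[OF degree_K]])

text \<open>Both pullbacks take values in the fraction field of \<open>A_x[T_j]\<close>. Each is the
  fraction in \<open>u\<close> with \<open>L j\<close> substituted, and since this substitution is
  injective it can be undone.\<close>

lemma overlap_agree_iff:
  assumes s: "s \<in> regular_functions UNIV (ch i U)" and t: "t \<in> regular_functions UNIV (ch j U)"
    and ij: "i \<in> I" "j \<in> I" "i \<noteq> j"
  shows "on_sections (overlap_left x \<gamma> i j) (ch i U) s = on_sections (overlap_right x) (ch j U) t \<longleftrightarrow>
    (\<forall>P Q. ((i, P), (j, Q)) \<in> R \<longrightarrow> P \<in> ch i U \<longrightarrow> H i (s P) = H j (t Q))"
proof -
  let ?l = "\<lambda>w. {p. pcompose (\<iota> p) (tr i j) \<in> w}" and ?r = "\<lambda>w. {p. \<iota> p \<in> w}"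
  have rel: "((i, ?l w), (j, ?r w)) \<in> R" if "w \<in> primes \<B>" for w
    unfolding R_iff_overlap using that ij by blast
  have dom: "?l w \<in> ch i U \<longleftrightarrow> ?r w \<in> ch j U" if "w \<in> primes \<B>" for w
    using rel[OF that] cls_eq_iff[of i "?l w" j "?r w"] ij unfolding ch_def by (auto simp: R_iff)
  have emb: "domain_embedding (\<lambda>p. pcompose (\<iota> p) (tr i j))"
    by (rule domain_embedding_compose[OF domain_embedding_fract_poly
        domain_embedding_pcompose[OF degree_tr]])
  have embL: "domain_embedding (\<lambda>p. pcompose p (L j))"
    by (rule domain_embedding_pcompose[OF degree_L])
  interpret E: domain_embedding "fract_map (\<lambda>p. pcompose p (L j))"
    by (rule domain_embedding.domain_embedding_fract_map[OF embL])
  have l: "localized_hom UNIV (\<lambda>p. pcompose (\<iota> p) (tr i j)) w (s (?l w)) =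
      fract_map (\<lambda>p. pcompose p (L j)) (H i (s (?l w)))" if w: "w \<in> primes \<B>" "?l w \<in> ch i U" for w
  proof -
    obtain a b where ab: "b \<notin> ?l w" "s (?l w) = Fract a b"
      using regular_function_stalk[OF s w(2)] by blast
    have "0 \<in> w" using w(1) primes_iff[OF subring_set_polys] by blast
    then have "localized_hom UNIV (\<lambda>p. pcompose (\<iota> p) (tr i j)) w (s (?l w)) =
        fract_map (\<lambda>p. pcompose (\<iota> p) (tr i j)) (s (?l w))"
      using domain_embedding.localized_hom_eq_fract_map[OF emb ab(2)] ab(1) by blast
    then show ?thesis
      by (simp add: H_def fract_map_compose[OF domain_embedding_K embL] tr_def pcompose_assoc)
  qed
  have r: "localized_hom UNIV \<iota> w (t (?r w)) =
      fract_map (\<lambda>p. pcompose p (L j)) (H j (t (?r w)))" if w: "w \<in> primes \<B>" "?r w \<in> ch j U" for w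
  proof -
    obtain a b where ab: "b \<notin> ?r w" "t (?r w) = Fract a b"
      using regular_function_stalk[OF t w(2)] by blast
    have "0 \<in> w" using w(1) primes_iff[OF subring_set_polys] by blast
    then have "localized_hom UNIV \<iota> w (t (?r w)) = fract_map \<iota> (t (?r w))"
      using domain_embedding.localized_hom_eq_fract_map[OF domain_embedding_fract_poly ab(2)] ab(1) by blast
    then show ?thesis
      by (simp add: H_def fract_map_compose[OF domain_embedding_K embL] pcompose_cancel)
  qed
  have "on_sections (overlap_left x \<gamma> i j) (ch i U) s = on_sections (overlap_right x) (ch j U) t \<longleftrightarrow>
    (\<forall>w \<in> primes \<B>. ?l w \<in> ch i U \<longrightarrow> H i (s (?l w)) = H j (t (?r w)))"
  proof -
    have "on_sections (overlap_left x \<gamma> i j) (ch i U) s =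
      (\<lambda>w \<in> {w \<in> primes \<B>. ?l w \<in> ch i U}. fract_map (\<lambda>p. pcompose p (L j)) (H i (s (?l w))))"
      unfolding overlap_left_def Spec_map_def transition_eq by (auto intro!: restrict_ext simp: l)
    moreover have "on_sections (overlap_right x) (ch j U) t =
      (\<lambda>w \<in> {w \<in> primes \<B>. ?l w \<in> ch i U}. fract_map (\<lambda>p. pcompose p (L j)) (H j (t (?r w))))"
    proof -
      have "on_sections (overlap_right x) (ch j U) t =
        (\<lambda>w \<in> {w \<in> primes \<B>. ?r w \<in> ch j U}. fract_map (\<lambda>p. pcompose p (L j)) (H j (t (?r w))))"
        unfolding overlap_right_def Spec_map_def by (auto intro!: restrict_ext simp: r)
      \<comment> \<open>The two domains coincide because related points have the same class.\<close>
      moreover have "{w \<in> primes \<B>. ?r w \<in> ch j U} = {w \<in> primes \<B>. ?l w \<in> ch i U}"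
        using dom by blast
      ultimately show ?thesis by simp
    qed
    ultimately show ?thesis by (auto simp: restrict_def fun_eq_iff E.hom_eq_iff)
  qed
  also have "\<dots> \<longleftrightarrow> (\<forall>P Q. ((i, P), (j, Q)) \<in> R \<longrightarrow> P \<in> ch i U \<longrightarrow> H i (s P) = H j (t Q))"
    unfolding R_iff_overlap using ij by blast
  finally show ?thesis .
qed

lemma carrier_sections:
  "s \<in> carrier (sections S U) \<longleftrightarrow> s \<in> extensional I \<and>
    (\<forall>i \<in> I. s i \<in> regular_functions UNIV (ch i U)) \<and>
    (\<forall>i j P Q. ((i, P), (j, Q)) \<in> R \<longrightarrow> P \<in> ch i U \<longrightarrow> H i (s i P) = H j (s j Q))"
proof -
  have "s \<in> carrier (sections S U) \<longleftrightarrow> s \<in> (\<Pi>\<^sub>E i\<in>I. regular_functions UNIV (ch i U)) \<and>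
    (\<forall>i \<in> I. \<forall>j \<in> I. i \<noteq> j \<longrightarrow> on_sections (overlap_left x \<gamma> i j) (ch i U) (s i) =
      on_sections (overlap_right x) (ch j U) (s j))"
    by (simp add: surface_def glue_def Let_def glue_chart_eq flip: R_def)
      (simp add: affine_line_def Spec_def)
  also have "\<dots> \<longleftrightarrow> s \<in> extensional I \<and>
    (\<forall>i \<in> I. s i \<in> regular_functions UNIV (ch i U)) \<and>
    (\<forall>i \<in> I. \<forall>j \<in> I. i \<noteq> j \<longrightarrow> (\<forall>P Q. ((i, P), (j, Q)) \<in> R \<longrightarrow> P \<in> ch i U \<longrightarrow> H i (s i P) = H j (s j Q)))"
    (is "_ \<longleftrightarrow> ?rhs")
  proof -
    have "(\<forall>i \<in> I. \<forall>j \<in> I. i \<noteq> j \<longrightarrow> on_sections (overlap_left x \<gamma> i j) (ch i U) (s i) =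
        on_sections (overlap_right x) (ch j U) (s j)) \<longleftrightarrow>
      (\<forall>i \<in> I. \<forall>j \<in> I. i \<noteq> j \<longrightarrow>
        (\<forall>P Q. ((i, P), (j, Q)) \<in> R \<longrightarrow> P \<in> ch i U \<longrightarrow> H i (s i P) = H j (s j Q)))"
      if "\<forall>i \<in> I. s i \<in> regular_functions UNIV (ch i U)"
      using that by (simp add: overlap_agree_iff)
    then show ?thesis unfolding PiE_iff by blast
  qed
  also have "\<dots> \<longleftrightarrow> s \<in> extensional I \<and>
    (\<forall>i \<in> I. s i \<in> regular_functions UNIV (ch i U)) \<and>
    (\<forall>i j P Q. ((i, P), (j, Q)) \<in> R \<longrightarrow> P \<in> ch i U \<longrightarrow> H i (s i P) = H j (s j Q))"
    unfolding R_iff_overlap by blast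
  finally show ?thesis .
qed

lemma sections_ops:
  "s \<otimes>\<^bsub>sections S U\<^esub> t = (\<lambda>i\<in>I. \<lambda>P\<in>ch i U. s i P * t i P)"
  "s \<oplus>\<^bsub>sections S U\<^esub> t = (\<lambda>i\<in>I. \<lambda>P\<in>ch i U. s i P + t i P)"
  "\<one>\<^bsub>sections S U\<^esub> = (\<lambda>i\<in>I. \<lambda>P\<in>ch i U. 1)"
  "restr S U V s = (\<lambda>i\<in>I. restrict (s i) (ch i V))"
  by (simp_all add: surface_def glue_def Let_def glue_chart_eq flip: R_def)
    (simp_all add: affine_line_def Spec_def)

text \<open>The definite description in \<open>glue_map\<close> is meaningful because constants are
  fixed by all substitutions: glued points have the same \<open>common\<close> and so contain the
  same constants.\<close>

lemma projection_points:
  assumes "i \<in> I" "P \<in> primes UNIV"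
  shows "on_points (surface_projection \<gamma>) (cls i P) = {a. [:a:] \<in> P}"
proof -
  have eq: "{a. [:a:] \<in> Q} = {a. [:a:] \<in> P}" if "(j, Q) \<in> cls i P" for j Q
  proof -
    have *: "[:a:] \<in> P' \<longleftrightarrow> [:to_fract a:] \<in> common k P'"
      if "P' \<in> primes UNIV" "[:x:] \<notin> P'" for a k P'
      using common_iff[OF that, of "[:a:]" k] by (simp add: map_poly_pCons)
    from that show ?thesis unfolding cls_def by (auto simp: R_iff) (metis *)+
  qed
  have "on_points (surface_projection \<gamma>) (cls i P) = (THE y. \<exists>(j, Q) \<in> cls i P. y = {a. [:a:] \<in> Q})"
    by (simp add: surface_projection_def glue_map_def Spec_map_def)
  also have "\<dots> = {a. [:a:] \<in> P}"
  proof (rule the_equality)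
    show "\<exists>(j, Q) \<in> cls i P. {a. [:a:] \<in> P} = {a. [:a:] \<in> Q}"
      using in_cls_self[OF assms] by blast
    show "z = {a. [:a:] \<in> P}" if "\<exists>(j, Q) \<in> cls i P. z = {a. [:a:] \<in> Q}" for z
    proof -
      from that obtain j Q where "(j, Q) \<in> cls i P" "z = {a. [:a:] \<in> Q}" by blast
      then show ?thesis using eq by metis
    qed
  qed
  finally show ?thesis .
qed

lemma projection_sections:
  "on_sections (surface_projection \<gamma>) V t = (\<lambda>i\<in>I. \<lambda>P\<in>{P \<in> primes UNIV. {a. [:a:] \<in> P} \<in> V}.
    localized_hom UNIV (\<lambda>a. [:a:]) P (t {a. [:a:] \<in> P}))"
  by (simp add: surface_projection_def glue_map_def Spec_map_def)

end

section \<open>Isomorphisms from affine coordinate changes\<close>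

text \<open>\<open>lrs_morphism\<close> without the condition on stalks, which
  \<open>lrs_morphism_if_inverse\<close> supplies for a pair of inverse maps.\<close>

definition ringed_space_map ::
    "('p, 's) ringed_space \<Rightarrow> ('q, 't) ringed_space \<Rightarrow> ('p, 's, 'q, 't) space_map \<Rightarrow> bool"
  where "ringed_space_map S Y f \<longleftrightarrow>
    continuous_map (space_top S) (space_top Y) (on_points f) \<and>
    (\<forall>V. openin (space_top Y) V \<longrightarrow>
      on_sections f V \<in> ring_hom (sections Y V) (sections S (preim S f V))) \<and>
    (\<forall>V W. openin (space_top Y) V \<and> openin (space_top Y) W \<and> W \<subseteq> V \<longrightarrow>
      (\<forall>t \<in> carrier (sections Y V).
        on_sections f W (restr Y V W t) =
          restr S (preim S f V) (preim S f W) (on_sections f V t)))"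

lemma openin_preim:
  assumes "ringed_space_map S Y f" "openin (space_top Y) V"
  shows "openin (space_top S) (preim S f V)"
  using assms by (simp add: ringed_space_map_def continuous_map_def preim_def)

lemma preim_preim:
  assumes g: "ringed_space_map Y S g" and "same_map Y Y (comp_map S f g) id_map" "V \<subseteq> points Y"
  shows "preim Y g (preim S f V) = V"
proof -
  have "on_points g y \<in> points S" if "y \<in> points Y" for y
    using g that unfolding ringed_space_map_def continuous_map_def by blast
  then show ?thesis
    using assms(2,3) by (auto simp: same_map_def comp_map_def id_map_def preim_def)
qed

text \<open>A map with an inverse is local on stalks: a neighbourhood on which the pullback of a
  section is invertible is carried by the inverse map to one on which the section is.\<close>

lemma lrs_morphism_if_inverse:
  assumes f: "ringed_space_map S Y f" and g: "ringed_space_map Y S g"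
    and gf: "same_map S S (comp_map Y g f) id_map" and fg: "same_map Y Y (comp_map S f g) id_map"
  shows "lrs_morphism S Y f"
proof -
  have "germ_invertible Y V t (on_points f p)"
    if V: "openin (space_top Y) V" and t: "t \<in> carrier (sections Y V)" and p: "p \<in> preim S f V"
      and inv: "germ_invertible S (preim S f V) (on_sections f V t) p" for V t p
  proof -
    from inv obtain W where W: "openin (space_top S) W" "p \<in> W" "W \<subseteq> preim S f V"
      and unit: "restr S (preim S f V) W (on_sections f V t) \<in> Units (sections S W)"
      by (auto simp: germ_invertible_def)
    define W' where "W' = preim Y g W"
    have openW': "openin (space_top Y) W'" unfolding W'_def by (rule openin_preim[OF g W(1)])
    have VY: "V \<subseteq> points Y" by (rule openin_subset[OF V])
    have W'V: "W' \<subseteq> V"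
      using W(3) fg unfolding W'_def by (auto simp: preim_def same_map_def comp_map_def id_map_def)
    have "on_points f p \<in> W'"
      using p W gf VY unfolding W'_def
      by (auto simp: preim_def same_map_def comp_map_def id_map_def)
    moreover have "restr Y V W' t \<in> Units (sections Y W')"
    proof -
      have fV: "openin (space_top S) (preim S f V)" by (rule openin_preim[OF f V])
      have hom: "on_sections g W \<in> ring_hom (sections S W) (sections Y W')"
        using g W(1) unfolding ringed_space_map_def W'_def by blast
      have ft: "on_sections f V t \<in> carrier (sections S (preim S f V))"
        using f V t ring_hom_closed unfolding ringed_space_map_def by metis
      have "on_sections g W (restr S (preim S f V) W (on_sections f V t)) =
          restr Y (preim Y g (preim S f V)) W' (on_sections g (preim S f V) (on_sections f V t))"
        using g fV W ft unfolding ringed_space_map_def W'_def by blast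
      also have "\<dots> = restr Y V W' t"
        using fg V t preim_preim[OF g fg VY] by (simp add: same_map_def comp_map_def id_map_def)
      finally have eq: "on_sections g W (restr S (preim S f V) W (on_sections f V t)) = restr Y V W' t" .
      from unit obtain r where r: "r \<in> carrier (sections S W)"
        "restr S (preim S f V) W (on_sections f V t) \<in> carrier (sections S W)"
        "r \<otimes>\<^bsub>sections S W\<^esub> restr S (preim S f V) W (on_sections f V t) = \<one>\<^bsub>sections S W\<^esub>"
        "restr S (preim S f V) W (on_sections f V t) \<otimes>\<^bsub>sections S W\<^esub> r = \<one>\<^bsub>sections S W\<^esub>"
        by (auto simp: Units_def)
      then have "on_sections g W r \<otimes>\<^bsub>sections Y W'\<^esub> restr Y V W' t = \<one>\<^bsub>sections Y W'\<^esub>"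
        "restr Y V W' t \<otimes>\<^bsub>sections Y W'\<^esub> on_sections g W r = \<one>\<^bsub>sections Y W'\<^esub>"
        using ring_hom_mult[OF hom] ring_hom_one[OF hom] eq by metis+
      moreover have "on_sections g W r \<in> carrier (sections Y W')"
        "restr Y V W' t \<in> carrier (sections Y W')"
        using ring_hom_closed[OF hom] r eq by metis+
      ultimately show ?thesis unfolding Units_def by blast
    qed
    ultimately show ?thesis using openW' W'V unfolding germ_invertible_def by blast
  qed
  then show ?thesis using f by (simp add: lrs_morphism_def ringed_space_map_def)
qed

text \<open>The chart \<open>i\<close> is mapped to the chart \<open>J i\<close> by \<open>T' \<mapsto> t i\<close>; all these maps are given by \<open>u' \<mapsto> \<theta>\<close> in
  the common coordinates, and therefore glue.\<close>

locale chart_map = src: surface_charts x \<gamma> + tgt: surface_charts x \<gamma>'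
  for x :: "'a::idom" and \<gamma> :: "'v rel \<times> ('v \<Rightarrow> 'a)" and \<gamma>' :: "'w rel \<times> ('w \<Rightarrow> 'a)" +
  fixes J :: "'v \<Rightarrow> 'w" and t :: "'v \<Rightarrow> 'a poly" and \<theta> :: "'a fract poly"
  assumes J: "i \<in> src.I \<Longrightarrow> J i \<in> tgt.I"
    and degree_t: "i \<in> src.I \<Longrightarrow> degree (t i) > 0"
    and degree_\<theta>: "degree \<theta> > 0"
    and L_t: "i \<in> src.I \<Longrightarrow> pcompose (tgt.L (J i)) (map_poly to_fract (t i)) = pcompose \<theta> (src.L i)"
begin

definition pt :: "'v \<Rightarrow> 'a poly set \<Rightarrow> 'a poly set"
  where "pt i P = {p. pcompose p (t i) \<in> P}"

text \<open>On points, the images of all representatives of a class are collected before closing up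
  under \<open>tgt.R\<close>, so that no representative has to be chosen; by \<open>R_pt\<close>
  they all lie in one class.\<close>

definition induced_map where "induced_map =
  \<lparr>on_points = (\<lambda>c. tgt.R `` ((\<lambda>(i, P). (J i, pt i P)) ` c)),
   on_sections = (\<lambda>V s. \<lambda>i\<in>src.I. \<lambda>P\<in>{P \<in> primes UNIV. pt i P \<in> tgt.ch (J i) V}.
     fract_map (\<lambda>p. pcompose p (t i)) (s (J i) (pt i P)))\<rparr>"

lemma domain_embedding_t: "i \<in> src.I \<Longrightarrow> domain_embedding (\<lambda>p. pcompose p (t i))"
  by (rule domain_embedding_pcompose[OF degree_t])

lemma pt_prime: "i \<in> src.I \<Longrightarrow> P \<in> primes UNIV \<Longrightarrow> pt i P \<in> primes UNIV"
  unfolding pt_def by (rule domain_embedding.primes_vimage[OF domain_embedding_t])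

lemma x_in_pt_iff: "[:c:] \<in> pt i P \<longleftrightarrow> [:c:] \<in> P"
  by (simp add: pt_def)

text \<open>Solving \<open>L_t\<close> for \<theta> by means of \<open>src.K\<close> exhibits it as
  a composite of polynomials over the localization.\<close>

lemma \<theta>_in_polys: "i \<in> src.I \<Longrightarrow> \<theta> \<in> polys_over_localization x"
proof -
  assume i: "i \<in> src.I"
  have "\<theta> = pcompose (pcompose (tgt.L (J i)) (map_poly to_fract (t i))) (src.K i)"
    unfolding L_t[OF i] by (rule src.pcompose_cancel[symmetric])
  then show ?thesis
    using src.pcompose_in_polys tgt.L_in_polys src.fract_poly_in_polys src.K_in_polys by metis
qed

text \<open>The chart enters the right-hand side only through \<open>src.common\<close>; this is why
  glued points are sent to glued points.\<close>

lemma common_pt: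
  assumes i: "i \<in> src.I" and P: "P \<in> primes UNIV" "[:x:] \<notin> P"
  shows "tgt.common (J i) (pt i P) = {q \<in> polys_over_localization x. pcompose q \<theta> \<in> src.common i P}"
proof -
  have P': "pt i P \<in> primes UNIV" "[:x:] \<notin> pt i P"
    using pt_prime[OF i P(1)] P(2) by (simp_all add: x_in_pt_iff)
  have "pcompose q (tgt.L (J i)) \<in> src.loc (pt i P) \<longleftrightarrow> pcompose (pcompose q \<theta>) (src.L i) \<in> src.loc P"
    if q: "q \<in> polys_over_localization x" for q
  proof -
    let ?r = "pcompose q (tgt.L (J i))"
    have "?r \<in> polys_over_localization x" by (rule src.pcompose_in_polys[OF q tgt.L_in_polys])
    then obtain n p where np: "smult (src.y ^ n) ?r = map_poly to_fract p"
      using src.polys_iff by blast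
    have "smult (src.y ^ n) (pcompose ?r (map_poly to_fract (t i))) = map_poly to_fract (pcompose p (t i))"
      using np by (simp add: map_poly_pcompose flip: pcompose_smult)
    then have "pcompose ?r (map_poly to_fract (t i)) \<in> src.loc P \<longleftrightarrow> pcompose p (t i) \<in> P"
      by (rule src.in_loc_iff[OF P])
    moreover have "?r \<in> src.loc (pt i P) \<longleftrightarrow> p \<in> pt i P" by (rule src.in_loc_iff[OF P' np])
    moreover have "pcompose ?r (map_poly to_fract (t i)) = pcompose (pcompose q \<theta>) (src.L i)"
      by (simp add: L_t[OF i] flip: pcompose_assoc)
    ultimately show ?thesis by (simp add: pt_def)
  qed
  then show ?thesis
    using src.pcompose_in_polys[OF _ \<theta>_in_polys[OF i]]
    unfolding tgt.common_def src.common_def by blast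
qed

lemma R_pt:
  assumes "((i, P), (j, Q)) \<in> src.R"
  shows "((J i, pt i P), (J j, pt j Q)) \<in> tgt.R"
  using assms common_pt[of i P] common_pt[of j Q]
  by (auto simp: src.R_iff tgt.R_iff J pt_prime x_in_pt_iff)

lemma induced_map_cls:
  assumes "i \<in> src.I" "P \<in> primes UNIV"
  shows "on_points induced_map (src.cls i P) = tgt.cls (J i) (pt i P)"
proof -
  have "tgt.R `` {(J j, pt j Q)} = tgt.cls (J i) (pt i P)" if "(j, Q) \<in> src.cls i P" for j Q
    using equiv_class_eq[OF tgt.equiv_R R_pt[of i P j Q]] that
    by (simp add: src.cls_def tgt.cls_def)
  then have "on_points induced_map (src.cls i P) = (\<Union>c \<in> src.cls i P. tgt.cls (J i) (pt i P))"
    unfolding induced_map_def by fastforce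
  then show ?thesis using src.in_cls_self[OF assms] by auto
qed

lemma ch_preim:
  assumes "i \<in> src.I"
  shows "src.ch i (preim src.S induced_map V) = {P \<in> primes UNIV. pt i P \<in> tgt.ch (J i) V}"
  using assms unfolding src.ch_def tgt.ch_def preim_def src.points_S
  by (auto simp: induced_map_cls pt_prime)

text \<open>The counterpart of \<open>common_pt\<close> for functions: in the common coordinates all
  the chart maps become the single substitution of \<theta>, so compatible families stay
  compatible.\<close>

lemma H_induced:
  assumes i: "i \<in> src.I"
  shows "src.H i (fract_map (\<lambda>p. pcompose p (t i)) z) = fract_map (\<lambda>q. pcompose q \<theta>) (tgt.H (J i) z)"
proof -
  have "pcompose (tgt.K (J i)) \<theta> = pcompose (tgt.K (J i)) (pcompose (pcompose \<theta> (src.L i)) (src.K i))"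
    by (simp add: src.pcompose_cancel)
  also have "\<dots> = pcompose (map_poly to_fract (t i)) (src.K i)"
    unfolding L_t[OF i, symmetric] pcompose_assoc tgt.K_L by (simp add: pcompose_pCons)
  finally have "pcompose (map_poly to_fract (t i)) (src.K i) = pcompose (tgt.K (J i)) \<theta>" ..
  then show ?thesis
    unfolding src.H_def tgt.H_def
    by (simp add: fract_map_compose domain_embedding_t[OF i] src.domain_embedding_K
        tgt.domain_embedding_K domain_embedding_pcompose[OF degree_\<theta>] map_poly_pcompose
        flip: pcompose_assoc)
qed

lemma induced_section_carrier:
  assumes V: "openin (space_top tgt.S) V" and s: "s \<in> carrier (sections tgt.S V)"
  shows "on_sections induced_map V s \<in> carrier (sections src.S (preim src.S induced_map V))"
  unfolding src.carrier_sections
proof (intro conjI ballI allI impI)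
  show "on_sections induced_map V s \<in> extensional src.I" by (simp add: induced_map_def)
  fix i assume i: "i \<in> src.I"
  have "s (J i) \<in> regular_functions UNIV (tgt.ch (J i) V)" "zariski_open UNIV (tgt.ch (J i) V)"
    using s V J[OF i] by (simp_all add: tgt.carrier_sections tgt.ch_open)
  from domain_embedding.regular_function_pullback[OF domain_embedding_t[OF i] this]
  show "on_sections induced_map V s i \<in> regular_functions UNIV (src.ch i (preim src.S induced_map V))"
    using i unfolding ch_preim[OF i] by (simp add: induced_map_def pt_def)
next
  fix i j P Q assume rel: "((i, P), (j, Q)) \<in> src.R" and P: "P \<in> src.ch i (preim src.S induced_map V)"
  have i: "i \<in> src.I" "j \<in> src.I" "P \<in> primes UNIV" "Q \<in> primes UNIV"
    using rel by (auto simp: src.R_iff)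
  have P': "pt i P \<in> tgt.ch (J i) V" using P unfolding ch_preim[OF i(1)] by blast
  have "src.cls i P = src.cls j Q" using rel src.cls_eq_iff i by blast
  then have "Q \<in> src.ch j (preim src.S induced_map V)" using P i by (simp add: src.ch_def)
  then have Q': "pt j Q \<in> tgt.ch (J j) V" unfolding ch_preim[OF i(2)] by blast
  have "tgt.H (J i) (s (J i) (pt i P)) = tgt.H (J j) (s (J j) (pt j Q))"
    using s R_pt[OF rel] P' unfolding tgt.carrier_sections by blast
  then show "src.H i (on_sections induced_map V s i P) = src.H j (on_sections induced_map V s j Q)"
    using i P' Q' by (simp add: induced_map_def H_induced)
qed

lemma ringed_space_map_induced: "ringed_space_map src.S tgt.S induced_map"
  unfolding ringed_space_map_def
proof (intro conjI allI impI ballI)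
  show "continuous_map (space_top src.S) (space_top tgt.S) (on_points induced_map)"
    unfolding continuous_map_def
  proof (intro conjI allI impI funcsetI)
    show "on_points induced_map c \<in> points tgt.S" if "c \<in> points src.S" for c
    proof -
      from that obtain i P where "i \<in> src.I" "P \<in> primes UNIV" "c = src.cls i P"
        unfolding src.points_S by blast
      then show ?thesis using induced_map_cls J pt_prime unfolding tgt.points_S by blast
    qed
    fix U assume U: "openin (space_top tgt.S) U"
    have "zariski_open UNIV (src.ch i (preim src.S induced_map U))" if i: "i \<in> src.I" for i
      unfolding ch_preim[OF i] pt_def
      by (rule domain_embedding.zariski_open_preimage[OF domain_embedding_t[OF i] tgt.ch_open[OF U J[OF i]]])
    then have "openin (space_top src.S) (preim src.S induced_map U)"
      unfolding src.openin_S by (auto simp: preim_def src.points_S)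
    then show "openin (space_top src.S) {c \<in> points src.S. on_points induced_map c \<in> U}"
      by (simp add: preim_def)
  qed
next
  fix V assume V: "openin (space_top tgt.S) V"
  have hom: "fract_map (\<lambda>p. pcompose p (t i)) (z * w) =
      fract_map (\<lambda>p. pcompose p (t i)) z * fract_map (\<lambda>p. pcompose p (t i)) w"
    "fract_map (\<lambda>p. pcompose p (t i)) (z + w) =
      fract_map (\<lambda>p. pcompose p (t i)) z + fract_map (\<lambda>p. pcompose p (t i)) w"
    "fract_map (\<lambda>p. pcompose p (t i)) 1 = 1" if "i \<in> src.I" for i z w
    using domain_embedding.fract_map_mult domain_embedding.fract_map_add
      domain_embedding.fract_map_one domain_embedding_t[OF that] by blast+
  \<comment> \<open>Only the \<open>on_sections\<close> component of \<open>induced_map_def\<close>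
    is unfolded, so that \<open>ch_preim\<close> still recognises the preimage.\<close>
  show "on_sections induced_map V \<in> ring_hom (sections tgt.S V) (sections src.S (preim src.S induced_map V))"
    by (rule ring_hom_memI, rule induced_section_carrier[OF V])
      (auto simp: src.sections_ops tgt.sections_ops
        induced_map_def[THEN arg_cong[of _ _ on_sections]] ch_preim J hom intro!: restrict_ext)
next
  fix V W s assume "openin (space_top tgt.S) V \<and> openin (space_top tgt.S) W \<and> W \<subseteq> V"
  then show "on_sections induced_map W (restr tgt.S V W s) =
      restr src.S (preim src.S induced_map V) (preim src.S induced_map W) (on_sections induced_map V s)"
    by (auto simp: src.sections_ops tgt.sections_ops ch_preim J tgt.ch_def
        induced_map_def[THEN arg_cong[of _ _ on_sections]] restrict_def fun_eq_iff)
qed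

text \<open>Constant polynomials are fixed by every substitution, so the chart maps leave the image
  of \<open>A\<close> alone.\<close>

lemma induced_map_over_base:
  "same_map src.S (Spec UNIV) (comp_map tgt.S (surface_projection \<gamma>') induced_map) (surface_projection \<gamma>)"
  unfolding same_map_def
proof (intro conjI ballI allI impI)
  fix c assume "c \<in> points src.S"
  then obtain i P where "i \<in> src.I" "P \<in> primes UNIV" "c = src.cls i P"
    unfolding src.points_S by blast
  then show "on_points (comp_map tgt.S (surface_projection \<gamma>') induced_map) c =
      on_points (surface_projection \<gamma>) c"
    by (simp add: comp_map_def induced_map_cls src.projection_points tgt.projection_points J
        pt_prime x_in_pt_iff)
next
  fix V s assume V: "openin (space_top (Spec (UNIV :: 'a set))) V"
    and s: "s \<in> carrier (sections (Spec (UNIV :: 'a set)) V)"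
  interpret const: domain_embedding "\<lambda>a::'a. [:a:]" by (rule domain_embedding_const_poly)
  have loc: "localized_hom UNIV (\<lambda>a. [:a:]) P (s {a. [:a:] \<in> P}) = fract_map (\<lambda>a. [:a:]) (s {a. [:a:] \<in> P})"
    if P: "P \<in> primes UNIV" "{a. [:a:] \<in> P} \<in> V" for P
  proof -
    have "s \<in> regular_functions UNIV V" using s by (simp add: Spec_def)
    then obtain a b where "b \<notin> {a. [:a:] \<in> P}" "s {a. [:a:] \<in> P} = Fract a b"
      using regular_function_stalk P(2) by metis
    then show ?thesis using const.localized_hom_eq_fract_map zero_in_prime[OF P(1)] by blast
  qed
  have ch: "tgt.ch j (preim tgt.S (surface_projection \<gamma>') V) =
      {P \<in> primes UNIV. {a. [:a:] \<in> P} \<in> V}" if "j \<in> tgt.I" for j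
    using that unfolding tgt.ch_def preim_def tgt.points_S
    by (auto simp: tgt.projection_points)
  have "(\<lambda>P\<in>{P \<in> primes UNIV. pt i P \<in> tgt.ch (J i) (preim tgt.S (surface_projection \<gamma>') V)}.
      fract_map (\<lambda>p. pcompose p (t i)) (on_sections (surface_projection \<gamma>') V s (J i) (pt i P))) =
    (\<lambda>P\<in>{P \<in> primes UNIV. {a. [:a:] \<in> P} \<in> V}. localized_hom UNIV (\<lambda>a. [:a:]) P (s {a. [:a:] \<in> P}))"
    (is "restrict ?f ?A = restrict ?g ?B") if i: "i \<in> src.I" for i
  proof -
    have "?A = ?B" using i by (auto simp: ch J pt_prime x_in_pt_iff)
    moreover have "?f P = ?g P" if P: "P \<in> ?B" for P
    proof -
      have *: "{a. [:a:] \<in> pt i P} = {a. [:a:] \<in> P}" by (simp add: x_in_pt_iff)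
      have "?f P = fract_map (\<lambda>p. pcompose p (t i)) (fract_map (\<lambda>a. [:a:]) (s {a. [:a:] \<in> P}))"
        using i P loc[of "pt i P"] unfolding * by (simp add: tgt.projection_sections J pt_prime *)
      also have "\<dots> = ?g P"
        using P by (simp add: fract_map_compose const.domain_embedding_axioms domain_embedding_t i loc)
      finally show ?thesis .
    qed
    ultimately show ?thesis by (simp cong: restrict_cong)
  qed
  then show "on_sections (comp_map tgt.S (surface_projection \<gamma>') induced_map) V s =
      on_sections (surface_projection \<gamma>) V s"
    unfolding comp_map_def src.projection_sections
    by (auto simp: induced_map_def[THEN arg_cong[of _ _ on_sections]] intro!: restrict_ext)
qed

end

lemma induced_map_inverse:
  assumes f: "chart_map x \<gamma> \<gamma>' J t \<theta>" and g: "chart_map x \<gamma>' \<gamma> J' t' \<theta>'"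
    and J': "\<And>i. i \<in> leaves (fst \<gamma>) \<Longrightarrow> J' (J i) = i"
    and t': "\<And>i. i \<in> leaves (fst \<gamma>) \<Longrightarrow> pcompose (t' (J i)) (t i) = [:0, 1:]"
  shows "same_map (surface x \<gamma>) (surface x \<gamma>)
    (comp_map (surface x \<gamma>') (chart_map.induced_map x \<gamma>' \<gamma> J' t')
      (chart_map.induced_map x \<gamma> \<gamma>' J t)) id_map"
proof -
  interpret f: chart_map x \<gamma> \<gamma>' J t \<theta> by fact
  interpret g: chart_map x \<gamma>' \<gamma> J' t' \<theta>' by fact
  have pt: "g.pt (J i) (f.pt i P) = P" if "i \<in> f.src.I" for i P
    using t'[OF that] by (simp add: g.pt_def f.pt_def flip: pcompose_assoc)
  show ?thesis
    unfolding same_map_def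
  proof (intro conjI ballI allI impI)
    fix c assume "c \<in> points f.src.S"
    then obtain i P where "i \<in> f.src.I" "P \<in> primes UNIV" "c = f.src.cls i P"
      unfolding f.src.points_S by blast
    then show "on_points (comp_map (surface x \<gamma>') g.induced_map f.induced_map) c = on_points id_map c"
      by (simp add: comp_map_def id_map_def f.induced_map_cls g.induced_map_cls f.J f.pt_prime pt J')
  next
    fix V s assume V: "openin (space_top f.src.S) V" and s: "s \<in> carrier (sections f.src.S V)"
    have sP: "s \<in> extensional f.src.I" "\<And>i. i \<in> f.src.I \<Longrightarrow> s i \<in> extensional (f.src.ch i V)"
      using s by (auto simp: f.src.carrier_sections regular_functions_def)
    let ?s = "on_sections f.induced_map (preim f.tgt.S g.induced_map V) (on_sections g.induced_map V s)"
    have "?s i = s i" if i: "i \<in> f.src.I" for i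
    proof (rule extensionalityI)
      have dom: "{P \<in> primes UNIV. f.pt i P \<in> f.tgt.ch (J i) (preim f.tgt.S g.induced_map V)} = f.src.ch i V"
        unfolding g.ch_preim[OF f.J[OF i]] using i pt f.pt_prime by (auto simp: J' f.src.ch_def)
      show "?s i \<in> extensional (f.src.ch i V)"
        using i by (simp add: f.induced_map_def dom)
      show "?s i P = s i P" if P: "P \<in> f.src.ch i V" for P
      proof -
        have "P \<in> primes UNIV" using P by (simp add: f.src.ch_def)
        moreover have "f.pt i P \<in> f.tgt.ch (J i) (preim f.tgt.S g.induced_map V)"
          using P dom by blast
        ultimately show ?thesis
          using i P f.J[OF i] f.pt_prime[OF i]
          by (simp add: f.induced_map_def g.induced_map_def pt J' fract_map_compose
              g.domain_embedding_t f.domain_embedding_t t' fract_map_ident flip: pcompose_assoc)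
      qed
    qed (rule sP(2)[OF i])
    then have "?s = s"
      using sP(1) by (intro extensionalityI[of _ f.src.I]) (auto simp: f.induced_map_def)
    then show "on_sections (comp_map (surface x \<gamma>') g.induced_map f.induced_map) V s = on_sections id_map V s"
      by (simp add: comp_map_def id_map_def)
  qed
qed

lemma X_isomorphic_if_chart_maps:
  assumes f: "chart_map x \<gamma> \<gamma>' J t \<theta>" and g: "chart_map x \<gamma>' \<gamma> J' t' \<theta>'"
    and "\<And>i. i \<in> leaves (fst \<gamma>) \<Longrightarrow> J' (J i) = i"
    and "\<And>i. i \<in> leaves (fst \<gamma>) \<Longrightarrow> pcompose (t' (J i)) (t i) = [:0, 1:]"
    and "\<And>i. i \<in> leaves (fst \<gamma>') \<Longrightarrow> J (J' i) = i"
    and "\<And>i. i \<in> leaves (fst \<gamma>') \<Longrightarrow> pcompose (t (J' i)) (t' i) = [:0, 1:]"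
  shows "X_isomorphic_surfaces x \<gamma> \<gamma>'"
proof -
  interpret f: chart_map x \<gamma> \<gamma>' J t \<theta> by fact
  interpret g: chart_map x \<gamma>' \<gamma> J' t' \<theta>' by fact
  note gf = induced_map_inverse[OF f g assms(3,4)] and fg = induced_map_inverse[OF g f assms(5,6)]
  have "lrs_morphism f.src.S f.tgt.S f.induced_map" "lrs_morphism f.tgt.S f.src.S g.induced_map"
    using lrs_morphism_if_inverse f.ringed_space_map_induced g.ringed_space_map_induced gf fg by blast+
  then show ?thesis
    unfolding X_isomorphic_surfaces_def isomorphic_over_def
    using f.induced_map_over_base g.induced_map_over_base gf fg by blast
qed

section \<open>Affine coordinate changes from isomorphisms\<close>

text \<open>Serves to remove a denominator \<open>b\<close> that is invertible at the generic point
  of a fibre component.\<close>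

lemma prime_elem_power_dvd_mult:
  fixes p :: "'r::idom"
  assumes "prime_elem p" "p ^ n dvd b * c" "\<not> p dvd b"
  shows "p ^ n dvd c"
  using assms(2)
proof (induction n arbitrary: c)
  case (Suc n)
  then have "p dvd b * c" by (metis dvd_mult_left power_Suc)
  then obtain c' where c': "c = p * c'"
    using assms prime_elem_dvd_mult_iff by (metis dvdE)
  moreover have "b * (p * c') = p * (b * c')" by (rule mult.left_commute)
  ultimately have "p * p ^ n dvd p * (b * c')" using Suc.prems by simp
  then have "p ^ n dvd b * c'"
    using assms(1) by (simp only: dvd_mult_cancel_left prime_elem_def) simp
  then have "p ^ n dvd c'" by (rule Suc.IH)
  then show ?case unfolding c' power_Suc by (rule mult_dvd_mono[OF dvd_refl])
qed simp

lemma linear_poly_coeffs: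
  assumes "degree p = 1"
  shows "p = [:coeff p 0, coeff p 1:]"
proof (rule poly_eqI)
  fix n
  show "coeff p n = coeff [:coeff p 0, coeff p 1:] n"
    using assms coeff_eq_0[of p n] by (cases n; cases "n - 1") (auto simp: coeff_pCons)
qed

section \<open>Global functions on the surface and coordinates of the charts\<close>

context surface_charts
begin

text \<open>By \<open>carrier_gsec\<close> all global sections arise in this way, with
  \<open>agrees\<close> as gluing condition.\<close>

definition gsec :: "('v \<Rightarrow> 'a poly) \<Rightarrow> 'v \<Rightarrow> 'a poly set \<Rightarrow> 'a poly fract"
  where "gsec q = (\<lambda>i\<in>I. \<lambda>P\<in>primes UNIV. to_fract (q i))"

definition agrees :: "('v \<Rightarrow> 'a poly) \<Rightarrow> bool"
  where "agrees q \<longleftrightarrow> (\<forall>i\<in>I. \<forall>j\<in>I. pcompose (\<iota> (q i)) (K i) = pcompose (\<iota> (q j)) (K j))"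

definition u :: "'v \<Rightarrow> 'a poly"
  where "u i = [:\<sigma> i, x ^ m i:]"

lemma fract_poly_u: "\<iota> (u i) = L i"
  by (simp add: u_def L_def map_poly_pCons y_def to_fract_power)

lemma openin_points: "openin (space_top S) (points S)"
  by simp

lemma H_to_fract: "H i (to_fract p) = to_fract (pcompose (\<iota> p) (K i))"
  unfolding H_def by (rule domain_embedding.fract_map_to_fract[OF domain_embedding_K])

lemma gsec_carrier:
  assumes "agrees q"
  shows "gsec q \<in> carrier (sections S (points S))"
  unfolding carrier_sections
proof (intro conjI ballI allI impI)
  fix i assume i: "i \<in> I"
  have "\<exists>a b. b \<notin> P \<and> to_fract (q i) = Fract a b" if "P \<in> primes UNIV" for P
    using one_notin_prime[OF that] by (auto simp: to_fract_def)
  then have "(\<lambda>P\<in>primes UNIV. to_fract (q i)) \<in> regular_functions UNIV (primes UNIV)"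
    by (intro regular_function_const zariski_open_primes)
  then show "gsec q i \<in> regular_functions UNIV (ch i (points S))"
    using i by (simp add: gsec_def ch_points)
next
  fix i j P Q assume "((i, P), (j, Q)) \<in> R"
  then show "H i (gsec q i P) = H j (gsec q j Q)"
    using assms by (auto simp: R_iff gsec_def H_to_fract agrees_def)
qed (simp add: gsec_def)

text \<open>All charts share the generic point of the surface; there the gluing condition of a
  section becomes an identity between fractions in \<open>u\<close>.\<close>

lemma generic_points_related:
  assumes "i \<in> I" "j \<in> I"
  shows "((i, {0}), (j, {0})) \<in> R"
proof -
  have "loc {0} = {0}" by (auto simp: loc_def)
  then have "common k {0} = {0} \<inter> \<B>" for k
    using pcompose_eq_0[OF _ degree_L[of k]] by (auto simp: common_def)
  then show ?thesis using assms x_nonzero by (simp add: R_iff zero_ideal_prime)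
qed

text \<open>On each chart the section is one fraction that lies in every localization of
  \<open>A[T]\<close>, hence a polynomial; the gluing condition at the generic point gives
  \<open>agrees\<close>.\<close>

lemma carrier_gsec:
  assumes s: "s \<in> carrier (sections S (points S))"
  shows "\<exists>q. s = gsec q \<and> agrees q"
proof -
  have reg: "s i \<in> regular_functions UNIV (primes UNIV)" if "i \<in> I" for i
    using s that by (simp add: carrier_sections ch_points)
  have "\<exists>a. s i {0} = to_fract a" if i: "i \<in> I" for i
  proof (rule to_fract_of_all_localizations)
    fix P :: "'a poly set" assume P: "P \<in> primes UNIV"
    obtain a b where "b \<notin> P" "s i P = Fract a b"
      using regular_function_stalk[OF reg[OF i] P] by blast
    then show "\<exists>a b. b \<notin> P \<and> s i {0} = Fract a b"
      using regular_function_eq_generic(2)[OF reg[OF i] P] by metis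
  qed
  then obtain q where q: "\<And>i. i \<in> I \<Longrightarrow> s i {0} = to_fract (q i)" by metis
  have "s = gsec q"
  proof (rule extensionalityI[of _ I])
    fix i assume i: "i \<in> I"
    show "s i = gsec q i"
    proof (rule extensionalityI[of _ "primes UNIV"])
      show "s i \<in> extensional (primes UNIV)" using reg[OF i] by (simp add: regular_functions_def)
      show "s i P = gsec q i P" if "P \<in> primes UNIV" for P
        using regular_function_eq_generic(2)[OF reg[OF i] that] i that by (simp add: gsec_def q)
    qed (use i in \<open>simp add: gsec_def\<close>)
  qed (use s in \<open>auto simp: carrier_sections gsec_def\<close>)
  moreover have "agrees q"
    unfolding agrees_def
  proof (intro ballI)
    fix i j assume ij: "i \<in> I" "j \<in> I"
    have "{0} \<in> ch i (points S)" using ij zero_ideal_prime by (simp add: ch_points)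
    then have "H i (s i {0}) = H j (s j {0})"
      using s generic_points_related[OF ij] unfolding carrier_sections by blast
    then show "pcompose (\<iota> (q i)) (K i) = pcompose (\<iota> (q j)) (K j)"
      using ij by (simp add: q H_to_fract)
  qed
  ultimately show ?thesis by blast
qed

lemma gsec_eqD: "gsec q = gsec q' \<Longrightarrow> i \<in> I \<Longrightarrow> q i = q' i"
  using zero_ideal_prime by (auto simp: gsec_def fun_eq_iff restrict_def split: if_splits)

lemma gsec_ops:
  "gsec q \<otimes>\<^bsub>sections S (points S)\<^esub> gsec q' = gsec (\<lambda>i. q i * q' i)"
  "gsec q \<oplus>\<^bsub>sections S (points S)\<^esub> gsec q' = gsec (\<lambda>i. q i + q' i)"
  by (auto simp: sections_ops gsec_def ch_points intro!: restrict_ext)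

lemma agrees_pcompose_u: "agrees (\<lambda>i. pcompose p (u i))"
  by (simp add: agrees_def map_poly_pcompose fract_poly_u pcompose_cancel)

lemma agrees_u: "agrees u"
  using agrees_pcompose_u[of "[:0, 1:]"] by (simp add: pcompose_pCons)

lemma agrees_const: "agrees (\<lambda>i. [:a:])"
  by (simp add: agrees_def map_poly_pCons)

lemma restr_carrier:
  assumes s: "s \<in> carrier (sections S V)" and W: "openin (space_top S) W" "W \<subseteq> V"
  shows "restr S V W s \<in> carrier (sections S W)"
  unfolding carrier_sections sections_ops
proof (intro conjI ballI allI impI)
  have sub: "ch i W \<subseteq> ch i V" for i using W(2) by (auto simp: ch_def)
  show "(\<lambda>i\<in>I. restrict (s i) (ch i W)) i \<in> regular_functions UNIV (ch i W)" if i: "i \<in> I" for i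
    using regular_function_restrict[OF _ ch_open[OF W(1) i] sub] s i
    by (simp add: carrier_sections)
  fix i j P Q assume rel: "((i, P), (j, Q)) \<in> R" and P: "P \<in> ch i W"
  have ij: "i \<in> I" "j \<in> I" "P \<in> primes UNIV" "Q \<in> primes UNIV" using rel by (auto simp: R_iff)
  then have "cls i P = cls j Q" using rel cls_eq_iff by blast
  then have "Q \<in> ch j W" using P ij by (simp add: ch_def)
  moreover have "H i (s i P) = H j (s j Q)"
    using s rel P sub unfolding carrier_sections by blast
  ultimately show "H i ((\<lambda>i\<in>I. restrict (s i) (ch i W)) i P) = H j ((\<lambda>i\<in>I. restrict (s i) (ch i W)) j Q)"
    using ij P by simp
qed simp

definition chart :: "'v \<Rightarrow> ('v \<times> 'a poly set) set set"
  where "chart j = {cls j Q |Q. Q \<in> primes UNIV}"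

lemma ch_chart:
  assumes i: "i \<in> I" and j: "j \<in> I"
  shows "ch i (chart j) = {P \<in> primes UNIV. i = j \<or> [:x:] \<notin> P}"
proof -
  have "\<exists>Q \<in> primes UNIV. cls i P = cls j Q" if P: "P \<in> primes UNIV" "[:x:] \<notin> P" and "i \<noteq> j" for P
  proof -
    \<comment> \<open>The overlap of \<open>j\<close> and \<open>i\<close> is the spectrum of
      \<open>A_x[T_i]\<close>; its point \<open>loc P\<close> supplies the representative in the
      chart \<open>j\<close>.\<close>
    have "P = {p. \<iota> p \<in> loc P}" using fract_poly_in_loc_iff[OF P] by blast
    then have "((j, {p. pcompose (\<iota> p) (tr j i) \<in> loc P}), (i, P)) \<in> R"
      unfolding R_iff_overlap using loc_in_primes[OF P] that i j by blast
    then show ?thesis using cls_eq_iff[OF j _ i P(1)] by (metis R_iff)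
  qed
  moreover have "i = j \<or> [:x:] \<notin> P" if "P \<in> primes UNIV" "Q \<in> primes UNIV" "cls i P = cls j Q" for P Q
    using that cls_eq_iff i j by (auto simp: R_iff)
  ultimately show ?thesis unfolding ch_def chart_def by blast
qed

lemma openin_chart:
  assumes j: "j \<in> I"
  shows "openin (space_top S) (chart j)"
proof -
  have "zariski_open UNIV (ch i (chart j))" if i: "i \<in> I" for i
    unfolding ch_chart[OF i j]
    by (cases "i = j") (simp_all add: zariski_open_primes zariski_open_basic)
  then show ?thesis using j unfolding openin_S chart_def by blast
qed

text \<open>The coordinate \<open>T\<^sub>j = (u - \<sigma>\<^sub>j) / x\<^sup>m\<close> of the chart \<open>j\<close>, as a section over this chart.\<close>

definition tsec :: "'v \<Rightarrow> 'v \<Rightarrow> 'a poly set \<Rightarrow> 'a poly fract"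
  where "tsec j = (\<lambda>i\<in>I. \<lambda>P\<in>ch i (chart j). Fract (u i - [:\<sigma> j:]) [:x ^ m j:])"

text \<open>On the chart \<open>j\<close> itself the fraction reduces to a polynomial; the other
  charts meet \<open>chart j\<close> only where the denominator, a power of \<open>x\<close>, is
  invertible. Rewritten in \<open>u\<close>, it is the same fraction on all charts.\<close>

lemma tsec_carrier:
  assumes j: "j \<in> I"
  shows "tsec j \<in> carrier (sections S (chart j))"
  unfolding carrier_sections
proof (intro conjI ballI allI impI)
  have nz: "[:x ^ m j:] \<noteq> 0" using x_nonzero by simp
  show "tsec j i \<in> regular_functions UNIV (ch i (chart j))" if i: "i \<in> I" for i
  proof -
    have "\<exists>a b. b \<notin> P \<and> Fract (u i - [:\<sigma> j:]) [:x ^ m j:] = Fract a b" if P: "P \<in> ch i (chart j)" for P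
    proof (cases "i = j")
      case True
      have "Fract (u i - [:\<sigma> j:]) [:x ^ m j:] = Fract [:0, 1:] 1"
        using nz True by (simp add: eq_fract u_def)
      moreover have "1 \<notin> P" using P one_notin_prime[of P] by (simp add: ch_def)
      ultimately show ?thesis by blast
    next
      case False
      then have P': "P \<in> primes UNIV" "[:x:] \<notin> P" using P unfolding ch_chart[OF i j] by auto
      then have "[:x:] ^ m j \<notin> P" by (simp add: prime_power_iff)
      then show ?thesis by (auto simp: poly_const_pow)
    qed
    then show ?thesis
      using i regular_function_const[OF ch_open[OF openin_chart[OF j] i]] by (simp add: tsec_def)
  qed
  fix i k P Q assume rel: "((i, P), (k, Q)) \<in> R" and P: "P \<in> ch i (chart j)"
  have ik: "i \<in> I" "k \<in> I" "P \<in> primes UNIV" "Q \<in> primes UNIV" using rel by (auto simp: R_iff)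
  then have "cls i P = cls k Q" using rel cls_eq_iff by blast
  then have Q: "Q \<in> ch k (chart j)" using P ik by (simp add: ch_def)
  have "H i (Fract (u i - [:\<sigma> j:]) [:x ^ m j:]) = Fract ([:0, 1:] - [:to_fract (\<sigma> j):]) [:y ^ m j:]" for i
    unfolding H_def domain_embedding.fract_map_Fract[OF domain_embedding_K nz]
    by (simp add: pcompose_diff fract_poly_u L_K map_poly_pCons y_def to_fract_power del: diff_pCons)
  then show "H i (tsec j i P) = H k (tsec j k Q)"
    using ik P Q by (simp add: tsec_def)
qed (simp add: tsec_def)

text \<open>Phrased with the operations of \<open>sections\<close>, so that a pullback homomorphism
  can be applied to it in \<open>comp_to_dvd\<close>.\<close>

lemma restr_u:
  assumes j: "j \<in> I"
  shows "restr S (points S) (chart j) (gsec u) =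
    restr S (points S) (chart j) (gsec (\<lambda>i. [:\<sigma> j:])) \<oplus>\<^bsub>sections S (chart j)\<^esub>
      restr S (points S) (chart j) (gsec (\<lambda>i. [:x ^ m j:])) \<otimes>\<^bsub>sections S (chart j)\<^esub> tsec j"
proof -
  have "to_fract (u i) = to_fract [:\<sigma> j:] + to_fract [:x ^ m j:] * Fract (u i - [:\<sigma> j:]) [:x ^ m j:]" for i
    using x_nonzero by (simp add: Fract_conv_to_fract)
  moreover have "ch i (chart j) \<subseteq> primes UNIV" for i by (auto simp: ch_def)
  ultimately show ?thesis
    by (intro extensionalityI[of _ I] extensionalityI[of _ "ch _ (chart j)"])
      (auto simp: sections_ops gsec_def tsec_def)
qed

lemma preim_projection: "preim S (surface_projection \<gamma>) (primes UNIV) = points S"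
proof -
  have "{a. [:a:] \<in> P} \<in> primes UNIV" if "P \<in> primes UNIV" for P :: "'a poly set"
    using domain_embedding.primes_vimage[OF domain_embedding_const_poly that] .
  then show ?thesis unfolding preim_def points_S by (auto simp: projection_points)
qed

lemma projection_const:
  "on_sections (surface_projection \<gamma>) (primes UNIV) (\<lambda>P\<in>primes UNIV. to_fract a) = gsec (\<lambda>i. [:a:])"
proof -
  interpret const: domain_embedding "\<lambda>a::'a. [:a:]" by (rule domain_embedding_const_poly)
  have loc: "localized_hom UNIV (\<lambda>a. [:a:]) P (to_fract a) = to_fract [:a:]" if P: "P \<in> primes UNIV" for P
    using const.localized_hom_eq_fract_map[of "to_fract a" a 1 P] zero_in_prime[OF P] one_notin_prime[OF P]
    by (simp add: to_fract_def const.fract_map_Fract one_pCons)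
  have vimage: "{a. [:a:] \<in> P} \<in> primes UNIV" if "P \<in> primes UNIV" for P :: "'a poly set"
    using that by (rule const.primes_vimage)
  have "{P \<in> primes UNIV. {a. [:a:] \<in> P} \<in> primes UNIV} = (primes UNIV :: 'a poly set set)"
    using vimage by blast
  moreover have "localized_hom UNIV (\<lambda>a. [:a:]) P ((\<lambda>P\<in>primes UNIV. to_fract a) {a. [:a:] \<in> P}) =
      to_fract [:a:]" if "P \<in> primes UNIV" for P
    using loc[OF that] vimage[OF that] by simp
  ultimately show ?thesis
    unfolding projection_sections gsec_def by (simp cong: restrict_cong)
qed

end

section \<open>The action of a morphism on global functions and on the fibre over x = 0\<close>

locale surface_morphism = src: surface_charts x \<gamma> + tgt: surface_charts x \<gamma>'
  for x :: "'a::idom" and \<gamma> :: "'v rel \<times> ('v \<Rightarrow> 'a)" and \<gamma>' :: "'w rel \<times> ('w \<Rightarrow> 'a)" +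
  fixes f
  assumes prime_x: "prime_elem x"
    and map: "ringed_space_map src.S tgt.S f"
    and over: "same_map src.S (Spec UNIV) (comp_map tgt.S (surface_projection \<gamma>') f) (surface_projection \<gamma>)"
begin

abbreviation pull where "pull \<equiv> on_sections f (points tgt.S)"

lemma preim_points: "preim src.S f (points tgt.S) = points src.S"
  using map unfolding ringed_space_map_def preim_def continuous_map_def by blast

lemma pull_hom: "pull \<in> ring_hom (sections tgt.S (points tgt.S)) (sections src.S (points src.S))"
  using map tgt.openin_points preim_points unfolding ringed_space_map_def by metis

text \<open>The constant comes from the base by \<open>projection_const\<close>, and
  \<open>f\<close> commutes with the projections; thus \<open>pull\<close> is linear over
  \<open>A\<close>.\<close>

lemma pull_const: "pull (tgt.gsec (\<lambda>_. [:a:])) = src.gsec (\<lambda>_. [:a:])"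
proof -
  let ?t = "\<lambda>P\<in>primes (UNIV :: 'a set). to_fract a"
  have "\<exists>b c. c \<notin> P \<and> to_fract a = Fract b c" if "P \<in> primes UNIV" for P
    using one_notin_prime[OF that] by (auto simp: to_fract_def)
  then have "?t \<in> regular_functions UNIV (primes UNIV)"
    by (intro regular_function_const zariski_open_primes)
  then have "?t \<in> carrier (sections (Spec UNIV) (primes UNIV))" by (simp add: Spec_def)
  moreover have "openin (space_top (Spec (UNIV :: 'a set))) (primes UNIV)"
    by (simp add: Spec_def openin_zariski zariski_open_primes)
  ultimately have "on_sections (comp_map tgt.S (surface_projection \<gamma>') f) (primes UNIV) ?t =
      on_sections (surface_projection \<gamma>) (primes UNIV) ?t"
    using over unfolding same_map_def by blast
  then show ?thesis
    by (simp add: comp_map_def tgt.preim_projection tgt.projection_const src.projection_const)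
qed

lemma pull_gsec:
  assumes "tgt.agrees q"
  obtains p where "pull (tgt.gsec q) = src.gsec p" "src.agrees p"
  using src.carrier_gsec[OF ring_hom_closed[OF pull_hom tgt.gsec_carrier[OF assms]]] by blast

text \<open>An \<open>A\<close>-algebra homomorphism is determined on polynomials in
  \<open>u'\<close> by the image of \<open>u'\<close>; the induction is Horner's scheme.\<close>

lemma pull_pcompose:
  assumes q: "pull (tgt.gsec tgt.u) = src.gsec q"
  shows "pull (tgt.gsec (\<lambda>l. pcompose p (tgt.u l))) = src.gsec (\<lambda>i. pcompose p (q i))"
proof (induction p)
  case 0
  show ?case using pull_const[of 0] by simp
next
  case (pCons a p)
  let ?T = "sections tgt.S (points tgt.S)" and ?S = "sections src.S (points src.S)"
  note carr = tgt.gsec_carrier[OF tgt.agrees_u] tgt.gsec_carrier[OF tgt.agrees_pcompose_u[of p]]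
    tgt.gsec_carrier[OF tgt.agrees_const[of a]]
  \<comment> \<open>The product is again a polynomial in \<open>u'\<close>; this puts it into the
    carrier without first making \<open>?T\<close> a ring.\<close>
  have uv: "tgt.gsec tgt.u \<otimes>\<^bsub>?T\<^esub> tgt.gsec (\<lambda>l. pcompose p (tgt.u l)) \<in> carrier ?T"
    unfolding tgt.gsec_ops
    using tgt.gsec_carrier[OF tgt.agrees_pcompose_u[of "pCons 0 p"]] by (simp add: pcompose_pCons)
  have "tgt.gsec (\<lambda>l. pcompose (pCons a p) (tgt.u l)) = tgt.gsec (\<lambda>l. [:a:]) \<oplus>\<^bsub>?T\<^esub>
      (tgt.gsec tgt.u \<otimes>\<^bsub>?T\<^esub> tgt.gsec (\<lambda>l. pcompose p (tgt.u l)))"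
    by (simp add: tgt.gsec_ops pcompose_pCons)
  then have "pull (tgt.gsec (\<lambda>l. pcompose (pCons a p) (tgt.u l))) = src.gsec (\<lambda>l. [:a:]) \<oplus>\<^bsub>?S\<^esub>
      (src.gsec q \<otimes>\<^bsub>?S\<^esub> src.gsec (\<lambda>i. pcompose p (q i)))"
    using ring_hom_add[OF pull_hom carr(3) uv] ring_hom_mult[OF pull_hom carr(1,2)]
      q pCons.IH pull_const by simp
  then show ?case by (simp add: src.gsec_ops pcompose_pCons)
qed

text \<open>The generic point of the line \<open>x = 0\<close>; the same ideal serves in every
  chart.\<close>

definition \<eta> :: "'a poly set" where "\<eta> = {p. [:x:] dvd p}"

lemma \<eta>_prime: "\<eta> \<in> primes UNIV"
  unfolding \<eta>_def by (intro principal_ideal_prime) (simp add: prime_elem_const_poly_iff prime_x)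

lemma \<eta>_subset: "P \<in> primes UNIV \<Longrightarrow> [:x:] \<in> P \<Longrightarrow> \<eta> \<subseteq> P"
  unfolding \<eta>_def using prime_mult_iff by (blast elim!: dvdE)

text \<open>The generic point of the \<open>i\<close>-th component of the fibre over \<open>x = 0\<close> is mapped into
  the \<open>j\<close>-th component.\<close>

definition comp_to :: "'v \<Rightarrow> 'w \<Rightarrow> bool"
  where "comp_to i j \<longleftrightarrow> i \<in> src.I \<and> j \<in> tgt.I \<and>
    (\<exists>Q \<in> primes UNIV. [:x:] \<in> Q \<and> on_points f (src.cls i \<eta>) = tgt.cls j Q)"

lemma over_points:
  assumes "i \<in> src.I" "P \<in> primes UNIV" "j \<in> tgt.I" "Q \<in> primes UNIV"
    and "on_points f (src.cls i P) = tgt.cls j Q"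
  shows "[:a:] \<in> Q \<longleftrightarrow> [:a:] \<in> P"
proof -
  have "src.cls i P \<in> points src.S" using assms unfolding src.points_S by blast
  then have "on_points (surface_projection \<gamma>') (tgt.cls j Q) = on_points (surface_projection \<gamma>) (src.cls i P)"
    using over bspec[of "points src.S" _ "src.cls i P"] assms(5)
    unfolding same_map_def comp_map_def by fastforce
  then show ?thesis using assms by (auto simp: tgt.projection_points src.projection_points)
qed

lemma on_points_cls:
  assumes "i \<in> src.I" "P \<in> primes UNIV"
  obtains j Q where "j \<in> tgt.I" "Q \<in> primes UNIV" "on_points f (src.cls i P) = tgt.cls j Q"
proof -
  have "src.cls i P \<in> points src.S" using assms unfolding src.points_S by blast
  then have "on_points f (src.cls i P) \<in> points tgt.S"
    using map unfolding ringed_space_map_def continuous_map_def by blast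
  then show thesis using that unfolding tgt.points_S by blast
qed

text \<open>A morphism over the base keeps points in the fibre over \<open>x = 0\<close>.\<close>

lemma ex_comp_to:
  assumes i: "i \<in> src.I"
  obtains j where "comp_to i j"
proof -
  obtain j Q where jQ: "j \<in> tgt.I" "Q \<in> primes UNIV" "on_points f (src.cls i \<eta>) = tgt.cls j Q"
    using on_points_cls[OF i \<eta>_prime] by blast
  moreover have "[:x:] \<in> Q" using over_points[OF i \<eta>_prime jQ] by (simp add: \<eta>_def)
  ultimately show thesis using that i unfolding comp_to_def by blast
qed

text \<open>A point whose prime contains \<open>x\<close> is glued to no point of another chart, so
  its chart is determined.\<close>

lemma comp_to_unique: "comp_to i j \<Longrightarrow> comp_to i k \<Longrightarrow> j = k"
  using tgt.cls_eq_iff by (auto simp: comp_to_def tgt.R_iff)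

text \<open>On the chart \<open>j\<close> the function \<open>u - \<sigma>\<^sub>j\<close> is divisible by \<open>x\<^sup>m\<close>, hence so is its
  pullback near the generic point of the component \<open>i\<close>.\<close>

lemma comp_to_dvd:
  assumes ij: "comp_to i j" and q: "pull (tgt.gsec tgt.u) = src.gsec q"
  shows "[:x ^ tgt.m j:] dvd q i - [:tgt.\<sigma> j:]"
proof -
  from ij obtain Q where i: "i \<in> src.I" and j: "j \<in> tgt.I" and Q: "Q \<in> primes UNIV"
    "on_points f (src.cls i \<eta>) = tgt.cls j Q" by (auto simp: comp_to_def)
  let ?U = "tgt.chart j" and ?P = "points tgt.S"
  let ?V = "preim src.S f ?U"
  have U: "openin (space_top tgt.S) ?U" "?U \<subseteq> ?P"
    using tgt.openin_chart[OF j] openin_subset by blast+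
  have hom: "on_sections f ?U \<in> ring_hom (sections tgt.S ?U) (sections src.S ?V)"
    using map U unfolding ringed_space_map_def by blast
  have nat: "on_sections f ?U (restr tgt.S ?P ?U s) = restr src.S (points src.S) ?V (pull s)"
    if "s \<in> carrier (sections tgt.S ?P)" for s
    using map U tgt.openin_points that unfolding ringed_space_map_def by (metis preim_points)
  have carr: "tgt.gsec tgt.u \<in> carrier (sections tgt.S ?P)"
    "tgt.gsec (\<lambda>_. [:a:]) \<in> carrier (sections tgt.S ?P)" for a
    by (simp_all add: tgt.gsec_carrier tgt.agrees_u tgt.agrees_const)
  have rcarr: "restr tgt.S ?P ?U s \<in> carrier (sections tgt.S ?U)" if "s \<in> carrier (sections tgt.S ?P)" for s
    using tgt.restr_carrier[OF that U] .
  define g where "g = on_sections f ?U (tgt.tsec j)"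
  have g: "g \<in> carrier (sections src.S ?V)"
    unfolding g_def by (rule ring_hom_closed[OF hom tgt.tsec_carrier[OF j]])
  \<comment> \<open>The product is the restriction of the global function
    \<open>u' - \<sigma>'\<close>, which shows that it is a section.\<close>
  have prod: "restr tgt.S ?P ?U (tgt.gsec (\<lambda>i. [:x ^ tgt.m j:])) \<otimes>\<^bsub>sections tgt.S ?U\<^esub> tgt.tsec j
      \<in> carrier (sections tgt.S ?U)"
  proof -
    have "restr tgt.S ?P ?U (tgt.gsec (\<lambda>i. [:x ^ tgt.m j:])) \<otimes>\<^bsub>sections tgt.S ?U\<^esub> tgt.tsec j =
        restr tgt.S ?P ?U (tgt.gsec (\<lambda>i. tgt.u i - [:tgt.\<sigma> j:]))"
      using src.x_nonzero
      by (auto simp: tgt.sections_ops tgt.gsec_def tgt.tsec_def tgt.ch_def Fract_conv_to_fract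
          simp del: to_fract_diff intro!: restrict_ext)
    moreover have "tgt.agrees (\<lambda>i. tgt.u i - [:tgt.\<sigma> j:])"
    proof -
      have "pcompose [:- tgt.\<sigma> j, 1:] p = - [:tgt.\<sigma> j:] + p" for p by (simp add: pcompose_pCons)
      then show ?thesis
        using tgt.agrees_pcompose_u[of "[:- tgt.\<sigma> j, 1:]"] by (simp only: uminus_add_conv_diff)
    qed
    ultimately show ?thesis using rcarr[OF tgt.gsec_carrier] by simp
  qed
  \<comment> \<open>This is \<open>restr_u\<close> pulled back along \<open>f\<close>, with
    \<open>g\<close> the pullback of the chart coordinate.\<close>
  have "restr src.S (points src.S) ?V (src.gsec q) =
      restr src.S (points src.S) ?V (src.gsec (\<lambda>_. [:tgt.\<sigma> j:])) \<oplus>\<^bsub>sections src.S ?V\<^esub>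
      (restr src.S (points src.S) ?V (src.gsec (\<lambda>_. [:x ^ tgt.m j:])) \<otimes>\<^bsub>sections src.S ?V\<^esub> g)"
    unfolding q[symmetric] g_def pull_const[symmetric]
    by (simp only: nat[OF carr(1), symmetric] nat[OF carr(2), symmetric] tgt.restr_u[OF j]
        ring_hom_add[OF hom rcarr[OF carr(2)] prod]
        ring_hom_mult[OF hom rcarr[OF carr(2)] tgt.tsec_carrier[OF j]])
  then have eq: "to_fract (q i) = to_fract [:tgt.\<sigma> j:] + to_fract [:x ^ tgt.m j:] * g i \<eta>"
    if "\<eta> \<in> src.ch i ?V"
    using that i \<eta>_prime
    by (auto simp: src.sections_ops src.gsec_def dest!: fun_cong[of _ _ i] fun_cong[of _ _ \<eta>])
  have mem: "\<eta> \<in> src.ch i ?V"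
    using i \<eta>_prime Q unfolding src.ch_def preim_def src.points_S tgt.chart_def by auto
  have "g i \<in> regular_functions UNIV (src.ch i ?V)" using g i by (simp add: src.carrier_sections)
  then obtain a b where ab: "b \<notin> \<eta>" "g i \<eta> = Fract a b"
    using regular_function_stalk[OF _ mem] by blast
  have b: "b \<noteq> 0" using ab(1) by (auto simp: \<eta>_def)
  \<comment> \<open>The denominator \<open>b\<close> of \<open>g\<close> at \<eta> is prime to
    \<open>x\<close>. Clearing it gives a divisibility of polynomials, from which \<open>b\<close>
    can then be cancelled.\<close>
  have "to_fract (b * (q i - [:tgt.\<sigma> j:])) = to_fract b * (to_fract [:x ^ tgt.m j:] * (to_fract a / to_fract b))"
    using eq[OF mem] ab(2) by (simp add: Fract_conv_to_fract)
  also have "\<dots> = to_fract ([:x ^ tgt.m j:] * a)" unfolding to_fract_mult using b by simp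
  finally have "b * (q i - [:tgt.\<sigma> j:]) = [:x:] ^ tgt.m j * a" by (simp only: to_fract_eq_iff poly_const_pow)
  then have "[:x:] ^ tgt.m j dvd b * (q i - [:tgt.\<sigma> j:])" by simp
  then have "[:x:] ^ tgt.m j dvd q i - [:tgt.\<sigma> j:]"
  proof (rule prime_elem_power_dvd_mult[rotated])
    show "prime_elem [:x:]" using prime_x by (simp only: prime_elem_const_poly_iff)
    show "\<not> [:x:] dvd b" using ab(1) by (simp only: \<eta>_def mem_Collect_eq not_False_eq_True)
  qed
  then show ?thesis by (simp add: poly_const_pow)
qed

end

text \<open>The point \<open>Q\<close> hit by the generic point of the component \<open>i\<close> is
  carried back into the chart \<open>i\<close>. The preimage of this chart is open, hence stable
  under generization, and so contains the generic point of the component \<open>j\<close> as well.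
  It is not necessary to know that generic points of components correspond.\<close>

lemma comp_to_inverse:
  assumes f: "surface_morphism x \<gamma> \<gamma>' f" and g: "surface_morphism x \<gamma>' \<gamma> g"
    and gf: "same_map (surface x \<gamma>) (surface x \<gamma>) (comp_map (surface x \<gamma>') g f) id_map"
    and ij: "surface_morphism.comp_to x \<gamma> \<gamma>' f i j"
  shows "surface_morphism.comp_to x \<gamma>' \<gamma> g j i"
proof -
  interpret f: surface_morphism x \<gamma> \<gamma>' f by fact
  interpret g: surface_morphism x \<gamma>' \<gamma> g by fact
  from ij obtain Q where i: "i \<in> f.src.I" and j: "j \<in> f.tgt.I" and Q: "Q \<in> primes UNIV" "[:x:] \<in> Q"
    "on_points f (f.src.cls i f.\<eta>) = f.tgt.cls j Q" by (auto simp: f.comp_to_def)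
  have "f.src.cls i f.\<eta> \<in> points f.src.S" using i f.\<eta>_prime unfolding f.src.points_S by blast
  then have "on_points g (f.tgt.cls j Q) = f.src.cls i f.\<eta>"
    using gf bspec[of "points f.src.S" _ "f.src.cls i f.\<eta>"] Q(3)
    unfolding same_map_def comp_map_def id_map_def by fastforce
  then have "Q \<in> f.tgt.ch j (preim f.tgt.S g (f.src.chart i))"
    using Q(1) j f.\<eta>_prime unfolding f.tgt.ch_def preim_def f.tgt.points_S f.src.chart_def by auto
  moreover have "zariski_open UNIV (f.tgt.ch j (preim f.tgt.S g (f.src.chart i)))"
    by (rule f.tgt.ch_open[OF openin_preim[OF g.map f.src.openin_chart[OF i]] j])
  ultimately have "f.\<eta> \<in> f.tgt.ch j (preim f.tgt.S g (f.src.chart i))"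
    using zariski_open_generization f.\<eta>_prime f.\<eta>_subset[OF Q(1,2)] by blast
  then obtain P where P: "P \<in> primes UNIV" "on_points g (f.tgt.cls j f.\<eta>) = f.src.cls i P"
    unfolding f.tgt.ch_def preim_def f.src.chart_def by blast
  moreover have "f.\<eta> = g.\<eta>" by (simp add: f.\<eta>_def g.\<eta>_def)
  moreover from this have "[:x:] \<in> P"
    using g.over_points[OF j g.\<eta>_prime i P(1)] P(2) by (simp add: g.\<eta>_def)
  ultimately show ?thesis using i j unfolding g.comp_to_def by auto
qed

text \<open>Pulling \<open>u\<close> back along \<open>g\<close> and then along \<open>f\<close>
  returns \<open>u\<close>. In terms of \<open>u'\<close> the first pullback has coefficients in
  \<open>A_x\<close> only, so it is multiplied by a power of \<open>x\<close> before
  \<open>pull_pcompose\<close> applies, and divided by it at the end.\<close>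

lemma pull_inverse_compose:
  assumes f: "surface_morphism x \<gamma> \<gamma>' f" and g: "surface_morphism x \<gamma>' \<gamma> g"
    and gf: "same_map (surface x \<gamma>) (surface x \<gamma>) (comp_map (surface x \<gamma>') g f) id_map"
    and q: "on_sections f (points (surface x \<gamma>')) (surface_charts.gsec \<gamma>' (surface_charts.u x \<gamma>')) =
      surface_charts.gsec \<gamma> q"
    and q': "on_sections g (points (surface x \<gamma>)) (surface_charts.gsec \<gamma> (surface_charts.u x \<gamma>)) =
      surface_charts.gsec \<gamma>' q'" "surface_charts.agrees x \<gamma>' q'"
    and i: "i \<in> leaves (fst \<gamma>)" and l: "l \<in> leaves (fst \<gamma>')"
  shows "pcompose (pcompose (map_poly to_fract (q' l)) (surface_charts.K x \<gamma>' l)) (map_poly to_fract (q i)) =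
    surface_charts.L x \<gamma> i"
proof -
  interpret f: surface_morphism x \<gamma> \<gamma>' f by fact
  interpret g: surface_morphism x \<gamma>' \<gamma> g by fact
  \<comment> \<open>The pullback of \<open>u\<close> written as a polynomial in \<open>u'\<close>;
    by \<open>agrees\<close> it does not depend on \<open>l\<close>.\<close>
  let ?r = "pcompose (map_poly to_fract (q' l)) (f.tgt.K l)"
  let ?T = "sections f.tgt.S (points f.tgt.S)" and ?S = "sections f.src.S (points f.src.S)"
  have "?r \<in> polys_over_localization x"
    by (intro f.src.pcompose_in_polys f.src.fract_poly_in_polys f.tgt.K_in_polys)
  then obtain n p where np: "smult (f.src.y ^ n) ?r = map_poly to_fract p"
    unfolding f.src.polys_iff by blast
  have tgt: "pcompose p (f.tgt.u k) = [:x ^ n:] * q' k" if k: "k \<in> f.tgt.I" for k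
  proof -
    have "?r = pcompose (map_poly to_fract (q' k)) (f.tgt.K k)"
      using q'(2) k l unfolding f.tgt.agrees_def by blast
    then have "map_poly to_fract (pcompose p (f.tgt.u k)) = smult (f.src.y ^ n) (map_poly to_fract (q' k))"
      by (simp add: map_poly_pcompose f.tgt.fract_poly_u f.tgt.pcompose_cancel pcompose_smult flip: np)
    also have "\<dots> = map_poly to_fract ([:x ^ n:] * q' k)"
      by (simp add: f.src.y_def to_fract_power)
    finally show ?thesis by (simp only: fract_poly_eq_iff)
  qed
  have "f.src.gsec f.src.u \<in> carrier ?S" by (intro f.src.gsec_carrier f.src.agrees_u)
  then have "on_sections (comp_map f.tgt.S g f) (points f.src.S) (f.src.gsec f.src.u) = f.src.gsec f.src.u"
    using gf f.src.openin_points unfolding same_map_def by (simp add: id_map_def)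
  then have inv: "f.pull (f.tgt.gsec q') = f.src.gsec f.src.u"
    by (simp add: comp_map_def g.preim_points q')
  have "f.tgt.gsec (\<lambda>k. pcompose p (f.tgt.u k)) =
      f.tgt.gsec (\<lambda>_. [:x ^ n:]) \<otimes>\<^bsub>?T\<^esub> f.tgt.gsec q'"
    unfolding f.tgt.gsec_ops by (auto simp: f.tgt.gsec_def tgt intro!: restrict_ext)
  then have "f.src.gsec (\<lambda>i. pcompose p (q i)) =
      f.src.gsec (\<lambda>_. [:x ^ n:]) \<otimes>\<^bsub>?S\<^esub> f.src.gsec f.src.u"
    using f.pull_pcompose[OF q] ring_hom_mult[OF f.pull_hom f.tgt.gsec_carrier f.tgt.gsec_carrier]
      f.tgt.agrees_const q'(2) f.pull_const inv by metis
  then have "pcompose p (q i) = [:x ^ n:] * f.src.u i"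
    unfolding f.src.gsec_ops using f.src.gsec_eqD[OF _ i] by blast
  then have "map_poly to_fract (pcompose p (q i)) = smult (f.src.y ^ n) (f.src.L i)"
    by (simp add: f.src.y_def to_fract_power f.src.fract_poly_u)
  then have "smult (f.src.y ^ n) (pcompose ?r (map_poly to_fract (q i))) = smult (f.src.y ^ n) (f.src.L i)"
    by (simp add: map_poly_pcompose pcompose_smult flip: np)
  from arg_cong[OF this, of "smult (1 / f.src.y ^ n)"] show ?thesis by simp
qed

text \<open>All that the combinatorial part needs to know about an isomorphism: comparing
  \<open>u' = \<alpha> u + \<beta>\<close> with \<open>T' = e i * T + c i\<close>, coefficient by
  coefficient, gives the two equations.\<close>

lemma affine_data_if_isomorphic:
  fixes x :: "'a::idom"
  assumes x: "prime_elem x" and iso: "X_isomorphic_surfaces x \<gamma> \<gamma>'"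
    and ne: "leaves (fst \<gamma>) \<noteq> {}"
  shows "\<exists>J \<alpha> \<beta> c e. bij_betw J (leaves (fst \<gamma>)) (leaves (fst \<gamma>')) \<and> (\<forall>i \<in> leaves (fst \<gamma>). e i dvd 1 \<and>
    to_fract (x ^ level (fst \<gamma>') (J i) * e i) = \<alpha> * to_fract (x ^ level (fst \<gamma>) i) \<and>
    to_fract (snd \<gamma>' (J i) + x ^ level (fst \<gamma>') (J i) * c i) = \<alpha> * to_fract (snd \<gamma> i) + \<beta>)"
proof -
  from iso obtain f g where lrs: "lrs_morphism (surface x \<gamma>) (surface x \<gamma>') f"
      "lrs_morphism (surface x \<gamma>') (surface x \<gamma>) g"
    and over: "same_map (surface x \<gamma>) (Spec (UNIV :: 'a set)) (comp_map (surface x \<gamma>') (surface_projection \<gamma>') f)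
        (surface_projection \<gamma>)"
      "same_map (surface x \<gamma>') (Spec (UNIV :: 'a set)) (comp_map (surface x \<gamma>) (surface_projection \<gamma>) g)
        (surface_projection \<gamma>')"
    and gf: "same_map (surface x \<gamma>) (surface x \<gamma>) (comp_map (surface x \<gamma>') g f) id_map"
    and fg: "same_map (surface x \<gamma>') (surface x \<gamma>') (comp_map (surface x \<gamma>) f g) id_map"
    unfolding X_isomorphic_surfaces_def isomorphic_over_def by blast
  have x0: "x \<noteq> 0" using x by (simp add: prime_elem_def)
  interpret f: surface_morphism x \<gamma> \<gamma>' f
    by unfold_locales (use x x0 lrs over in \<open>simp_all add: lrs_morphism_def ringed_space_map_def\<close>)
  interpret g: surface_morphism x \<gamma>' \<gamma> g
    by unfold_locales (use x x0 lrs over in \<open>simp_all add: lrs_morphism_def ringed_space_map_def\<close>)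
  note fm = f.surface_morphism_axioms and gm = g.surface_morphism_axioms
  obtain q where q: "f.pull (f.tgt.gsec f.tgt.u) = f.src.gsec q" "f.src.agrees q"
    using f.pull_gsec[OF f.tgt.agrees_u] by blast
  obtain q' where q': "g.pull (f.src.gsec f.src.u) = f.tgt.gsec q'" "f.tgt.agrees q'"
    using g.pull_gsec[OF f.src.agrees_u] by blast
  have "\<forall>i \<in> f.src.I. \<exists>j. f.comp_to i j" using f.ex_comp_to by blast
  then obtain J where J: "\<And>i. i \<in> f.src.I \<Longrightarrow> f.comp_to i (J i)" by metis
  have comp: "g.comp_to (J i) i" if "i \<in> f.src.I" for i
    by (rule comp_to_inverse[OF fm gm gf J[OF that]])
  have JI: "J i \<in> f.tgt.I" if "i \<in> f.src.I" for i using J[OF that] by (simp add: f.comp_to_def)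
  \<comment> \<open>The relations \<open>f.comp_to\<close> and \<open>g.comp_to\<close> are converse
    to each other, and each is the graph of a function.\<close>
  have bij: "bij_betw J f.src.I f.tgt.I"
  proof (rule bij_betwI')
    show "J i = J k \<longleftrightarrow> i = k" if "i \<in> f.src.I" "k \<in> f.src.I" for i k
      using comp[OF that(1)] comp[OF that(2)] g.comp_to_unique by metis
    show "\<exists>i \<in> f.src.I. j = J i" if j: "j \<in> f.tgt.I" for j
    proof -
      obtain i where i: "g.comp_to j i" using g.ex_comp_to[OF j] by blast
      then have "i \<in> f.src.I" by (simp add: g.comp_to_def)
      moreover have "f.comp_to i j" by (rule comp_to_inverse[OF gm fm fg i])
      ultimately show ?thesis using J f.comp_to_unique by blast
    qed
  qed (rule JI)
  have main: "\<exists>c e. e dvd 1 \<and> q i = [:f.tgt.\<sigma> (J i) + x ^ f.tgt.m (J i) * c, x ^ f.tgt.m (J i) * e:]"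
    if i: "i \<in> f.src.I" for i
  proof -
    let ?j = "J i"
    have comp1: "pcompose (pcompose (map_poly to_fract (q' ?j)) (f.tgt.K ?j)) (map_poly to_fract (q i)) = f.src.L i"
      by (rule pull_inverse_compose[OF fm gm gf q(1) q' i JI[OF i]])
    have "degree (f.src.L i) = 1" by (simp add: f.src.L_def)
    \<comment> \<open>Degrees multiply under composition over a domain, so a composite of degree one
      has only factors of degree one.\<close>
    then have "degree (q' ?j) * degree (f.tgt.K ?j) * degree (q i) = 1"
      using arg_cong[OF comp1, of degree] by (simp add: degree_pcompose degree_map_poly)
    then have deg: "degree (q' ?j) = 1" "degree (q i) = 1" by auto
    then obtain b a b' a' where qi: "q i = [:b, a:]" and qj: "q' ?j = [:b', a':]"
      using linear_poly_coeffs by metis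
    have "[:x ^ f.tgt.m ?j:] dvd q i - [:f.tgt.\<sigma> ?j:]" by (rule f.comp_to_dvd[OF J[OF i] q(1)])
    then have "x ^ f.tgt.m ?j dvd coeff (q i - [:f.tgt.\<sigma> ?j:]) n" for n
      unfolding const_poly_dvd_iff by blast
    from this[of 0] this[of 1]
    have dvd1: "x ^ f.tgt.m ?j dvd b - f.tgt.\<sigma> ?j" "x ^ f.tgt.m ?j dvd a"
      by (simp_all add: qi)
    have "[:x ^ f.src.m i:] dvd q' ?j - [:f.src.\<sigma> i:]" by (rule g.comp_to_dvd[OF comp[OF i] q'(1)])
    then have "x ^ f.src.m i dvd coeff (q' ?j - [:f.src.\<sigma> i:]) 1"
      unfolding const_poly_dvd_iff by blast
    then have dvd2: "x ^ f.src.m i dvd a'" by (simp add: qj)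
    obtain c e e' where c: "b = f.tgt.\<sigma> ?j + x ^ f.tgt.m ?j * c" and e: "a = x ^ f.tgt.m ?j * e"
      and e': "a' = x ^ f.src.m i * e'"
      using dvd1 dvd2 by (metis dvdE diff_add_cancel add.commute)
    \<comment> \<open>The linear coefficients of \<open>comp1\<close>: the product of the slopes is
      \<open>x^(m + m')\<close>, so after dividing out both powers of \<open>x\<close> the cofactors
      are inverse to each other.\<close>
    have "to_fract a' / f.src.y ^ f.tgt.m ?j * to_fract a = f.src.y ^ f.src.m i"
      using arg_cong[OF comp1, of "\<lambda>p. coeff p 1"]
      by (simp add: qi qj f.tgt.K_def f.src.L_def map_poly_pCons pcompose_pCons mult.commute)
    then have "to_fract (x ^ f.src.m i * (e' * e)) = to_fract (x ^ f.src.m i * 1)"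
      using x0 by (simp add: e e' f.src.y_def to_fract_power)
    then have "e' * e = 1" using x0 by (simp only: to_fract_eq_iff mult_left_cancel) simp
    then have "e dvd 1" by (metis dvd_triv_right)
    then show ?thesis using qi c e by blast
  qed
  then obtain c e where ce: "\<And>i. i \<in> f.src.I \<Longrightarrow> e i dvd 1 \<and>
      q i = [:f.tgt.\<sigma> (J i) + x ^ f.tgt.m (J i) * c i, x ^ f.tgt.m (J i) * e i:]"
    by metis
  from ne obtain k where k: "k \<in> f.src.I" by blast
  \<comment> \<open>The pullback of \<open>u'\<close> written in terms of \<open>u\<close>. By
    \<open>agrees\<close> any one leaf \<open>k\<close> suffices to read it off.\<close>
  define \<theta> where "\<theta> = pcompose (map_poly to_fract (q k)) (f.src.K k)"
  define \<alpha> where "\<alpha> = coeff \<theta> 1"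
  define \<beta> where "\<beta> = coeff \<theta> 0"
  have \<theta>: "\<theta> = [:\<beta>, \<alpha>:]"
    unfolding \<alpha>_def \<beta>_def unfolding \<theta>_def using ce[OF k]
    by (simp add: f.src.K_def map_poly_pCons pcompose_pCons)
  have q\<theta>: "map_poly to_fract (q i) = pcompose \<theta> (f.src.L i)" if i: "i \<in> f.src.I" for i
  proof -
    have "\<theta> = pcompose (map_poly to_fract (q i)) (f.src.K i)"
      using q(2) i k unfolding f.src.agrees_def \<theta>_def by blast
    then show ?thesis by (simp add: f.src.pcompose_cancel)
  qed
  have "to_fract (x ^ f.tgt.m (J i) * e i) = \<alpha> * to_fract (x ^ f.src.m i) \<and>
    to_fract (f.tgt.\<sigma> (J i) + x ^ f.tgt.m (J i) * c i) = \<alpha> * to_fract (f.src.\<sigma> i) + \<beta>"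
    if i: "i \<in> f.src.I" for i
  proof -
    have "[:to_fract (f.tgt.\<sigma> (J i) + x ^ f.tgt.m (J i) * c i), to_fract (x ^ f.tgt.m (J i) * e i):] =
        map_poly to_fract (q i)"
      using ce[OF i] by (simp add: map_poly_pCons)
    also have "\<dots> = [:\<alpha> * to_fract (f.src.\<sigma> i) + \<beta>, \<alpha> * to_fract (x ^ f.src.m i):]"
      unfolding q\<theta>[OF i] \<theta>
      by (simp add: pcompose_pCons f.src.L_def f.src.y_def to_fract_power mult.commute add.commute)
    finally show ?thesis by simp
  qed
  then show ?thesis using bij ce by blast
qed

section \<open>Trees\<close>

locale rooted_tree =
  fixes \<Gamma> :: "'v rel"
  assumes tree: "tree \<Gamma>"
begin

abbreviation le (infix "\<sqsubseteq>" 50) where "a \<sqsubseteq> b \<equiv> (a, b) \<in> \<Gamma>"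
abbreviation lv where "lv \<equiv> level \<Gamma>"
abbreviation fca where "fca \<equiv> first_common_ancestor \<Gamma>"
abbreviation ess where "ess \<equiv> essential_root \<Gamma>"

lemma le_refl: "a \<in> Field \<Gamma> \<Longrightarrow> a \<sqsubseteq> a"
  using tree by (auto simp: tree_def partial_order_on_def preorder_on_def refl_on_def)

lemma le_trans: "a \<sqsubseteq> b \<Longrightarrow> b \<sqsubseteq> c \<Longrightarrow> a \<sqsubseteq> c"
  using tree by (auto simp: tree_def partial_order_on_def preorder_on_def dest: transD)

lemma le_antisym: "a \<sqsubseteq> b \<Longrightarrow> b \<sqsubseteq> a \<Longrightarrow> a = b"
  using tree by (auto simp: tree_def partial_order_on_def dest: antisymD)

lemma le_Field: "a \<sqsubseteq> b \<Longrightarrow> a \<in> Field \<Gamma> \<and> b \<in> Field \<Gamma>"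
  by (auto simp: Field_def)

lemma finite_Field: "finite (Field \<Gamma>)" and Field_nonempty: "Field \<Gamma> \<noteq> {}"
  using tree by (auto simp: tree_def)

lemma le_total: "a \<sqsubseteq> e \<Longrightarrow> b \<sqsubseteq> e \<Longrightarrow> a \<sqsubseteq> b \<or> b \<sqsubseteq> a"
  using tree le_Field unfolding tree_def Chains_def under_def by blast

lemma finite_under: "finite (under \<Gamma> e)"
  by (rule finite_subset[OF _ finite_Field]) (auto simp: under_def Field_def)

lemma card_under: "e \<in> Field \<Gamma> \<Longrightarrow> card (under \<Gamma> e) = Suc (lv e)"
  using finite_under[of e] le_refl[of e] card_gt_0_iff[of "under \<Gamma> e"]
  by (auto simp: level_def under_def)

lemma lv_mono: "a \<sqsubseteq> b \<Longrightarrow> lv a \<le> lv b"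
  unfolding level_def
  by (intro diff_le_mono card_mono finite_under) (auto simp: under_def intro: le_trans)

lemma lv_strict_mono:
  assumes "a \<sqsubseteq> b" "a \<noteq> b"
  shows "lv a < lv b"
proof -
  have "b \<notin> under \<Gamma> a" "b \<in> under \<Gamma> b"
    using assms le_antisym le_refl le_Field by (auto simp: under_def)
  moreover have "under \<Gamma> a \<subseteq> under \<Gamma> b" using assms le_trans by (auto simp: under_def)
  ultimately have "under \<Gamma> a \<subset> under \<Gamma> b" by blast
  then have "card (under \<Gamma> a) < card (under \<Gamma> b)" by (rule psubset_card_mono[OF finite_under])
  then show ?thesis using card_under le_Field[OF assms(1)] by simp
qed

text \<open>Ancestors of a common element form a chain, so comparing them amounts to comparing
  numbers.\<close>

lemma le_iff_lv: "a \<sqsubseteq> e \<Longrightarrow> b \<sqsubseteq> e \<Longrightarrow> a \<sqsubseteq> b \<longleftrightarrow> lv a \<le> lv b"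
  using le_total lv_mono lv_strict_mono le_Field by (metis leD)

lemma eq_if_lv_eq: "a \<sqsubseteq> e \<Longrightarrow> b \<sqsubseteq> e \<Longrightarrow> lv a = lv b \<Longrightarrow> a = b"
  using le_iff_lv le_antisym by (metis order_refl)

text \<open>A counting argument: \<open>lv\<close> is injective on the \<open>lv e + 1\<close>
  ancestors of \<open>e\<close> and takes values at most \<open>lv e\<close> there.\<close>

lemma ancestor_at_level:
  assumes e: "e \<in> Field \<Gamma>" and h: "h \<le> lv e"
  shows "\<exists>a. a \<sqsubseteq> e \<and> lv a = h"
proof -
  have "inj_on lv (under \<Gamma> e)" using eq_if_lv_eq by (auto simp: inj_on_def under_def)
  then have "card (lv ` under \<Gamma> e) = card {..lv e}" using card_under[OF e] by (simp add: card_image)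
  moreover have "lv ` under \<Gamma> e \<subseteq> {..lv e}" using lv_mono by (auto simp: under_def)
  ultimately have "lv ` under \<Gamma> e = {..lv e}" by (intro card_subset_eq) auto
  then have "h \<in> lv ` under \<Gamma> e" using h by simp
  then show ?thesis by (auto simp: under_def)
qed

lemma leaf_Field: "l \<in> leaves \<Gamma> \<Longrightarrow> l \<in> Field \<Gamma>"
  by (simp add: leaves_def)

lemma leaf_max: "l \<in> leaves \<Gamma> \<Longrightarrow> l \<sqsubseteq> e \<Longrightarrow> e = l"
  by (simp add: leaves_def)

lemma maximal_lv:
  assumes "E \<subseteq> Field \<Gamma>" "E \<noteq> {}"
  shows "\<exists>a \<in> E. \<forall>b \<in> E. lv b \<le> lv a"
proof -
  have fin: "finite (lv ` E)" using assms finite_subset[OF _ finite_Field] by blast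
  then have "Max (lv ` E) \<in> lv ` E" using assms(2) by (intro Max_in) auto
  then obtain a where a: "a \<in> E" "lv a = Max (lv ` E)" by auto
  have "lv b \<le> lv a" if "b \<in> E" for b unfolding a(2) by (rule Max_ge[OF fin imageI[OF that]])
  then show ?thesis using a(1) by blast
qed

lemma leaf_above:
  assumes e: "e \<in> Field \<Gamma>"
  shows "\<exists>l \<in> leaves \<Gamma>. e \<sqsubseteq> l"
proof -
  have "{a. e \<sqsubseteq> a} \<subseteq> Field \<Gamma>" "{a. e \<sqsubseteq> a} \<noteq> {}" using le_refl[OF e] by (auto simp: Field_def)
  then obtain a where a: "e \<sqsubseteq> a" "\<And>b. e \<sqsubseteq> b \<Longrightarrow> lv b \<le> lv a"
    using maximal_lv[of "{a. e \<sqsubseteq> a}"] by blast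
  have "b = a" if "a \<sqsubseteq> b" for b
    using lv_strict_mono[OF that] a(2)[OF le_trans[OF a(1) that]] by fastforce
  then have "a \<in> leaves \<Gamma>" using a le_Field by (auto simp: leaves_def)
  then show ?thesis using a(1) by blast
qed

lemma root: "\<exists>r \<in> Field \<Gamma>. \<forall>e \<in> Field \<Gamma>. r \<sqsubseteq> e"
proof -
  have min: "\<exists>a. a \<sqsubseteq> e \<and> minimal_element \<Gamma> a" if e: "e \<in> Field \<Gamma>" for e
  proof -
    obtain a where a: "a \<sqsubseteq> e" "lv a = 0" using ancestor_at_level[OF e] by blast
    then have "b = a" if "b \<sqsubseteq> a" for b using lv_strict_mono[OF that] by auto
    then show ?thesis using a le_Field unfolding minimal_element_def by blast
  qed
  obtain r where r: "minimal_element \<Gamma> r" "\<And>a. minimal_element \<Gamma> a \<Longrightarrow> a = r"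
    using tree unfolding tree_def by blast
  have "r \<in> Field \<Gamma>" using r(1) unfolding minimal_element_def by (rule conjunct1)
  then show ?thesis using min r(2) by blast
qed

text \<open>Replaces the definite description by the universal property of a meet. Existence holds
  because the common ancestors form a nonempty finite chain, nonempty by the root.\<close>

lemma below_fca_iff:
  assumes E: "E \<subseteq> leaves \<Gamma>" and ij: "i \<in> E" "j \<in> E" "i \<noteq> j"
  shows "y \<sqsubseteq> fca E \<longleftrightarrow> (\<forall>e \<in> E. y \<sqsubseteq> e)"
proof -
  let ?B = "\<Inter>e \<in> E. underS \<Gamma> e"
  \<comment> \<open>A leaf of \<open>E\<close> below all of \<open>E\<close> would equal every other
    leaf of \<open>E\<close>; as \<open>i\<close> and \<open>j\<close> differ, strictness in
    \<open>underS\<close> is automatic.\<close>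
  have B: "y \<in> ?B \<longleftrightarrow> (\<forall>e \<in> E. y \<sqsubseteq> e)" for y
    using E ij leaf_max unfolding underS_def by blast
  obtain r where "r \<in> Field \<Gamma>" "\<And>e. e \<in> Field \<Gamma> \<Longrightarrow> r \<sqsubseteq> e" using root by blast
  then have "r \<in> ?B" using E leaf_Field unfolding B by blast
  then have "?B \<noteq> {}" by blast
  moreover have "?B \<subseteq> Field \<Gamma>" using ij(1) unfolding underS_def by (auto simp: Field_def)
  ultimately obtain z where z: "z \<in> ?B" "\<And>y. y \<in> ?B \<Longrightarrow> lv y \<le> lv z"
    using maximal_lv[of ?B] by metis
  have max: "y \<sqsubseteq> z" if "y \<in> ?B" for y
    using that z le_iff_lv[of y i z] ij(1) unfolding B by blast
  have "fca E = z"
    unfolding first_common_ancestor_def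
    by (rule the_equality) (use z(1) max le_antisym in blast)+
  then show ?thesis using max z(1) le_trans unfolding B by blast
qed

lemma fca_le: "E \<subseteq> leaves \<Gamma> \<Longrightarrow> i \<in> E \<Longrightarrow> j \<in> E \<Longrightarrow> i \<noteq> j \<Longrightarrow> e \<in> E \<Longrightarrow> fca E \<sqsubseteq> e"
proof -
  assume *: "E \<subseteq> leaves \<Gamma>" "i \<in> E" "j \<in> E" "i \<noteq> j" "e \<in> E"
  obtain r where "r \<in> Field \<Gamma>" "\<And>e. e \<in> Field \<Gamma> \<Longrightarrow> r \<sqsubseteq> e" using root by blast
  then have "r \<sqsubseteq> fca E" using below_fca_iff[OF *(1-4)] *(1) leaf_Field by blast
  then have "fca E \<sqsubseteq> fca E" using le_refl le_Field by blast
  then show ?thesis using below_fca_iff[OF *(1-4)] *(5) by blast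
qed

lemma below_fca2_iff:
  assumes "i \<in> leaves \<Gamma>" "j \<in> leaves \<Gamma>" "i \<noteq> j"
  shows "y \<sqsubseteq> fca {i, j} \<longleftrightarrow> y \<sqsubseteq> i \<and> y \<sqsubseteq> j"
  using below_fca_iff[of "{i, j}" i j y] assms by auto

lemma fca2_le:
  assumes "i \<in> leaves \<Gamma>" "j \<in> leaves \<Gamma>" "i \<noteq> j"
  shows "fca {i, j} \<sqsubseteq> i" "fca {i, j} \<sqsubseteq> j"
  using fca_le[of "{i, j}" i j] assms by auto

lemma lv_fca_less:
  assumes "i \<in> leaves \<Gamma>" "j \<in> leaves \<Gamma>" "i \<noteq> j"
  shows "lv (fca {i, j}) < lv i" "lv (fca {i, j}) < lv j"
  using lv_strict_mono fca2_le[OF assms] leaf_max assms by metis+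

text \<open>Turns the case distinction on chains in \<open>essential_root\<close> into one on the
  number of leaves, which is what a bijection of leaves can see.\<close>

lemma essential_root_cases:
  obtains l where "leaves \<Gamma> = {l}" "ess = l"
  | i j where "i \<in> leaves \<Gamma>" "j \<in> leaves \<Gamma>" "i \<noteq> j" "ess = fca (leaves \<Gamma>)"
proof (cases "Field \<Gamma> \<in> Chains \<Gamma>")
  case True
  obtain l where l: "l \<in> leaves \<Gamma>" using leaf_above Field_nonempty by blast
  have "k = l" if k: "k \<in> leaves \<Gamma>" for k
    using True leaf_Field[OF k] leaf_Field[OF l] leaf_max[OF k] leaf_max[OF l]
    unfolding Chains_def by blast
  then have "leaves \<Gamma> = {l}" using l by blast
  then show thesis using that(1)[of l] True by (simp add: essential_root_def)
next
  case False
  then obtain a b where "a \<in> Field \<Gamma>" "b \<in> Field \<Gamma>" "\<not> a \<sqsubseteq> b" "\<not> b \<sqsubseteq> a"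
    unfolding Chains_def by blast
  then obtain i j where "i \<in> leaves \<Gamma>" "j \<in> leaves \<Gamma>" "i \<noteq> j"
    using leaf_above le_total by metis
  then show thesis using that(2) False by (simp add: essential_root_def)
qed

lemma ess_le_leaf: "l \<in> leaves \<Gamma> \<Longrightarrow> ess \<sqsubseteq> l"
  by (cases rule: essential_root_cases) (auto intro: fca_le le_refl leaf_Field)

lemma ess_Field: "ess \<in> Field \<Gamma>"
  using ess_le_leaf leaf_above Field_nonempty le_Field by blast

lemma ess_le_fca:
  assumes "i \<in> leaves \<Gamma>" "j \<in> leaves \<Gamma>" "i \<noteq> j"
  shows "ess \<sqsubseteq> fca {i, j}"
  using below_fca2_iff[OF assms] ess_le_leaf assms by blast

text \<open>The elements \<open>fca {i, k}\<close> lie on the chain below \<open>i\<close>, so the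
  lowest of them is below every leaf. Thus the essential root is visible in the pairwise ancestors
  of any prescribed leaf.\<close>

lemma fca_eq_ess:
  assumes "i \<in> leaves \<Gamma>" "j \<in> leaves \<Gamma>" "i \<noteq> j"
  obtains k where "k \<in> leaves \<Gamma>" "k \<noteq> i" "fca {i, k} = ess"
proof -
  have ess: "ess = fca (leaves \<Gamma>)"
    using assms by (cases rule: essential_root_cases) auto
  let ?D = "(\<lambda>k. lv (fca {i, k})) ` (leaves \<Gamma> - {i})"
  have "finite (leaves \<Gamma>)" by (rule finite_subset[OF _ finite_Field]) (auto simp: leaves_def)
  then have fin: "finite ?D" by simp
  then have "Min ?D \<in> ?D" using assms by (intro Min_in) auto
  then obtain k where "k \<in> leaves \<Gamma> - {i}" "Min ?D = lv (fca {i, k})" by blast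
  then have k: "k \<in> leaves \<Gamma>" "k \<noteq> i" "lv (fca {i, k}) = Min ?D" by simp_all
  have "fca {i, k} \<sqsubseteq> l" if l: "l \<in> leaves \<Gamma>" for l
  proof (cases "l = i")
    case True
    then show ?thesis using fca2_le(1) assms(1) k by blast
  next
    case False
    then have "lv (fca {i, k}) \<le> lv (fca {i, l})" using k(3) fin l by simp
    then have "fca {i, k} \<sqsubseteq> fca {i, l}"
      using le_iff_lv fca2_le(1) assms(1) k l False by metis
    then show ?thesis using le_trans fca2_le(2) assms(1) l False by metis
  qed
  then have "fca {i, k} \<sqsubseteq> ess" unfolding ess using below_fca_iff[OF _ assms] by blast
  then have "fca {i, k} = ess" using le_antisym ess_le_fca k assms(1) by metis
  then show thesis using that k by blast
qed

section \<open>Essential subtrees\<close>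

lemma in_Es_iff: "(a, b) \<in> Es \<Gamma> \<longleftrightarrow> a \<sqsubseteq> b \<and> ess \<sqsubseteq> a"
  unfolding Es_def using le_trans le_Field by blast

lemma Field_Es: "Field (Es \<Gamma>) = {e. ess \<sqsubseteq> e}"
proof -
  have "(e, e) \<in> Es \<Gamma>" if "ess \<sqsubseteq> e" for e using that le_refl le_Field by (auto simp: in_Es_iff)
  moreover have "ess \<sqsubseteq> e" if "e \<in> Field (Es \<Gamma>)" for e
    using that by (auto simp: Field_def in_Es_iff intro: le_trans)
  ultimately show ?thesis by (auto simp: Field_def)
qed

lemma tree_Es: "tree (Es \<Gamma>)"
  unfolding tree_def
proof (intro conjI ballI)
  show "Partial_order (Es \<Gamma>)"
    unfolding partial_order_on_def preorder_on_def
  proof (intro conjI)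
    show "refl_on (Field (Es \<Gamma>)) (Es \<Gamma>)"
      unfolding refl_on_def Field_Es using le_refl le_Field by (auto simp: in_Es_iff intro: le_trans)
    show "trans (Es \<Gamma>)" unfolding trans_def in_Es_iff using le_trans by blast
    show "antisym (Es \<Gamma>)" unfolding antisym_def in_Es_iff using le_antisym by blast
  qed (auto simp: Field_def)
  show "finite (Field (Es \<Gamma>))"
    unfolding Field_Es by (rule finite_subset[OF _ finite_Field]) (auto simp: Field_def)
  show "Field (Es \<Gamma>) \<noteq> {}" unfolding Field_Es using le_refl[OF ess_Field] by blast
  show "\<exists>!e. minimal_element (Es \<Gamma>) e"
  proof (rule ex1I[of _ ess])
    show "minimal_element (Es \<Gamma>) ess"
      unfolding minimal_element_def Field_Es in_Es_iff using le_refl[OF ess_Field] le_antisym by blast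
    show "e = ess" if "minimal_element (Es \<Gamma>) e" for e
      using that le_refl[OF ess_Field] unfolding minimal_element_def Field_Es in_Es_iff by blast
  qed
  show "under (Es \<Gamma>) e \<in> Chains (Es \<Gamma>)" for e
    unfolding Chains_def under_def in_Es_iff using le_total by blast
qed

lemma leaves_Es: "leaves (Es \<Gamma>) = leaves \<Gamma>"
proof (intro equalityI subsetI)
  fix l assume "l \<in> leaves \<Gamma>"
  then show "l \<in> leaves (Es \<Gamma>)"
    using ess_le_leaf leaf_max unfolding leaves_def[of "Es \<Gamma>"] Field_Es in_Es_iff by blast
next
  fix l assume "l \<in> leaves (Es \<Gamma>)"
  then show "l \<in> leaves \<Gamma>"
    using le_Field unfolding leaves_def Field_Es in_Es_iff by blast
qed

text \<open>The chain below \<open>e\<close> splits at \<open>ess\<close>, which belongs to both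
  pieces; this overlap compensates for a chain having one element more than its level.\<close>

lemma level_Es:
  assumes e: "ess \<sqsubseteq> e"
  shows "lv e = lv ess + level (Es \<Gamma>) e"
proof -
  interpret E: rooted_tree "Es \<Gamma>" by unfold_locales (rule tree_Es)
  have "under \<Gamma> e = under \<Gamma> ess \<union> under (Es \<Gamma>) e"
    using le_trans[OF _ e] le_total[OF e] by (auto simp: under_def in_Es_iff)
  moreover have "under \<Gamma> ess \<inter> under (Es \<Gamma>) e = {ess}"
    using e le_refl[OF ess_Field] by (auto simp: under_def in_Es_iff dest: le_antisym)
  ultimately have "card (under \<Gamma> e) + 1 = card (under \<Gamma> ess) + card (under (Es \<Gamma>) e)"
    using card_Un_Int[OF finite_under E.finite_under] by simp
  moreover have "e \<in> Field \<Gamma>" "e \<in> Field (Es \<Gamma>)" using e le_Field Field_Es by auto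
  ultimately show ?thesis using card_under E.card_under ess_Field by simp
qed

lemma fca_Es:
  assumes "i \<in> leaves \<Gamma>" "j \<in> leaves \<Gamma>" "i \<noteq> j"
  shows "first_common_ancestor (Es \<Gamma>) {i, j} = fca {i, j}"
proof -
  interpret E: rooted_tree "Es \<Gamma>" by unfold_locales (rule tree_Es)
  have E: "i \<in> leaves (Es \<Gamma>)" "j \<in> leaves (Es \<Gamma>)" using assms leaves_Es by auto
  have "(fca {i, j}, E.fca {i, j}) \<in> Es \<Gamma>"
    using E.below_fca2_iff[OF E assms(3)] fca2_le[OF assms] ess_le_fca[OF assms] in_Es_iff by blast
  moreover have "E.fca {i, j} \<sqsubseteq> fca {i, j}"
    unfolding below_fca2_iff[OF assms] using E.fca2_le[OF E assms(3)] in_Es_iff by blast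
  ultimately show ?thesis using le_antisym in_Es_iff by metis
qed

end

section \<open>Reconstruction of a tree from the levels of leaves and first common ancestors\<close>

lemma ex_level_preserving_map:
  assumes T: "tree T" and U: "tree U"
    and J: "\<And>i. i \<in> leaves T \<Longrightarrow> J i \<in> leaves U" "inj_on J (leaves T)"
    and lv: "\<And>i. i \<in> leaves T \<Longrightarrow> level U (J i) = level T i"
    and fca: "\<And>i j. i \<in> leaves T \<Longrightarrow> j \<in> leaves T \<Longrightarrow> i \<noteq> j \<Longrightarrow>
      level U (first_common_ancestor U {J i, J j}) = level T (first_common_ancestor T {i, j})"
  shows "\<exists>\<tau>. \<forall>e i. i \<in> leaves T \<longrightarrow> (e, i) \<in> T \<longrightarrow> (\<tau> e, J i) \<in> U \<and> level U (\<tau> e) = level T e"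
proof -
  interpret T: rooted_tree T by unfold_locales (rule T)
  interpret U: rooted_tree U by unfold_locales (rule U)
  have "\<exists>a. \<forall>i. i \<in> leaves T \<longrightarrow> (e, i) \<in> T \<longrightarrow> (a, J i) \<in> U \<and> level U a = level T e" for e
  proof (cases "e \<in> Field T")
    case True
    then obtain l where l: "l \<in> leaves T" "(e, l) \<in> T" using T.leaf_above by blast
    then have "level T e \<le> level U (J l)" using lv T.lv_mono by simp
    \<comment> \<open>An element is determined by its level and any leaf above it, so the image of
      \<open>e\<close> can only be the ancestor of \<open>J l\<close> at the level of
      \<open>e\<close>.\<close>
    then obtain a where a: "(a, J l) \<in> U" "level U a = level T e"
      using U.ancestor_at_level U.leaf_Field J(1) l(1) by metis
    have "(a, J i) \<in> U" if i: "i \<in> leaves T" "(e, i) \<in> T" for i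
    proof (cases "i = l")
      case False
      then have ne: "J l \<noteq> J i" using J(2) l i by (auto simp: inj_on_def)
      \<comment> \<open>Independence of the leaf: the first common ancestor of two leaves above
        \<open>e\<close> is at least as high as \<open>e\<close>. Its level is preserved, so the
        ancestor of \<open>J l\<close> also lies below \<open>J i\<close>.\<close>
      have "level T e \<le> level T (T.fca {l, i})"
        using T.lv_mono T.below_fca2_iff[OF l(1) i(1)] False l i by metis
      then have "level U a \<le> level U (U.fca {J l, J i})" using fca[OF l(1) i(1)] False a by simp
      then have "(a, U.fca {J l, J i}) \<in> U"
        using U.le_iff_lv[OF a(1) U.fca2_le(1)] J(1) l(1) i(1) ne by blast
      then show ?thesis using U.below_fca2_iff[OF J(1)[OF l(1)] J(1)[OF i(1)] ne] by blast
    qed (use a in simp)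
    then show ?thesis using a by blast
  next
    case False
    then show ?thesis using T.le_Field by blast
  qed
  then show ?thesis by metis
qed

text \<open>Both \<open>J\<close> and its inverse extend to level-preserving maps. These are inverse
  to each other, since elements of equal level below the same leaf coincide.\<close>

lemma ex_tree_iso:
  assumes T: "tree T" and U: "tree U" and J: "bij_betw J (leaves T) (leaves U)"
    and lv: "\<And>i. i \<in> leaves T \<Longrightarrow> level U (J i) = level T i"
    and fca: "\<And>i j. i \<in> leaves T \<Longrightarrow> j \<in> leaves T \<Longrightarrow> i \<noteq> j \<Longrightarrow>
      level U (first_common_ancestor U {J i, J j}) = level T (first_common_ancestor T {i, j})"
  shows "\<exists>\<tau>. tree_iso T U \<tau> \<and> (\<forall>i \<in> leaves T. \<tau> i = J i)"
proof -
  interpret T: rooted_tree T by unfold_locales (rule T)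
  interpret U: rooted_tree U by unfold_locales (rule U)
  define J' where "J' = inv_into (leaves T) J"
  have J': "bij_betw J' (leaves U) (leaves T)" unfolding J'_def by (rule bij_betw_inv_into[OF J])
  have JI: "J i \<in> leaves U" "J' (J i) = i" if "i \<in> leaves T" for i
    using J that by (auto simp: J'_def bij_betw_def inv_into_f_f)
  have J'I: "J' i \<in> leaves T" "J (J' i) = i" if "i \<in> leaves U" for i
    using J J' that by (auto simp: J'_def bij_betw_def f_inv_into_f)
  obtain \<tau> where \<tau>: "\<And>e i. i \<in> leaves T \<Longrightarrow> (e, i) \<in> T \<Longrightarrow> (\<tau> e, J i) \<in> U \<and> level U (\<tau> e) = level T e"
    using ex_level_preserving_map[OF T U, of J] J JI lv fca by (auto simp: bij_betw_def)
  have fca': "level T (T.fca {J' i, J' j}) = level U (U.fca {i, j})"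
    if "i \<in> leaves U" "j \<in> leaves U" "i \<noteq> j" for i j
    using fca[of "J' i" "J' j"] J'I that by metis
  have lv': "level T (J' i) = level U i" if "i \<in> leaves U" for i using lv[of "J' i"] J'I that by simp
  obtain \<tau>' where \<tau>': "\<And>e i. i \<in> leaves U \<Longrightarrow> (e, i) \<in> U \<Longrightarrow> (\<tau>' e, J' i) \<in> T \<and> level T (\<tau>' e) = level U e"
    using ex_level_preserving_map[OF U T, of J'] J' J'I lv' fca' by (auto simp: bij_betw_def)
  have inv: "\<tau>' (\<tau> e) = e \<and> \<tau> e \<in> Field U" if e: "e \<in> Field T" for e
  proof -
    obtain i where i: "i \<in> leaves T" "(e, i) \<in> T" using T.leaf_above[OF e] by blast
    then have "(\<tau>' (\<tau> e), i) \<in> T" "level T (\<tau>' (\<tau> e)) = level T e"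
      using \<tau>[OF i] \<tau>'[of "J i" "\<tau> e"] JI by auto
    then show ?thesis using T.eq_if_lv_eq i \<tau>[OF i] U.le_Field by blast
  qed
  have inv': "\<tau> (\<tau>' e) = e \<and> \<tau>' e \<in> Field T" if e: "e \<in> Field U" for e
  proof -
    obtain i where i: "i \<in> leaves U" "(e, i) \<in> U" using U.leaf_above[OF e] by blast
    then have "(\<tau> (\<tau>' e), i) \<in> U" "level U (\<tau> (\<tau>' e)) = level U e"
      using \<tau>'[OF i] \<tau>[of "J' i" "\<tau>' e"] J'I by auto
    then show ?thesis using U.eq_if_lv_eq i \<tau>'[OF i] T.le_Field by blast
  qed
  have mono: "(\<tau> a, \<tau> b) \<in> U" if ab: "(a, b) \<in> T" for a b
  proof -
    obtain i where i: "i \<in> leaves T" "(b, i) \<in> T" using T.leaf_above T.le_Field ab by blast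
    then have "(a, i) \<in> T" using T.le_trans ab by blast
    then show ?thesis using \<tau>[OF i] \<tau>[of i a] i U.le_iff_lv T.lv_mono[OF ab] by metis
  qed
  have mono': "(\<tau>' a, \<tau>' b) \<in> T" if ab: "(a, b) \<in> U" for a b
  proof -
    obtain i where i: "i \<in> leaves U" "(b, i) \<in> U" using U.leaf_above U.le_Field ab by blast
    then have "(a, i) \<in> U" using U.le_trans ab by blast
    then show ?thesis using \<tau>'[OF i] \<tau>'[of i a] i T.le_iff_lv U.lv_mono[OF ab] by metis
  qed
  have "tree_iso T U \<tau>"
    unfolding tree_iso_def
  proof (intro conjI ballI)
    show "bij_betw \<tau> (Field T) (Field U)"
      by (rule bij_betw_byWitness[where f' = \<tau>']) (use inv inv' in auto)
    show "(e, e') \<in> T \<longleftrightarrow> (\<tau> e, \<tau> e') \<in> U" if "e \<in> Field T" "e' \<in> Field T" for e e'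
      using mono mono' inv that by metis
  qed
  moreover have "\<tau> i = J i" if i: "i \<in> leaves T" for i
    using \<tau>[OF i T.le_refl] T.leaf_Field[OF i] lv[OF i] U.eq_if_lv_eq U.le_refl U.leaf_Field[OF JI(1)[OF i]]
    by metis
  ultimately show ?thesis by blast
qed

lemma tree_iso_leaves:
  assumes \<tau>: "tree_iso T U \<tau>"
  shows "bij_betw \<tau> (leaves T) (leaves U)"
proof -
  have bij: "bij_betw \<tau> (Field T) (Field U)"
    and iso: "\<And>e e'. e \<in> Field T \<Longrightarrow> e' \<in> Field T \<Longrightarrow> (e, e') \<in> T \<longleftrightarrow> (\<tau> e, \<tau> e') \<in> U"
    using \<tau> by (auto simp: tree_iso_def)
  have leaf_iff: "e \<in> leaves T \<longleftrightarrow> \<tau> e \<in> leaves U" if e: "e \<in> Field T" for e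
  proof
    assume l: "e \<in> leaves T"
    have "f = \<tau> e" if "(\<tau> e, f) \<in> U" for f
    proof -
      have "f \<in> Field U" using that by (auto simp: Field_def)
      then obtain e' where "e' \<in> Field T" "f = \<tau> e'" using bij by (auto simp: bij_betw_def)
      then show ?thesis using iso[OF e] that l by (auto simp: leaves_def)
    qed
    then show "\<tau> e \<in> leaves U" using bij e by (auto simp: leaves_def bij_betw_def)
  next
    assume l: "\<tau> e \<in> leaves U"
    have "e' = e" if "(e, e') \<in> T" for e'
    proof -
      have e': "e' \<in> Field T" using that by (auto simp: Field_def)
      then have "\<tau> e' = \<tau> e" using iso[OF e e'] that l by (auto simp: leaves_def)
      then show ?thesis using bij e e' by (auto simp: bij_betw_def inj_on_def)
    qed
    then show "e \<in> leaves T" using e by (auto simp: leaves_def)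
  qed
  have sub: "leaves T \<subseteq> Field T" "leaves U \<subseteq> Field U" by (auto simp: leaves_def)
  have "\<tau> ` leaves T = leaves U"
  proof (intro equalityI subsetI)
    fix l assume "l \<in> leaves U"
    then obtain e where "e \<in> Field T" "l = \<tau> e" using bij sub(2) by (auto simp: bij_betw_def)
    then show "l \<in> \<tau> ` leaves T" using \<open>l \<in> leaves U\<close> leaf_iff by blast
  qed (use leaf_iff sub(1) in blast)
  then show ?thesis using bij_betw_subset[OF bij sub(1)] by blast
qed

lemma tree_iso_level:
  assumes \<tau>: "tree_iso T U \<tau>" and e: "e \<in> Field T"
  shows "level U (\<tau> e) = level T e"
proof -
  have bij: "bij_betw \<tau> (Field T) (Field U)"
    and iso: "\<And>e e'. e \<in> Field T \<Longrightarrow> e' \<in> Field T \<Longrightarrow> (e, e') \<in> T \<longleftrightarrow> (\<tau> e, \<tau> e') \<in> U"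
    using \<tau> by (auto simp: tree_iso_def)
  have sub: "under T e \<subseteq> Field T" "under U (\<tau> e) \<subseteq> Field U" by (auto simp: under_def Field_def)
  have "under U (\<tau> e) = \<tau> ` under T e"
  proof (intro equalityI subsetI)
    fix f assume f: "f \<in> under U (\<tau> e)"
    then obtain e' where "e' \<in> Field T" "f = \<tau> e'" using bij sub(2) by (auto simp: bij_betw_def)
    then show "f \<in> \<tau> ` under T e" using f iso e by (auto simp: under_def)
  next
    fix f assume "f \<in> \<tau> ` under T e"
    then show "f \<in> under U (\<tau> e)" using iso[OF _ e] sub(1) unfolding under_def by blast
  qed
  moreover have "inj_on \<tau> (under T e)" using bij sub(1) inj_on_subset unfolding bij_betw_def by blast
  ultimately show ?thesis by (simp add: level_def card_image)
qed

section \<open>Labelled trees and coordinate changes\<close>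

text \<open>The \<open>x\<close>-adic valuation as a relation, so that zero needs no value.\<close>

definition exact_power :: "'a::idom \<Rightarrow> nat \<Rightarrow> 'a \<Rightarrow> bool"
  where "exact_power x n z \<longleftrightarrow> x ^ n dvd z \<and> \<not> x ^ Suc n dvd z"

lemma exact_power_unique:
  assumes "exact_power x n z" "exact_power x k z"
  shows "n = k"
  using assms le_imp_power_dvd[of "Suc n" k x] le_imp_power_dvd[of "Suc k" n x] dvd_trans
  unfolding exact_power_def by (metis Suc_leI linorder_neqE_nat)

lemma exact_power_mult_power:
  assumes "x \<noteq> 0"
  shows "exact_power x (k + n) (x ^ k * z) \<longleftrightarrow> exact_power x n z"
  using assms by (simp add: exact_power_def power_add flip: power_Suc add_Suc_right)

lemma exact_power_mult_unit:
  assumes "e dvd 1"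
  shows "exact_power x n (e * z) \<longleftrightarrow> exact_power x n z"
proof -
  obtain e' where e': "1 = e * e'" using assms by blast
  have "x ^ n dvd e * z \<longleftrightarrow> x ^ n dvd z" for n
  proof
    assume "x ^ n dvd e * z"
    then have "x ^ n dvd e' * (e * z)" by (rule dvd_mult)
    also have "e' * (e * z) = (e * e') * z" by (simp add: mult_ac)
    finally show "x ^ n dvd z" by (simp flip: e')
  qed (rule dvd_mult)
  then show ?thesis by (simp only: exact_power_def)
qed

lemma exact_power_add:
  assumes "x ^ Suc n dvd w"
  shows "exact_power x n (z + w) \<longleftrightarrow> exact_power x n z"
proof -
  have "x ^ n dvd w" using assms by (metis dvd_mult_right power_Suc)
  then show ?thesis using assms by (simp add: exact_power_def dvd_add_left_iff)
qed

text \<open>The exponent is the valuation of either side; once the exponents agree, the power of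
  \<open>x\<close> cancels.\<close>

lemma power_times_unit_eq:
  fixes x :: "'a::idom"
  assumes x: "prime_elem x" and e: "e dvd 1" "f dvd 1" and eq: "x ^ p * e = x ^ q * f"
  shows "p = q \<and> e = f"
proof -
  have nz: "x \<noteq> 0" and nu: "\<not> x dvd 1" using x by (auto simp: prime_elem_def)
  have 1: "exact_power x 0 1" using nu by (simp add: exact_power_def)
  have "exact_power x (n + 0) (x ^ n * (g * 1))" if "g dvd 1" for n g
    unfolding exact_power_mult_power[OF nz] exact_power_mult_unit[OF that] by (rule 1)
  from this[OF e(1), of p] this[OF e(2), of q] eq have "p = q"
    using exact_power_unique by fastforce
  then show ?thesis using eq nz by simp
qed

lemma compatible_iff:
  "compatible x \<Gamma> \<sigma> \<longleftrightarrow> (\<forall>i \<in> leaves \<Gamma>. \<forall>j \<in> leaves \<Gamma>. i \<noteq> j \<longrightarrow>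
    exact_power x (level \<Gamma> (first_common_ancestor \<Gamma> {i, j})) (\<sigma> j - \<sigma> i))"
  by (simp add: compatible_def exact_power_def Let_def)

text \<open>The essential root is below all first common ancestors, so its power of \<open>x\<close>
  divides all differences of the cochain. Dividing the differences to one fixed leaf
  \<open>i0\<close> gives \<rho>, with \<open>c\<close> the value at \<open>i0\<close>.\<close>

lemma ex_essential_cochain:
  assumes x: "x \<noteq> 0" and \<gamma>: "labelled_tree x \<gamma>"
  shows "\<exists>\<rho>. essential_cochain x \<gamma> \<rho>"
proof -
  let ?\<Gamma> = "fst \<gamma>" and ?\<sigma> = "snd \<gamma>"
  interpret rooted_tree ?\<Gamma> using \<gamma> by unfold_locales (simp add: labelled_tree_def)
  have comp: "exact_power x (lv (fca {i, j})) (?\<sigma> j - ?\<sigma> i)"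
    if "i \<in> leaves ?\<Gamma>" "j \<in> leaves ?\<Gamma>" "i \<noteq> j" for i j
    using \<gamma> that unfolding labelled_tree_def compatible_iff by blast
  obtain i0 where i0: "i0 \<in> leaves ?\<Gamma>" using leaf_above[OF ess_Field] by blast
  have "\<exists>r. ?\<sigma> i = ?\<sigma> i0 + x ^ lv ess * r" if i: "i \<in> leaves ?\<Gamma>" for i
  proof (cases "i = i0")
    case False
    then have "x ^ lv (fca {i0, i}) dvd ?\<sigma> i - ?\<sigma> i0"
      using comp[OF i0 i] by (simp add: exact_power_def)
    moreover have "x ^ lv ess dvd x ^ lv (fca {i0, i})"
      using False ess_le_fca[OF i0 i] by (intro le_imp_power_dvd lv_mono) auto
    ultimately obtain r where "?\<sigma> i - ?\<sigma> i0 = x ^ lv ess * r" by (meson dvdE dvd_trans)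
    then show ?thesis by (metis add.commute diff_add_cancel)
  qed (auto intro: exI[of _ 0])
  then obtain \<rho> where \<rho>: "\<And>i. i \<in> leaves ?\<Gamma> \<Longrightarrow> ?\<sigma> i = ?\<sigma> i0 + x ^ lv ess * \<rho> i" by metis
  have "exact_power x (level (Es ?\<Gamma>) (fca {i, j})) (\<rho> j - \<rho> i)"
    if ij: "i \<in> leaves ?\<Gamma>" "j \<in> leaves ?\<Gamma>" "i \<noteq> j" for i j
  proof -
    have "?\<sigma> j - ?\<sigma> i = x ^ lv ess * (\<rho> j - \<rho> i)"
      using \<rho> ij by (simp add: algebra_simps)
    then show ?thesis
      using comp[OF ij] level_Es[OF ess_le_fca[OF ij]] exact_power_mult_power[OF x] by metis
  qed
  then have "compatible x (Es ?\<Gamma>) \<rho>"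
    unfolding compatible_iff leaves_Es using fca_Es by metis
  then show ?thesis unfolding essential_cochain_def using \<rho> by blast
qed

lemma X_isomorphic_sym:
  "X_isomorphic_surfaces x \<gamma> \<gamma>' \<Longrightarrow> X_isomorphic_surfaces x \<gamma>' \<gamma>"
  unfolding X_isomorphic_surfaces_def isomorphic_over_def by blast

lemma isomorphic_if_equivalent:
  fixes x :: "'a::idom"
  assumes x: "x \<noteq> 0" and trees: "tree (fst \<gamma>)" "tree (fst \<gamma>')"
    and equiv: "equivalent_trees x \<gamma> \<gamma>'"
  shows "X_isomorphic_surfaces x \<gamma> \<gamma>'"
proof -
  interpret T: rooted_tree "fst \<gamma>" by unfold_locales (rule trees)
  interpret T': rooted_tree "fst \<gamma>'" by unfold_locales (rule trees)
  interpret S: surface_charts x \<gamma> by unfold_locales (rule x)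
  interpret S': surface_charts x \<gamma>' by unfold_locales (rule x)
  from equiv obtain \<rho> \<rho>' \<tau> a b c c' where
    c: "\<And>i. i \<in> S.I \<Longrightarrow> S.\<sigma> i = c + x ^ T.lv T.ess * \<rho> i"
    and c': "\<And>i. i \<in> S'.I \<Longrightarrow> S'.\<sigma> i = c' + x ^ T'.lv T'.ess * \<rho>' i"
    and \<tau>: "tree_iso (Es (fst \<gamma>')) (Es (fst \<gamma>)) \<tau>" and a: "a dvd 1"
    and dvd: "\<And>i. i \<in> S'.I \<Longrightarrow> x ^ level (Es (fst \<gamma>)) (\<tau> i) dvd a * \<rho>' i - \<rho> (\<tau> i) + b"
    unfolding equivalent_trees_def essential_cochain_def T'.leaves_Es by blast
  from a obtain a' where a': "a' * a = 1" by (metis dvdE mult.commute)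
  then have a0: "a \<noteq> 0" "a' \<noteq> 0" by auto
  from dvd obtain r where
    r: "\<And>i. i \<in> S'.I \<Longrightarrow> a * \<rho>' i - \<rho> (\<tau> i) + b = x ^ level (Es (fst \<gamma>)) (\<tau> i) * r i"
    unfolding dvd_def by metis
  have bij: "bij_betw \<tau> S'.I S.I" using tree_iso_leaves[OF \<tau>] by (simp add: T.leaves_Es T'.leaves_Es)
  have lv: "S.m (\<tau> i) = T.lv T.ess + level (Es (fst \<gamma>)) (\<tau> i)"
    "S'.m i = T'.lv T'.ess + level (Es (fst \<gamma>)) (\<tau> i)" if i: "i \<in> S'.I" for i
  proof -
    have "\<tau> i \<in> S.I" using bij i by (auto simp: bij_betw_def)
    then show "S.m (\<tau> i) = T.lv T.ess + level (Es (fst \<gamma>)) (\<tau> i)"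
      by (intro T.level_Es T.ess_le_leaf)
    have "i \<in> Field (Es (fst \<gamma>'))" using T'.ess_le_leaf[OF i] by (simp add: T'.Field_Es)
    then show "S'.m i = T'.lv T'.ess + level (Es (fst \<gamma>)) (\<tau> i)"
      using T'.level_Es[OF T'.ess_le_leaf[OF i]] tree_iso_level[OF \<tau>] by simp
  qed
  \<comment> \<open>Let \<open>u = c + x^k v\<close> and \<open>u' = c' + x^k' v'\<close>, where
    \<open>k\<close> and \<open>k'\<close> are the levels of the essential roots. The equivalence
    asks for \<open>v = a v' + b\<close>, and rewriting this in \<open>u\<close> and
    \<open>u'\<close> yields \<alpha> and \<beta>.\<close>
  define \<alpha> where "\<alpha> = to_fract a * S.y ^ T.lv T.ess / S.y ^ T'.lv T'.ess"
  define \<beta> where "\<beta> = to_fract c + S.y ^ T.lv T.ess * to_fract b - \<alpha> * to_fract c'"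
  have \<alpha>0: "\<alpha> \<noteq> 0" using a0 by (simp add: \<alpha>_def)
  \<comment> \<open>On charts the map is \<open>T = a * T' + r i\<close>; its constant term lies in
    \<open>A\<close> precisely by the divisibility in the definition of equivalence.\<close>
  have lin: "pcompose (S.L (\<tau> i)) (map_poly to_fract [:r i, a:]) = pcompose [:\<beta>, \<alpha>:] (S'.L i)"
    if i: "i \<in> S'.I" for i
  proof -
    let ?k = "level (Es (fst \<gamma>)) (\<tau> i)"
    have \<tau>i: "\<tau> i \<in> S.I" using bij i by (auto simp: bij_betw_def)
    have slope: "\<alpha> * S.y ^ S'.m i = to_fract a * S.y ^ S.m (\<tau> i)"
      using lv[OF i] by (simp add: \<alpha>_def power_add)
    have "\<beta> + \<alpha> * to_fract (S'.\<sigma> i) =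
        to_fract c + S.y ^ T.lv T.ess * to_fract b + (\<alpha> * S.y ^ T'.lv T'.ess) * to_fract (\<rho>' i)"
      by (simp add: \<beta>_def c'[OF i] S.y_def to_fract_power algebra_simps)
    also have "\<dots> = to_fract (c + x ^ T.lv T.ess * (a * \<rho>' i + b))"
      by (simp add: \<alpha>_def S.y_def[symmetric] to_fract_power algebra_simps)
    also have "a * \<rho>' i + b = \<rho> (\<tau> i) + x ^ ?k * r i"
      using r[OF i] by (simp add: algebra_simps)
    also have "to_fract (c + x ^ T.lv T.ess * (\<rho> (\<tau> i) + x ^ ?k * r i)) =
        to_fract (S.\<sigma> (\<tau> i)) + S.y ^ S.m (\<tau> i) * to_fract (r i)"
      using lv(1)[OF i] by (simp add: c[OF \<tau>i] S.y_def to_fract_power power_add algebra_simps)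
    finally show ?thesis using slope
      by (simp add: S.L_def S'.L_def map_poly_pCons pcompose_pCons mult.commute)
  qed
  have f: "chart_map x \<gamma>' \<gamma> \<tau> (\<lambda>i. [:r i, a:]) [:\<beta>, \<alpha>:]"
    by unfold_locales (use bij a0 \<alpha>0 lin in \<open>auto simp: bij_betw_def\<close>)
  define \<tau>' where "\<tau>' = inv_into S'.I \<tau>"
  have \<tau>': "\<tau>' i \<in> S'.I" "\<tau> (\<tau>' i) = i" if "i \<in> S.I" for i
    using bij that bij_betw_inv_into[OF bij] by (auto simp: \<tau>'_def bij_betw_def f_inv_into_f)
  have \<tau>'\<tau>: "\<tau>' (\<tau> i) = i" if "i \<in> S'.I" for i
    using bij that by (auto simp: \<tau>'_def bij_betw_def)
  define t where "t = (\<lambda>k. [:- (a' * r (\<tau>' k)), a':])"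
  have inv: "pcompose [:r (\<tau>' k), a:] (t k) = [:0, 1:]" "pcompose (t k) [:r (\<tau>' k), a:] = [:0, 1:]" for k
    using a' by (simp_all add: t_def pcompose_pCons mult.commute flip: mult.assoc)
  define \<theta> where "\<theta> = [:- \<beta> / \<alpha>, 1 / \<alpha>:]"
  have \<theta>: "pcompose \<theta> [:\<beta>, \<alpha>:] = [:0, 1:]"
    using \<alpha>0 by (simp add: \<theta>_def pcompose_pCons field_simps)
  have "pcompose (S'.L (\<tau>' k)) (map_poly to_fract (t k)) = pcompose \<theta> (S.L k)" if k: "k \<in> S.I" for k
  proof -
    \<comment> \<open>Inserting the identity as \<open>[:r (\<tau>' k), a:]\<close> composed with
      \<open>t k\<close> makes \<open>lin\<close> applicable, after which \<theta> cancels.\<close>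
    have "pcompose \<theta> (S.L k) = pcompose \<theta> (pcompose (S.L k) (map_poly to_fract (pcompose [:r (\<tau>' k), a:] (t k))))"
      by (simp add: inv map_poly_pCons)
    also have "\<dots> = pcompose \<theta> (pcompose (pcompose (S.L (\<tau> (\<tau>' k))) (map_poly to_fract [:r (\<tau>' k), a:])) (map_poly to_fract (t k)))"
      using k by (simp only: map_poly_pcompose pcompose_assoc \<tau>')
    also have "\<dots> = pcompose (pcompose \<theta> [:\<beta>, \<alpha>:]) (pcompose (S'.L (\<tau>' k)) (map_poly to_fract (t k)))"
      unfolding lin[OF \<tau>'(1)[OF k]] by (simp only: pcompose_assoc)
    finally show ?thesis unfolding \<theta> by (simp add: pcompose_pCons)
  qed
  then have g: "chart_map x \<gamma> \<gamma>' \<tau>' t \<theta>"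
    by unfold_locales (use \<tau>' a0 \<alpha>0 in \<open>auto simp: t_def \<theta>_def\<close>)
  have "pcompose (t (\<tau> i)) [:r i, a:] = [:0, 1:]" if "i \<in> S'.I" for i
    using inv(2)[of "\<tau> i"] \<tau>'\<tau>[OF that] by simp
  then show ?thesis
    using X_isomorphic_if_chart_maps[OF g f] \<tau>' \<tau>'\<tau> inv(1) by blast
qed

lemma equivalent_if_isomorphic:
  fixes x :: "'a::idom"
  assumes x: "prime_elem x" and lab: "labelled_tree x \<gamma>" "labelled_tree x \<gamma>'"
    and iso: "X_isomorphic_surfaces x \<gamma> \<gamma>'"
  shows "equivalent_trees x \<gamma> \<gamma>'"
proof -
  let ?I = "leaves (fst \<gamma>)" and ?I' = "leaves (fst \<gamma>')"
  let ?m = "level (fst \<gamma>)" and ?m' = "level (fst \<gamma>')"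
  let ?\<sigma> = "snd \<gamma>" and ?\<sigma>' = "snd \<gamma>'"
  interpret T: rooted_tree "fst \<gamma>" using lab by unfold_locales (simp add: labelled_tree_def)
  interpret T': rooted_tree "fst \<gamma>'" using lab by unfold_locales (simp add: labelled_tree_def)
  have x0: "x \<noteq> 0" using x by (simp add: prime_elem_def)
  obtain k where k: "k \<in> ?I'" using T'.leaf_above[OF T'.ess_Field] by blast
  then have "?I' \<noteq> {}" by blast
  \<comment> \<open>Applied from \<gamma>' to \<gamma>, the direction of the tree isomorphism in
    \<open>equivalent_trees\<close>.\<close>
  from affine_data_if_isomorphic[OF x X_isomorphic_sym[OF iso] this]
  obtain J \<alpha> \<beta> c e where J: "bij_betw J ?I' ?I"
    and e: "\<And>i. i \<in> ?I' \<Longrightarrow> e i dvd 1"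
    and slope: "\<And>i. i \<in> ?I' \<Longrightarrow> to_fract (x ^ ?m (J i) * e i) = \<alpha> * to_fract (x ^ ?m' i)"
    and offset: "\<And>i. i \<in> ?I' \<Longrightarrow>
      to_fract (?\<sigma> (J i) + x ^ ?m (J i) * c i) = \<alpha> * to_fract (?\<sigma>' i) + \<beta>"
    by blast
  have JI: "J i \<in> ?I" if "i \<in> ?I'" for i using J that by (auto simp: bij_betw_def)
  have Jne: "J i \<noteq> J l" if "i \<in> ?I'" "l \<in> ?I'" "i \<noteq> l" for i l
    using J that by (auto simp: bij_betw_def inj_on_def)
  \<comment> \<open>Eliminating \<alpha> between two slopes; the products are crosswise to avoid
    negative exponents.\<close>
  have shift: "?m (J i) + ?m' l = ?m (J l) + ?m' i \<and> e i = e l"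
    if il: "i \<in> ?I'" "l \<in> ?I'" for i l
  proof (rule power_times_unit_eq[OF x e[OF il(1)] e[OF il(2)]])
    have "to_fract (x ^ (?m (J i) + ?m' l) * e i) = to_fract (x ^ ?m (J i) * e i) * to_fract (x ^ ?m' l)"
      by (simp add: power_add mult_ac)
    also have "\<dots> = to_fract (x ^ ?m (J l) * e l) * to_fract (x ^ ?m' i)"
      unfolding slope[OF il(1)] slope[OF il(2)] by (simp add: mult_ac)
    also have "\<dots> = to_fract (x ^ (?m (J l) + ?m' i) * e l)" by (simp add: power_add mult_ac)
    finally show "x ^ (?m (J i) + ?m' l) * e i = x ^ (?m (J l) + ?m' i) * e l"
      by (simp only: to_fract_eq_iff)
  qed
  define a where "a = e k"
  have a: "a dvd 1" unfolding a_def by (rule e[OF k])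
  have ea: "e i = a" if "i \<in> ?I'" for i using shift[OF that k] by (simp add: a_def)
  \<comment> \<open>Subtracting two offsets removes \<beta>, and the slope at \<open>i\<close>
    removes \<alpha>.\<close>
  have diff: "x ^ ?m' i * (?\<sigma> (J l) - ?\<sigma> (J i) + (x ^ ?m (J l) * c l - x ^ ?m (J i) * c i)) =
      x ^ ?m (J i) * (a * (?\<sigma>' l - ?\<sigma>' i))" if il: "i \<in> ?I'" "l \<in> ?I'" for i l
  proof -
    have "to_fract (x ^ ?m' i * (?\<sigma> (J l) - ?\<sigma> (J i) + (x ^ ?m (J l) * c l - x ^ ?m (J i) * c i))) =
      to_fract (x ^ ?m' i) * (to_fract (?\<sigma> (J l) + x ^ ?m (J l) * c l) - to_fract (?\<sigma> (J i) + x ^ ?m (J i) * c i))"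
      by (simp add: algebra_simps)
    also have "\<dots> = (\<alpha> * to_fract (x ^ ?m' i)) * to_fract (?\<sigma>' l - ?\<sigma>' i)"
      unfolding offset[OF il(1)] offset[OF il(2)] by (simp add: algebra_simps)
    also have "\<dots> = to_fract (x ^ ?m (J i) * (a * (?\<sigma>' l - ?\<sigma>' i)))"
      unfolding slope[OF il(1), symmetric] ea[OF il(1)] by (simp add: mult_ac)
    finally show ?thesis by (simp only: to_fract_eq_iff)
  qed
  \<comment> \<open>The valuations of both sides of \<open>diff\<close>. The terms with
    \<open>c\<close> do not interfere, because leaves lie strictly above their first common
    ancestor.\<close>
  have fca: "?m (T.fca {J i, J l}) + ?m' i = ?m' (T'.fca {i, l}) + ?m (J i)"
    if il: "i \<in> ?I'" "l \<in> ?I'" "i \<noteq> l" for i l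
  proof -
    let ?d = "?m (T.fca {J i, J l})" and ?d' = "?m' (T'.fca {i, l})"
    note Jil = JI[OF il(1)] JI[OF il(2)] Jne[OF il]
    have "exact_power x ?d (?\<sigma> (J l) - ?\<sigma> (J i))"
      using lab(1) Jil unfolding labelled_tree_def compatible_iff by blast
    moreover have "x ^ Suc ?d dvd x ^ ?m (J l) * c l - x ^ ?m (J i) * c i"
      using T.lv_fca_less[OF Jil]
      by (intro dvd_diff dvd_mult2 le_imp_power_dvd) auto
    ultimately have "exact_power x (?m' i + ?d)
      (x ^ ?m' i * (?\<sigma> (J l) - ?\<sigma> (J i) + (x ^ ?m (J l) * c l - x ^ ?m (J i) * c i)))"
      by (simp only: exact_power_mult_power[OF x0] exact_power_add)
    moreover have "exact_power x ?d' (?\<sigma>' l - ?\<sigma>' i)"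
      using lab(2) il unfolding labelled_tree_def compatible_iff by blast
    then have "exact_power x (?m (J i) + ?d') (x ^ ?m (J i) * (a * (?\<sigma>' l - ?\<sigma>' i)))"
      by (simp only: exact_power_mult_power[OF x0] exact_power_mult_unit[OF a])
    ultimately show ?thesis
      unfolding diff[OF il(1,2)] using exact_power_unique by fastforce
  qed
  \<comment> \<open>By \<open>fca\<close> the levels of ancestors on the branch of \<open>i\<close>
    are shifted as the level of \<open>i\<close> is. The essential root is the lowest of these
    ancestors in either tree, which gives one inequality from each side; a single leaf is its own
    essential root.\<close>
  have ess: "?m (J i) + ?m' T'.ess = ?m' i + ?m T.ess" if i: "i \<in> ?I'" for i
  proof (cases "?I' = {i}")
    case True
    then have I: "?I = {J i}" using J by (auto simp: bij_betw_def)
    have "T.ess = J i" by (rule T.essential_root_cases) (use I in auto)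
    moreover have "T'.ess = i" by (rule T'.essential_root_cases) (use True in auto)
    ultimately show ?thesis by simp
  next
    case False
    then obtain l where l: "l \<in> ?I'" "i \<noteq> l" using i by blast
    obtain p where p: "p \<in> ?I'" "p \<noteq> i" "T'.fca {i, p} = T'.ess"
      using T'.fca_eq_ess[OF i l] by blast
    have "?m' i + ?m T.ess \<le> ?m (J i) + ?m' T'.ess"
      using fca[OF i p(1)] p T.lv_mono[OF T.ess_le_fca[OF JI[OF i] JI[OF p(1)] Jne[OF i p(1)]]]
      by auto
    moreover obtain q' where q': "q' \<in> ?I" "q' \<noteq> J i" "T.fca {J i, q'} = T.ess"
      using T.fca_eq_ess[OF JI[OF i] JI[OF l(1)] Jne[OF i l]] by blast
    then obtain q where q: "q \<in> ?I'" "q' = J q" using J by (auto simp: bij_betw_def)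
    then have "i \<noteq> q" using q' by blast
    then have "?m (J i) + ?m' T'.ess \<le> ?m' i + ?m T.ess"
      using fca[OF i q(1)] q q' T'.lv_mono[OF T'.ess_le_fca[OF i q(1)]] by auto
    ultimately show ?thesis by simp
  qed
  have Es_level: "level (Es (fst \<gamma>)) (J i) = level (Es (fst \<gamma>')) i" if i: "i \<in> ?I'" for i
    using ess[OF i] T.level_Es[OF T.ess_le_leaf[OF JI[OF i]]] T'.level_Es[OF T'.ess_le_leaf[OF i]]
    by simp
  have Es_fca: "level (Es (fst \<gamma>)) (first_common_ancestor (Es (fst \<gamma>)) {J i, J l}) =
      level (Es (fst \<gamma>')) (first_common_ancestor (Es (fst \<gamma>')) {i, l})"
    if il: "i \<in> ?I'" "l \<in> ?I'" "i \<noteq> l" for i l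
  proof -
    note Jil = JI[OF il(1)] JI[OF il(2)] Jne[OF il]
    show ?thesis
      unfolding T.fca_Es[OF Jil] T'.fca_Es[OF il]
      using fca[OF il] ess[OF il(1)] T.level_Es[OF T.ess_le_fca[OF Jil]]
        T'.level_Es[OF T'.ess_le_fca[OF il]] by simp
  qed
  obtain \<tau> where \<tau>: "tree_iso (Es (fst \<gamma>')) (Es (fst \<gamma>)) \<tau>" "\<And>i. i \<in> ?I' \<Longrightarrow> \<tau> i = J i"
    using ex_tree_iso[OF T'.tree_Es T.tree_Es, of J] J Es_level Es_fca
    unfolding T.leaves_Es T'.leaves_Es by blast
  obtain \<rho> where \<rho>: "essential_cochain x \<gamma> \<rho>" using ex_essential_cochain[OF x0 lab(1)] by blast
  then obtain s where s: "\<And>i. i \<in> ?I \<Longrightarrow> ?\<sigma> i = s + x ^ ?m T.ess * \<rho> i"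
    by (auto simp: essential_cochain_def)
  obtain \<rho>' where \<rho>': "essential_cochain x \<gamma>' \<rho>'" using ex_essential_cochain[OF x0 lab(2)] by blast
  then obtain s' where s': "\<And>i. i \<in> ?I' \<Longrightarrow> ?\<sigma>' i = s' + x ^ ?m' T'.ess * \<rho>' i"
    by (auto simp: essential_cochain_def)
  define n where "n i = level (Es (fst \<gamma>)) (J i)" for i
  \<comment> \<open>Normalised so that the equation below holds at the leaf \<open>k\<close>;
    \<open>diff\<close> carries it over to the other leaves.\<close>
  define b where "b = \<rho> (J k) + x ^ n k * c k - a * \<rho>' k"
  have "a * \<rho>' i - \<rho> (J i) + b = x ^ n i * c i" if i: "i \<in> ?I'" for i
  proof -
    have lv: "?m (J l) = ?m T.ess + n l" if "l \<in> ?I'" for l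
      unfolding n_def by (rule T.level_Es[OF T.ess_le_leaf[OF JI[OF that]]])
    have "x ^ (?m' k + ?m T.ess) * (\<rho> (J i) - \<rho> (J k) + (x ^ n i * c i - x ^ n k * c k)) =
        x ^ ?m' k * (?\<sigma> (J i) - ?\<sigma> (J k) + (x ^ ?m (J i) * c i - x ^ ?m (J k) * c k))"
      by (simp add: s JI i k lv power_add algebra_simps)
    also have "\<dots> = x ^ (?m (J k) + ?m' T'.ess) * (a * (\<rho>' i - \<rho>' k))"
      unfolding diff[OF k i] by (simp add: s' i k power_add algebra_simps)
    finally have "\<rho> (J i) - \<rho> (J k) + (x ^ n i * c i - x ^ n k * c k) = a * (\<rho>' i - \<rho>' k)"
      unfolding ess[OF k] using x0 by simp
    then show ?thesis by (simp add: b_def algebra_simps)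
  qed
  then have "x ^ level (Es (fst \<gamma>)) (\<tau> i) dvd a * \<rho>' i - \<rho> (\<tau> i) + b" if "i \<in> leaves (Es (fst \<gamma>'))" for i
    using that \<tau>(2) unfolding T'.leaves_Es n_def by simp
  then show ?thesis
    unfolding equivalent_trees_def using \<rho> \<rho>' \<tau>(1) a by blast
qed

section \<open>The base ring\<close>

text \<open>The ideal of multiples of \<open>x\<close> is a nonzero prime ideal, which is the
  definition of a prime element in terms of ideals.\<close>

lemma prime_elem_if_dvr_pair:
  assumes "dvr_pair K x"
  shows "prime_elem x"
proof -
  let ?A = "ring_of_type_algebra :: 'b ring"
  have "cgenideal ?A x = {a. x dvd a}"
    by (auto simp: cgenideal_def ring_of_type_algebra_def dvd_def mult.commute)
  moreover have "cgenideal ?A x \<in> {P. primeideal P ?A \<and> P \<noteq> {0}}"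
    using assms by (simp add: dvr_pair_def Let_def)
  moreover have "?A = subring_of_type UNIV"
    by (simp add: subring_of_type_def ring_of_type_algebra_def)
  ultimately have P: "{a. x dvd a} \<in> primes UNIV" and ne: "{a. x dvd a} \<noteq> {0}"
    by (simp_all add: primes_def)
  show ?thesis
    unfolding prime_elem_def
    using one_notin_prime[OF P] prime_mult_iff[OF P] ne by auto
qed

text \<open>Divisibility by the variable is vanishing at 0, and evaluation at 0 is multiplicative
  with values in a field.\<close>

lemma prime_elem_if_polynomial_ring_pair:
  fixes x :: "'a::idom"
  assumes "polynomial_ring_pair TYPE('k::field) x"
  shows "prime_elem x"
proof -
  from assms obtain h where h: "h \<in> ring_iso (ring_of_type_algebra :: 'k poly ring) (ring_of_type_algebra :: 'a ring)"
    and hx: "h [:0, 1:] = x" by (auto simp: polynomial_ring_pair_def)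
  have mult: "h (p * q) = h p * h q" and add: "h (p + q) = h p + h q" and one: "h 1 = 1" for p q
    using h by (auto simp: ring_iso_def ring_hom_def ring_of_type_algebra_def)
  have bij: "bij h" using h by (simp add: ring_iso_def ring_of_type_algebra_def)
  have zero: "h 0 = 0" using add[of 0 0] by (metis add.right_neutral add_left_cancel)
  have dvd: "x dvd h p \<longleftrightarrow> poly p 0 = 0" for p
  proof -
    have "x dvd h p \<longleftrightarrow> [:0, 1:] dvd p"
      unfolding dvd_def hx[symmetric] using bij mult by (metis bij_pointE)
    then show ?thesis using poly_eq_0_iff_dvd[of p 0] by simp
  qed
  have "x \<noteq> 0" using hx zero bij by (metis bij_pointE one_pCons pCons_eq_0_iff zero_neq_one)
  moreover have "\<not> x dvd 1" using dvd[of 1] one by simp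
  moreover have "x dvd z \<or> x dvd w" if "x dvd z * w" for z w
  proof -
    obtain p q where "z = h p" "w = h q" using bij by (metis bij_pointE)
    then show ?thesis using that dvd by (simp flip: mult)
  qed
  ultimately show ?thesis unfolding prime_elem_def by blast
qed

theorem theorem3p10:
  fixes x :: "'a::idom"
    and \<gamma> :: "'v rel \<times> ('v \<Rightarrow> 'a)"
    and \<gamma>' :: "'w rel \<times> ('w \<Rightarrow> 'a)"
  assumes "dvr_pair TYPE('k::field_char_0) x \<or> polynomial_ring_pair TYPE('k) x"
    and "labelled_tree x \<gamma>" and "labelled_tree x \<gamma>'"
  shows "X_isomorphic_surfaces x \<gamma> \<gamma>' \<longleftrightarrow> equivalent_trees x \<gamma> \<gamma>'"
proof -
  have x: "prime_elem x"
    using assms(1) prime_elem_if_dvr_pair prime_elem_if_polynomial_ring_pair by blast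
  then have "x \<noteq> 0" by (simp add: prime_elem_def)
  moreover have "tree (fst \<gamma>)" "tree (fst \<gamma>')" using assms(2,3) by (simp_all add: labelled_tree_def)
  ultimately show ?thesis
    using equivalent_if_isomorphic[OF x assms(2,3)] isomorphic_if_equivalent by blast
qed

end
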